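(* Let $1<p<\infty$, $0<\alpha<\infty$ and $w\in A_p^{\mathrm{restricted}}$. Then there exists $r_0>0$ such that for any $r\in(0,r_0)$, the space $F^p_{\alpha,w}$ consists exactly of the functions $$f(z)=\sum_{\nu\in r\mathbb{Z}^2}c_{\nu}\frac{K_{\nu}(z)}{\|K_{\nu}\|_{F^p_{\alpha,w}}},\quad z\in\mathbb{C},\qquad(\ast)$$ where $\{c_{\nu}\}_{\nu\in r\mathbb{Z}^2}\in l^p(r\mathbb{Z}^2)$. Moreover, for each such $r$ there exists $C=C(p,\alpha,r,w)\geq1$ such that for all $f\in F^p_{\alpha,w}$, $$C^{-1}\|f\|_{F^p_{\alpha,w}}\leq \inf\|\{c_{\nu}\}\|_{l^p(r\mathbb{Z}^2)}\leq C\|f\|_{F^p_{\alpha,w}},$$ where the infimum is taken over all sequences $\{c_{\nu}\}\in l^p(r\mathbb{Z}^2)$ that give rise to the decomposition $(\ast)$ of $f$.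
   Context: $dA$ is Lebesgue measure on $\mathbb{C}$. A weight is a non-negative locally integrable function $w$ on $\mathbb{C}$. Squares $Q\subset\mathbb{C}$ have sides parallel to the coordinate axes and side length $\ell(Q)$. For $1<p<\infty$ with conjugate exponent $p'$ ($1/p+1/p'=1$), $A_p^{\mathrm{restricted}}$ is the class of weights $w$ such that for some (equivalently any) fixed $r>0$, $$\sup_{Q:\ell(Q)=r}\Big(\frac{1}{A(Q)}\int_{Q}w\,dA\Big)\Big(\frac{1}{A(Q)}\int_{Q}w^{-p'/p}dA\Big)^{p/p'}<\infty$$ (convention $0\cdot\infty=\infty$, so $w>0$ a.e.). $F^p_{\alpha,w}$ is the space of entire functions $f$ on $\mathbb{C}$ with $\|f\|^p_{F^p_{\alpha,w}}:=\int_{\mathbb{C}}|f(z)|^pe^{-\frac{p\alpha}{2}|z|^2}w(z)\,dA(z)<\infty$. For $a\in\mathbb{C}$, $K_a(z):=e^{\alpha\overline{a}z}$. The lattice $r\mathbb{Z}^2$ is viewed as a subset of $\mathbb{C}$ via $\mathbb{R}^2\cong\mathbb{C}$. *)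

theory Defs
  imports "HOL-Analysis.Analysis"
begin

definition conj_exponent :: "real \<Rightarrow> real"
  where "conj_exponent p = p / (p - 1)"

lemma conj_exponent_eq:
  assumes "1 < p"
  shows "1 / p + 1 / conj_exponent p = 1"
  using assms by (simp add: conj_exponent_def field_simps)

definition weight :: "(complex \<Rightarrow> real) \<Rightarrow> bool"
  where "weight w \<longleftrightarrow>
    w \<in> borel_measurable lebesgue \<and> (\<forall>z. 0 \<le> w z) \<and>
    (\<forall>K. compact K \<longrightarrow> set_integrable lebesgue K w)"

text \<open>Powers with values in \<open>[0,\<infinity>]\<close>: \<open>neg_power t s\<close> is \<open>t\<close> to the power \<open>-s\<close> for real \<open>t \<ge> 0\<close>
  and \<open>s > 0\<close>, with value \<open>\<infinity>\<close> at \<open>t = 0\<close> (whereas \<open>0 powr (- s) = 0\<close>), and \<open>ennreal_power\<close> is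
  the power with a positive exponent.\<close>

definition neg_power :: "real \<Rightarrow> real \<Rightarrow> ennreal"
  where "neg_power t s = (if t = 0 then \<infinity> else ennreal (t powr (- s)))"

definition ennreal_power :: "ennreal \<Rightarrow> real \<Rightarrow> ennreal"
  where "ennreal_power x s = (if x = \<infinity> then \<infinity> else ennreal (enn2real x powr s))"

text \<open>Multiplication with \<open>0 \<cdot> \<infinity> = \<infinity>\<close>; in the type \<open>ennreal\<close> this product is \<open>0\<close>.\<close>

definition mult_inf :: "ennreal \<Rightarrow> ennreal \<Rightarrow> ennreal"
  where "mult_inf x y = (if x = \<infinity> \<or> y = \<infinity> then \<infinity> else x * y)"

definition square :: "complex \<Rightarrow> real \<Rightarrow> complex set"
  where "square a l = cbox a (a + Complex l l)"

definition average :: "complex set \<Rightarrow> (complex \<Rightarrow> ennreal) \<Rightarrow> ennreal"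
  where "average Q g = (\<integral>\<^sup>+z\<in>Q. g z \<partial>lebesgue) / emeasure lebesgue Q"

definition Ap_restricted :: "real \<Rightarrow> (complex \<Rightarrow> real) set"
  where "Ap_restricted p = {w. weight w \<and>
    (\<exists>r>0. (SUP a. mult_inf
        (average (square a r) (\<lambda>z. ennreal (w z)))
        (ennreal_power
          (average (square a r) (\<lambda>z. neg_power (w z) (conj_exponent p / p)))
          (p / conj_exponent p))) < \<infinity>)}"

definition fock_integrand ::
    "real \<Rightarrow> real \<Rightarrow> (complex \<Rightarrow> real) \<Rightarrow> (complex \<Rightarrow> complex) \<Rightarrow> complex \<Rightarrow> real"
  where "fock_integrand p \<alpha> w f z =
    norm (f z) powr p * exp (- (p * \<alpha> / 2) * (norm z)\<^sup>2) * w z"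

definition fock_space ::
    "real \<Rightarrow> real \<Rightarrow> (complex \<Rightarrow> real) \<Rightarrow> (complex \<Rightarrow> complex) set"
  where "fock_space p \<alpha> w =
    {f. f holomorphic_on UNIV \<and> integrable lebesgue (fock_integrand p \<alpha> w f)}"

definition fock_norm ::
    "real \<Rightarrow> real \<Rightarrow> (complex \<Rightarrow> real) \<Rightarrow> (complex \<Rightarrow> complex) \<Rightarrow> real"
  where "fock_norm p \<alpha> w f = (integral\<^sup>L lebesgue (fock_integrand p \<alpha> w f)) powr (1 / p)"

definition fock_kernel :: "real \<Rightarrow> complex \<Rightarrow> complex \<Rightarrow> complex"
  where "fock_kernel \<alpha> a z = exp (of_real \<alpha> * cnj a * z)"

definition lattice_pts :: "real \<Rightarrow> complex set"
  where "lattice_pts r = {Complex (r * of_int m) (r * of_int n) | m n. True}"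

text \<open>A sequence indexed by \<open>A\<close> is a function on \<open>complex\<close> whose values outside \<open>A\<close> are ignored.\<close>

definition lp_space :: "real \<Rightarrow> complex set \<Rightarrow> (complex \<Rightarrow> complex) set"
  where "lp_space p A = {c. (\<lambda>\<nu>. norm (c \<nu>) powr p) summable_on A}"

definition lp_norm :: "real \<Rightarrow> complex set \<Rightarrow> (complex \<Rightarrow> complex) \<Rightarrow> real"
  where "lp_norm p A c = (\<Sum>\<^sub>\<infinity>\<nu>\<in>A. norm (c \<nu>) powr p) powr (1 / p)"

text \<open>The series is summed pointwise and unconditionally (hence absolutely), since the lattice
  carries no preferred enumeration.\<close>

definition atomic_decomposition ::
    "real \<Rightarrow> real \<Rightarrow> (complex \<Rightarrow> real) \<Rightarrow> real \<Rightarrow>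
     (complex \<Rightarrow> complex) \<Rightarrow> (complex \<Rightarrow> complex) \<Rightarrow> bool"
  where "atomic_decomposition p \<alpha> w r c f \<longleftrightarrow>
    (\<forall>z. ((\<lambda>\<nu>. c \<nu> * (fock_kernel \<alpha> \<nu> z / of_real (fock_norm p \<alpha> w (fock_kernel \<alpha> \<nu>))))
           has_sum f z) (lattice_pts r))"

end

theory Submission
  imports Defs "HOL-Complex_Analysis.Complex_Analysis" "HOL-Probability.Distributions"
begin

text \<open>The restricted \<open>A\<^sub>p\<close> condition at one scale \<open>s\<close> makes the masses \<open>W\<close> of squares of side \<open>s\<close>
  comparable up to a factor exponential in their distance, so Gaussians absorb them; with the
  sub-mean value property of entire functions it also bounds \<open>W(\<nu>) \<bar>f(\<nu>)\<bar>\<^sup>p exp(-p\<alpha>\<bar>\<nu>\<bar>\<^sup>2/2)\<close> by the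
  local part of the norm of \<open>f\<close>. The first fact and Hoelder's inequality make the series converge in
  norm. For the converse, \<open>f\<close> satisfies the reproducing formula of the unweighted Fock space; replacing
  that integral by its Riemann sum over \<open>r\<int>\<^sup>2\<close> gives an operator \<open>T\<close> whose values are kernel series, with
  \<open>\<parallel>f - T f\<parallel> \<le> C r \<parallel>f\<parallel>\<close>. For small \<open>r\<close> the iterates of \<open>f \<mapsto> f - T f\<close> decay geometrically and
  the coefficients of their images under \<open>T\<close> add up to coefficients for \<open>f\<close>.\<close>

subsection \<open>Lebesgue measure on the complex plane\<close>

text \<open>The A_p condition enters through one inequality, W(a) (int_Q g)^p <= B int_Q g^p w on
  the square Q around a, in which the dual weight no longer occurs. Tested on indicators it compares
  masses; tested on the modulus of an entire function it gives the local bound. Such weights may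
  decay exponentially, so f need not belong to the unweighted space. The reproducing formula is
  therefore derived from the mean value property against radial densities, and its integrability
  from a pointwise bound exp(kappa |z| / p) on the Gaussian-normalised modulus. Two scales are kept
  apart: s is fixed by the weight, r is the mesh. The constants of the norm equivalence may depend
  on r, but the constant of the error estimate must not; hence its lattice sums carry the weight r^2
  and are treated as integrals of step functions. The gain r comes from the oscillation of the
  integrand over a cell, measured relative to the local supremum of f.\<close>

lemma borel_measurable_Complex [measurable (raw)]:
  assumes "f \<in> borel_measurable M" "g \<in> borel_measurable M"
  shows "(\<lambda>x. Complex (f x) (g x)) \<in> borel_measurable M"
  using assms by (simp add: borel_measurable_complex_iff)

text \<open>The plane carries its own Lebesgue measure as a Euclidean space; this identification
  opens it to Fubini's theorem. Agreement on boxes determines the measure.\<close>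

lemma lborel_complex_prod:
  "(lborel :: complex measure) = distr (lborel \<Otimes>\<^sub>M lborel) borel (\<lambda>(x, y). Complex x y)"
proof (rule lborel_eqI)
  have m [measurable]: "(\<lambda>(x, y). Complex x y) \<in> borel_measurable (lborel \<Otimes>\<^sub>M lborel)"
    unfolding case_prod_beta by measurable
  fix l u :: complex
  assume le: "\<And>b. b \<in> Basis \<Longrightarrow> l \<bullet> b \<le> u \<bullet> b"
  have "(\<lambda>(x, y). Complex x y) -` box l u = {Re l<..<Re u} \<times> {Im l<..<Im u}"
    by (auto simp: in_box_complex_iff)
  then have "emeasure (distr (lborel \<Otimes>\<^sub>M lborel) borel (\<lambda>(x, y). Complex x y)) (box l u) =
      emeasure (lborel \<Otimes>\<^sub>M lborel) ({Re l<..<Re u} \<times> {Im l<..<Im u})"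
    by (subst emeasure_distr) (auto simp: space_pair_measure)
  also have "\<dots> = (\<Prod>b\<in>Basis. (u - l) \<bullet> b)"
    using le[of 1] le[of \<i>]
    by (subst lborel.emeasure_pair_measure_Times)
       (auto simp: Basis_complex_def ennreal_mult)
  finally show "emeasure (distr (lborel \<Otimes>\<^sub>M lborel) borel (\<lambda>(x, y). Complex x y)) (box l u) =
      (\<Prod>b\<in>Basis. (u - l) \<bullet> b)" .
qed simp

lemma nn_integral_complex:
  assumes [measurable]: "f \<in> borel_measurable (borel :: complex measure)"
  shows "(\<integral>\<^sup>+z. f z \<partial>lborel) = (\<integral>\<^sup>+y. \<integral>\<^sup>+x. f (Complex x y) \<partial>lborel \<partial>lborel)"
    and "(\<integral>\<^sup>+z. f z \<partial>lborel) = (\<integral>\<^sup>+x. \<integral>\<^sup>+y. f (Complex x y) \<partial>lborel \<partial>lborel)"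
proof -
  have m [measurable]: "(\<lambda>(x, y). Complex x y) \<in> borel_measurable (lborel \<Otimes>\<^sub>M lborel)"
    unfolding case_prod_beta by measurable
  have "(\<integral>\<^sup>+z. f z \<partial>lborel) = (\<integral>\<^sup>+q. f (Complex (fst q) (snd q)) \<partial>(lborel \<Otimes>\<^sub>M lborel))"
    by (subst lborel_complex_prod, subst nn_integral_distr) (auto simp: case_prod_beta)
  moreover have m2: "(\<lambda>q. f (Complex (fst q) (snd q))) \<in> borel_measurable (lborel \<Otimes>\<^sub>M lborel)"
    using measurable_compose[OF m assms] by (simp add: case_prod_beta)
  ultimately show "(\<integral>\<^sup>+z. f z \<partial>lborel) = (\<integral>\<^sup>+y. \<integral>\<^sup>+x. f (Complex x y) \<partial>lborel \<partial>lborel)"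
    "(\<integral>\<^sup>+z. f z \<partial>lborel) = (\<integral>\<^sup>+x. \<integral>\<^sup>+y. f (Complex x y) \<partial>lborel \<partial>lborel)"
    using lborel_pair.nn_integral_snd[of "\<lambda>q. f (Complex (fst q) (snd q))"]
      lborel.nn_integral_fst[of "\<lambda>q. f (Complex (fst q) (snd q))" lborel] by auto
qed

lemma nn_integral_translate:
  fixes f :: "'a :: euclidean_space \<Rightarrow> ennreal"
  assumes [measurable]: "f \<in> borel_measurable borel"
  shows "(\<integral>\<^sup>+x. f (c + x) \<partial>lborel) = (\<integral>\<^sup>+x. f x \<partial>lborel)"
  by (subst lborel_distr_plus[of c, symmetric], subst nn_integral_distr) auto

definition shear_Re :: "real \<Rightarrow> complex \<Rightarrow> complex"
  where "shear_Re t z = Complex (t * Im z + Re z) (Im z)"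

definition shear_Im :: "real \<Rightarrow> complex \<Rightarrow> complex"
  where "shear_Im t z = Complex (Re z) (t * Re z + Im z)"

lemma shear_measurable [measurable]:
  "shear_Re t \<in> borel_measurable borel" "shear_Im t \<in> borel_measurable borel"
  unfolding shear_Re_def shear_Im_def by measurable

text \<open>A shear translates each horizontal (or vertical) line by an amount constant on that
  line, so Fubini and translation invariance in one real variable suffice. Rotations are built from
  these maps.\<close>

lemma nn_integral_shear:
  assumes [measurable]: "f \<in> borel_measurable (borel :: complex measure)"
  shows "(\<integral>\<^sup>+z. f (shear_Re t z) \<partial>lborel) = (\<integral>\<^sup>+z. f z \<partial>lborel)"
    and "(\<integral>\<^sup>+z. f (shear_Im t z) \<partial>lborel) = (\<integral>\<^sup>+z. f z \<partial>lborel)"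
proof -
  have "(\<integral>\<^sup>+z. f (shear_Re t z) \<partial>lborel) =
      (\<integral>\<^sup>+y. \<integral>\<^sup>+x. f (Complex (t * y + x) y) \<partial>lborel \<partial>lborel)"
    by (subst nn_integral_complex(1)) (auto simp: shear_Re_def)
  also have "\<dots> = (\<integral>\<^sup>+y. \<integral>\<^sup>+x. f (Complex x y) \<partial>lborel \<partial>lborel)"
    by (intro nn_integral_cong nn_integral_translate[where f = "\<lambda>x. f (Complex x y)" for y]) simp
  finally show "(\<integral>\<^sup>+z. f (shear_Re t z) \<partial>lborel) = (\<integral>\<^sup>+z. f z \<partial>lborel)"
    by (simp add: nn_integral_complex(1))
  have "(\<integral>\<^sup>+z. f (shear_Im t z) \<partial>lborel) =
      (\<integral>\<^sup>+x. \<integral>\<^sup>+y. f (Complex x (t * x + y)) \<partial>lborel \<partial>lborel)"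
    by (subst nn_integral_complex(2)) (auto simp: shear_Im_def)
  also have "\<dots> = (\<integral>\<^sup>+x. \<integral>\<^sup>+y. f (Complex x y) \<partial>lborel \<partial>lborel)"
    by (intro nn_integral_cong nn_integral_translate[where f = "\<lambda>y. f (Complex x y)" for x]) simp
  finally show "(\<integral>\<^sup>+z. f (shear_Im t z) \<partial>lborel) = (\<integral>\<^sup>+z. f z \<partial>lborel)"
    by (simp add: nn_integral_complex(2))
qed

text \<open>A rotation by an angle other than \<open>\<pi>\<close> is a product of three shears.\<close>

lemma nn_integral_rotate_generic:
  assumes [measurable]: "f \<in> borel_measurable (borel :: complex measure)"
    and "norm u = 1" "Im u \<noteq> 0"
  shows "(\<integral>\<^sup>+z. f (u * z) \<partial>lborel) = (\<integral>\<^sup>+z. f z \<partial>lborel)"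
proof -
  \<comment> \<open>For u = exp(i theta) this is tan(theta/2), the coefficient of the classical
    factorisation into three shears; \<open>t\<close> and \<open>t2\<close> are the half-angle
    formulas.\<close>
  define t where "t = (1 - Re u) / Im u"
  have u: "Re u * Re u + Im u * Im u = 1"
    using assms(2) by (metis cmod_power2 one_power2 power2_eq_square)
  have t: "t * Im u = 1 - Re u"
    using assms(3) by (simp add: t_def)
  have t2: "t * (1 + Re u) = Im u"
    using u assms(3) by (simp add: t_def field_simps)
  have "shear_Re (- t) (shear_Im (Im u) (shear_Re (- t) z)) = u * z" for z
    using t t2 by (simp add: shear_Re_def shear_Im_def complex_eq_iff) algebra
  then have "(\<integral>\<^sup>+z. f (u * z) \<partial>lborel) =
      (\<integral>\<^sup>+z. f (shear_Re (- t) (shear_Im (Im u) (shear_Re (- t) z))) \<partial>lborel)"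
    by simp
  also have "\<dots> = (\<integral>\<^sup>+z. f z \<partial>lborel)"
    by (subst nn_integral_shear(1)[of "\<lambda>z. f (shear_Re (- t) (shear_Im (Im u) z))"], measurable,
        subst nn_integral_shear(2)[of "\<lambda>z. f (shear_Re (- t) z)"], measurable,
        subst nn_integral_shear(1), auto)
  finally show ?thesis .
qed

lemma nn_integral_rotate:
  assumes [measurable]: "f \<in> borel_measurable (borel :: complex measure)" and "norm u = 1"
  shows "(\<integral>\<^sup>+z. f (u * z) \<partial>lborel) = (\<integral>\<^sup>+z. f z \<partial>lborel)"
proof (cases "Im u = 0")
  case True
  \<comment> \<open>Rotation by pi has no half-angle tangent, so it is composed of two quarter
    turns.\<close>
  have "(\<integral>\<^sup>+z. f (\<i> * (\<i> * z)) \<partial>lborel) = (\<integral>\<^sup>+z. f (\<i> * z) \<partial>lborel)"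
    using nn_integral_rotate_generic[of "\<lambda>z. f (\<i> * z)" \<i>] by simp
  also have "\<dots> = (\<integral>\<^sup>+z. f z \<partial>lborel)"
    using nn_integral_rotate_generic[of f \<i>] by simp
  finally have "(\<integral>\<^sup>+z. f (- z) \<partial>lborel) = (\<integral>\<^sup>+z. f z \<partial>lborel)"
    by simp
  moreover have "u = 1 \<or> u = - 1"
    using assms(2) True by (auto simp: complex_eq_iff cmod_def)
  ultimately show ?thesis by auto
qed (use nn_integral_rotate_generic assms in auto)

lemma lborel_distr_rotate:
  assumes "norm (u :: complex) = 1"
  shows "distr lborel borel ((*) u) = lborel"
proof (rule measure_eqI)
  fix A assume "A \<in> sets (distr lborel borel ((*) u))"
  then have [measurable]: "A \<in> sets borel" by simp
  have "emeasure (distr lborel borel ((*) u)) A = (\<integral>\<^sup>+z. indicator A (u * z) \<partial>lborel)"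
    by (subst nn_integral_indicator[symmetric], simp, subst nn_integral_distr) auto
  also have "\<dots> = emeasure lborel A"
    using nn_integral_rotate[of "indicator A" u] assms by simp
  finally show "emeasure (distr lborel borel ((*) u)) A = emeasure lborel A" .
qed simp

lemma nn_integral_gaussian_finite:
  assumes "\<beta> > 0"
  shows "(\<integral>\<^sup>+z. ennreal (exp (- \<beta> * (norm (z :: complex))\<^sup>2)) \<partial>lborel) < \<infinity>"
proof -
  have real: "(\<integral>\<^sup>+x. ennreal (exp (- \<beta> * x\<^sup>2)) \<partial>lborel) < \<infinity>"
  proof -
    have i: "integrable lborel (\<lambda>x. exp (- x\<^sup>2) :: real)"
      using has_bochner_integral_even_function[OF gaussian_moment_0]
      by (auto simp: has_bochner_integral_iff)
    have "integrable lborel (\<lambda>x. exp (- (0 + sqrt \<beta> * x)\<^sup>2))"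
      by (rule lborel_integrable_real_affine[OF i]) (use assms in simp)
    then show ?thesis
      using assms by (simp add: power_mult_distrib integrable_iff_bounded)
  qed
  have "(\<integral>\<^sup>+z. ennreal (exp (- \<beta> * (norm (z :: complex))\<^sup>2)) \<partial>lborel) =
      (\<integral>\<^sup>+z. (\<Prod>b\<in>Basis. ennreal (exp (- \<beta> * ((z :: complex) \<bullet> b)\<^sup>2))) \<partial>lborel)"
    by (intro nn_integral_cong)
       (simp add: Basis_complex_def cmod_power2 exp_add[symmetric] ennreal_mult[symmetric] algebra_simps
         del: ennreal_mult' ennreal_mult'')
  also have "\<dots> = (\<Prod>b\<in>(Basis :: complex set). (\<integral>\<^sup>+x. ennreal (exp (- \<beta> * x\<^sup>2)) \<partial>lborel))"
    by (subst nn_integral_lborel_prod[symmetric, where f = "\<lambda>_ x. ennreal (exp (- \<beta> * x\<^sup>2))"]) auto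
  also have "\<dots> < \<infinity>"
    using real by (simp add: Basis_complex_def ennreal_mult_less_top)
  finally show ?thesis .
qed

subsection \<open>Mean values and lattice sums\<close>

text \<open>Cauchy's formula on the unit circle for the rescaled function u |-> g(u \<zeta>) covers
  all radii at once, including \<zeta> = 0, and leaves the rotation explicit for averaging.\<close>

lemma circle_mean_value:
  assumes "g holomorphic_on UNIV"
  shows "((\<lambda>t. g (exp (2 * of_real pi * \<i> * of_real t) * \<zeta>)) has_integral g 0) {0..1}"
proof -
  define G where "G = (\<lambda>u. g (u * \<zeta>))"
  have "G holomorphic_on cball 0 1"
    unfolding G_def
    by (rule holomorphic_on_compose_gen[of _ _ g, unfolded o_def, OF _ assms])
       (auto intro!: holomorphic_intros)
  then have "((\<lambda>u. G u / (u - 0)) has_contour_integral (2 * of_real pi * \<i> * G 0)) (circlepath 0 1)"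
    by (intro Cauchy_integral_circlepath_simple) auto
  then have "((\<lambda>t. (2 * of_real pi * \<i>) * G (exp (2 * of_real pi * \<i> * of_real t))) has_integral
      (2 * of_real pi * \<i> * G 0)) {0..1}"
    unfolding has_contour_integral_def
    by (rule has_integral_eq[rotated])
       (simp add: vector_derivative_circlepath01, simp add: circlepath)
  from has_integral_mult_right[OF this, of "1 / (2 * of_real pi * \<i>)"] show ?thesis
    by (simp add: G_def)
qed

text \<open>Lebesgue measure and \<open>\<phi>\<close> are rotation invariant, so averaging over
  rotations leaves the absolute value of nothing but \<open>g\<close> affected; after exchanging the
  integrals, the mean over each circle turns \<open>g\<close> into \<open>g 0\<close>. Applied with
  a disc indicator and with a Gaussian, it takes the place of polar coordinates.\<close>

lemma radial_mean_value:
  fixes g :: "complex \<Rightarrow> complex" and \<phi> :: "complex \<Rightarrow> real"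
  assumes g: "g holomorphic_on UNIV"
    and \<phi>: "\<And>u z. norm u = 1 \<Longrightarrow> \<phi> (u * z) = \<phi> z"
    and [measurable]: "\<phi> \<in> borel_measurable borel"
    and int: "integrable lborel (\<lambda>z. g z * of_real (\<phi> z))"
  shows "(\<integral>z. g z * of_real (\<phi> z) \<partial>lborel) = g 0 * of_real (\<integral>z. \<phi> z \<partial>lborel)"
proof -
  have contg: "continuous_on UNIV g"
    using g holomorphic_on_imp_continuous_on by blast
  then have [measurable]: "g \<in> borel_measurable borel"
    by (rule borel_measurable_continuous_onI)
  define e where "e = (\<lambda>t::real. exp (2 * of_real pi * \<i> * of_real t))"
  have ne: "norm (e t) = 1" for t
    by (simp add: e_def norm_exp_eq_Re)
  have [measurable]: "e \<in> borel_measurable borel"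
    unfolding e_def by (intro borel_measurable_continuous_onI continuous_intros)
  define \<Phi> where "\<Phi> = (\<lambda>z. g z * of_real (\<phi> z))"
  have [measurable]: "\<Phi> \<in> borel_measurable borel"
    unfolding \<Phi>_def by measurable
  have int\<Phi>: "integrable lborel (\<lambda>z. \<Phi> (e t * z))" for t
    using int lborel_distr_rotate[OF ne, of t]
    by (subst integrable_distr_eq[symmetric, where N = borel]) (auto simp: \<Phi>_def)
  have eq\<Phi>: "(\<integral>z. \<Phi> (e t * z) \<partial>lborel) = (\<integral>z. \<Phi> z \<partial>lborel)" for t
    by (subst integral_distr[symmetric, where N = borel]) (auto simp: lborel_distr_rotate ne)
  have eqn\<Phi>: "(\<integral>z. norm (\<Phi> (e t * z)) \<partial>lborel) = (\<integral>z. norm (\<Phi> z) \<partial>lborel)" for t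
    by (subst integral_distr[symmetric, where N = borel, where f = "\<lambda>z. norm (\<Phi> z)"])
       (auto simp: lborel_distr_rotate ne)
  \<comment> \<open>The rotation parameter becomes an extra variable in the probability space [0,1],
    so that Fubini can be applied to a function on a product.\<close>
  define F where "F = (\<lambda>(t, z). indicator {0..1} t *\<^sub>R \<Phi> (e t * z))"
  have [measurable]: "F \<in> borel_measurable (lborel \<Otimes>\<^sub>M lborel)"
    unfolding F_def by measurable
  have intF: "integrable (lborel \<Otimes>\<^sub>M lborel) F"
  proof (rule lborel_pair.Fubini_integrable)
    have "(\<lambda>t. \<integral>z. norm (F (t, z)) \<partial>lborel) = (\<lambda>t. indicator {0..1} t *\<^sub>R (\<integral>z. norm (\<Phi> z) \<partial>lborel))"
      by (auto simp: F_def eqn\<Phi>)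
    moreover have "integrable lborel (\<lambda>t. indicator {0..1::real} t *\<^sub>R (\<integral>z. norm (\<Phi> z) \<partial>lborel))"
      by (intro integrable_scaleR_left integrable_real_indicator) auto
    ultimately show "integrable lborel (\<lambda>t. \<integral>z. norm (F (t, z)) \<partial>lborel)"
      by (simp only:)
  qed (auto simp: F_def int\<Phi>)
  have inner: "(\<integral>t. F (t, z) \<partial>lborel) = g 0 * of_real (\<phi> z)" for z
  proof -
    have "continuous_on {0..1} (\<lambda>t. g (e t * z))"
      unfolding e_def
      by (rule continuous_on_compose2[OF contg]) (auto intro!: continuous_intros)
    then have "set_integrable lborel {0..1} (\<lambda>t. g (e t * z))"
      unfolding set_integrable_def by (intro borel_integrable_compact) auto
    then have "(LINT t:{0..1}|lborel. g (e t * z)) = integral {0..1} (\<lambda>t. g (e t * z))"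
      by (rule set_borel_integral_eq_integral)
    also have "\<dots> = g 0"
      using circle_mean_value[OF g, of z] by (simp add: e_def integral_unique)
    finally have "(LINT t:{0..1}|lborel. g (e t * z)) * of_real (\<phi> z) = g 0 * of_real (\<phi> z)"
      by simp
    then show ?thesis
      by (simp add: F_def \<Phi>_def \<phi> ne set_lebesgue_integral_def scaleR_conv_of_real mult.assoc
          flip: integral_mult_left_zero)
  qed
  have "(\<integral>z. \<Phi> z \<partial>lborel) = (LINT t:{0..1::real}|lborel. (\<integral>z. \<Phi> z \<partial>lborel))"
    by (simp add: set_lebesgue_integral_def)
  also have "\<dots> = (\<integral>t. \<integral>z. F (t, z) \<partial>lborel \<partial>lborel)"
    by (simp add: F_def eq\<Phi> set_lebesgue_integral_def)
  also have "\<dots> = (\<integral>z. \<integral>t. F (t, z) \<partial>lborel \<partial>lborel)"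
    using lborel_pair.Fubini_integral[of "\<lambda>t z. F (t, z)"] intF by simp
  also have "\<dots> = g 0 * of_real (\<integral>z. \<phi> z \<partial>lborel)"
    by (simp add: inner)
  finally show ?thesis by (simp add: \<Phi>_def)
qed

section \<open>Sums over the lattice as integrals of step functions\<close>

definition lattice_floor :: "real \<Rightarrow> complex \<Rightarrow> complex"
  where "lattice_floor r u = Complex (r * of_int \<lfloor>Re u / r\<rfloor>) (r * of_int \<lfloor>Im u / r\<rfloor>)"

lemma lattice_floor_in: "lattice_floor r u \<in> lattice_pts r"
  by (auto simp: lattice_floor_def lattice_pts_def)

lemma countable_lattice_pts: "countable (lattice_pts r)"
proof -
  have "lattice_pts r = (\<lambda>(m, n). Complex (r * of_int m) (r * of_int n)) ` UNIV"
    by (auto simp: lattice_pts_def)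
  then show ?thesis by simp
qed

lemma norm_diff_lattice_floor:
  assumes "r > 0"
  shows "norm (u - lattice_floor r u) \<le> 2 * r"
proof -
  have 1: "\<bar>x - r * of_int \<lfloor>x / r\<rfloor>\<bar> \<le> r" for x
  proof -
    have "r * (x / r - of_int \<lfloor>x / r\<rfloor>) \<le> r * 1" "0 \<le> r * (x / r - of_int \<lfloor>x / r\<rfloor>)"
      using assms by (intro mult_left_mono mult_nonneg_nonneg; linarith)+
    then show ?thesis
      using assms by (simp add: algebra_simps)
  qed
  show ?thesis
    using 1[of "Re u"] 1[of "Im u"] cmod_le[of "u - lattice_floor r u"]
    by (simp add: lattice_floor_def)
qed

lemma lattice_cell:
  assumes "r > 0" "\<nu> = Complex (r * of_int m) (r * of_int n)"
  shows "lattice_floor r u = \<nu> \<longleftrightarrow> Re u \<in> {r * m ..< r * m + r} \<and> Im u \<in> {r * n ..< r * n + r}"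
  using assms by (auto simp: lattice_floor_def floor_eq_iff field_simps)

lemma sets_lattice_cell [measurable]:
  assumes "r > 0" "\<nu> \<in> lattice_pts r"
  shows "lattice_floor r -` {\<nu>} \<in> sets borel"
proof -
  obtain m n where \<nu>: "\<nu> = Complex (r * of_int m) (r * of_int n)"
    using assms by (auto simp: lattice_pts_def)
  have "lattice_floor r -` {\<nu>} =
      {u. Re u \<in> {r * m ..< r * m + r} \<and> Im u \<in> {r * n ..< r * n + r}}"
    using lattice_cell[OF assms(1) \<nu>] by auto
  then show ?thesis by simp
qed

text \<open>The half-open cell lies between an open and a closed square of the same area.\<close>

lemma emeasure_lattice_cell:
  assumes "r > 0" "\<nu> \<in> lattice_pts r"
  shows "emeasure lborel (lattice_floor r -` {\<nu>}) = ennreal (r\<^sup>2)"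
proof -
  obtain m n where \<nu>: "\<nu> = Complex (r * of_int m) (r * of_int n)"
    using assms by (auto simp: lattice_pts_def)
  let ?S = "lattice_floor r -` {\<nu>}"
  have c: "u \<in> ?S \<longleftrightarrow> Re u \<in> {r * m ..< r * m + r} \<and> Im u \<in> {r * n ..< r * n + r}" for u
    using lattice_cell[OF assms(1) \<nu>] by auto
  have "?S \<subseteq> cbox \<nu> (\<nu> + Complex r r)" "box \<nu> (\<nu> + Complex r r) \<subseteq> ?S"
    unfolding subset_iff c by (auto simp: in_cbox_complex_iff in_box_complex_iff \<nu>)
  then have "emeasure lborel ?S \<le> emeasure lborel (cbox \<nu> (\<nu> + Complex r r))"
    "emeasure lborel (box \<nu> (\<nu> + Complex r r)) \<le> emeasure lborel ?S"
    using assms by (auto intro!: emeasure_mono)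
  moreover have "emeasure lborel (cbox \<nu> (\<nu> + Complex r r)) = ennreal (r\<^sup>2)"
    "emeasure lborel (box \<nu> (\<nu> + Complex r r)) = ennreal (r\<^sup>2)"
    using assms
    by (simp_all add: emeasure_lborel_cbox_eq emeasure_lborel_box_eq Basis_complex_def power2_eq_square)
  ultimately show ?thesis by simp
qed

lemma measurable_lattice_floor:
  assumes "r > 0"
  shows "lattice_floor r \<in> measurable lborel (count_space (lattice_pts r))"
  using assms countable_lattice_pts
  by (auto simp: measurable_count_space_eq_countable lattice_floor_in)

text \<open>Every fibre is a cell of area r^2, so the image of Lebesgue measure is r^2 times
  counting measure. All passages between lattice sums and integrals rest on this.\<close>

lemma distr_lattice_floor:
  assumes "r > 0"
  shows "distr lborel (count_space (lattice_pts r)) (lattice_floor r) =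
    density (count_space (lattice_pts r)) (\<lambda>_. ennreal (r\<^sup>2))"
proof (rule measure_eqI_countable)
  fix \<nu> assume \<nu>: "\<nu> \<in> lattice_pts r"
  then show "emeasure (distr lborel (count_space (lattice_pts r)) (lattice_floor r)) {\<nu>} =
      emeasure (density (count_space (lattice_pts r)) (\<lambda>_. ennreal (r\<^sup>2))) {\<nu>}"
    using measurable_lattice_floor[OF assms] emeasure_lattice_cell[OF assms \<nu>]
    by (simp add: emeasure_distr emeasure_density)
qed (auto simp: countable_lattice_pts)

lemma nn_integral_lattice_floor:
  fixes h :: "complex \<Rightarrow> ennreal"
  assumes "r > 0"
  shows "(\<integral>\<^sup>+u. h (lattice_floor r u) \<partial>lborel) = (\<integral>\<^sup>+\<nu>. ennreal (r\<^sup>2) * h \<nu> \<partial>count_space (lattice_pts r))"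
  using nn_integral_distr[OF measurable_lattice_floor[OF assms], of h]
  by (simp add: distr_lattice_floor[OF assms] nn_integral_density)

text \<open>A Riemann sum is the Bochner integral of a step function. Integrability against the
  image measure is absolute summability over the lattice, hence the unconditional convergence that
  \<open>has_sum\<close> demands.\<close>

lemma has_sum_lattice_floor:
  fixes h :: "complex \<Rightarrow> complex"
  assumes "r > 0" and "integrable lborel (\<lambda>u. h (lattice_floor r u))"
  shows "((\<lambda>\<nu>. of_real (r\<^sup>2) * h \<nu>) has_sum (\<integral>u. h (lattice_floor r u) \<partial>lborel)) (lattice_pts r)"
proof -
  let ?D = "density (count_space (lattice_pts r)) (\<lambda>_. ennreal (r\<^sup>2))"
  have "integrable ?D h"
    using integrable_distr_eq[OF measurable_lattice_floor[OF assms(1)], of h] assms(2)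
    by (simp add: distr_lattice_floor[OF assms(1)])
  then have i: "integrable (count_space (lattice_pts r)) (\<lambda>\<nu>. r\<^sup>2 *\<^sub>R h \<nu>)"
    by (subst (asm) integrable_density) auto
  have "(\<integral>u. h (lattice_floor r u) \<partial>lborel) = (\<integral>\<nu>. h \<nu> \<partial>?D)"
    using integral_distr[OF measurable_lattice_floor[OF assms(1)], of h]
    by (simp add: distr_lattice_floor[OF assms(1)])
  also have "\<dots> = (\<integral>\<nu>. r\<^sup>2 *\<^sub>R h \<nu> \<partial>count_space (lattice_pts r))"
    by (subst integral_density) auto
  also have "\<dots> = infsetsum (\<lambda>\<nu>. r\<^sup>2 *\<^sub>R h \<nu>) (lattice_pts r)"
    by (simp add: infsetsum_def)
  finally have "(\<integral>u. h (lattice_floor r u) \<partial>lborel) = infsetsum (\<lambda>\<nu>. r\<^sup>2 *\<^sub>R h \<nu>) (lattice_pts r)" .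
  moreover have "Infinite_Set_Sum.abs_summable_on (\<lambda>\<nu>. r\<^sup>2 *\<^sub>R h \<nu>) (lattice_pts r)"
    using i by (simp add: Infinite_Set_Sum.abs_summable_on_def)
  then have "infsetsum (\<lambda>\<nu>. r\<^sup>2 *\<^sub>R h \<nu>) (lattice_pts r) = infsum (\<lambda>\<nu>. r\<^sup>2 *\<^sub>R h \<nu>) (lattice_pts r)"
    "(\<lambda>\<nu>. r\<^sup>2 *\<^sub>R h \<nu>) summable_on (lattice_pts r)"
    by (auto simp: infsetsum_infsum abs_summable_equivalent[symmetric] intro: abs_summable_summable)
  ultimately show ?thesis
    by (simp add: has_sum_infsum scaleR_conv_of_real)
qed

text \<open>Moving the centre by at most \<open>d\<close> costs a constant and half of the exponent,
  since |z-u|^2 <= 2 |z-v|^2 + 2 d^2.\<close>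

lemma exp_neg_square_shift:
  fixes z u v :: complex
  assumes "\<beta> > 0" "norm (u - v) \<le> d"
  shows "exp (- \<beta> * (norm (z - v))\<^sup>2) \<le> exp (\<beta> * d\<^sup>2) * exp (- (\<beta> / 2) * (norm (z - u))\<^sup>2)"
proof -
  have "(norm (z - u))\<^sup>2 \<le> (norm (z - v) + norm (u - v))\<^sup>2"
    using norm_triangle_ineq[of "z - v" "v - u"] by (intro power_mono) (auto simp: norm_minus_commute)
  also have "\<dots> \<le> 2 * (norm (z - v))\<^sup>2 + 2 * (norm (u - v))\<^sup>2"
    using sum_squares_bound[of "norm (z - v)" "norm (u - v)"] by (simp add: power2_sum)
  also have "\<dots> \<le> 2 * (norm (z - v))\<^sup>2 + 2 * d\<^sup>2"
    using assms power_mono[OF assms(2), of 2] by simp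
  finally have "\<beta> * ((norm (z - u))\<^sup>2 / 2) \<le> \<beta> * ((norm (z - v))\<^sup>2 + d\<^sup>2)"
    using assms(1) by (intro mult_left_mono) auto
  then show ?thesis
    by (simp add: mult_exp_exp algebra_simps)
qed

text \<open>The factor r^2 makes this a Riemann sum of a Gaussian integral, so one constant serves
  all z and all meshes up to \<open>R\<close>. The contraction estimate depends on this
  uniformity.\<close>

lemma lattice_gaussian_sum_bound:
  assumes "\<beta> > 0" "R > 0"
  shows "\<exists>C>0. \<forall>r z. 0 < r \<longrightarrow> r \<le> R \<longrightarrow>
    (\<integral>\<^sup>+\<nu>. ennreal (r\<^sup>2 * exp (- \<beta> * (norm (z - \<nu>))\<^sup>2)) \<partial>count_space (lattice_pts r)) \<le> ennreal C"
proof -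
  define I where "I = (\<integral>\<^sup>+u. ennreal (exp (- (\<beta> / 2) * (norm (u :: complex))\<^sup>2)) \<partial>lborel)"
  have I: "I < \<infinity>"
    unfolding I_def using assms by (intro nn_integral_gaussian_finite) auto
  define C where "C = exp (\<beta> * (2 * R)\<^sup>2) * enn2real I + 1"
  have "C > 0" by (auto simp: C_def intro!: add_nonneg_pos)
  moreover have "(\<integral>\<^sup>+\<nu>. ennreal (r\<^sup>2 * exp (- \<beta> * (norm (z - \<nu>))\<^sup>2)) \<partial>count_space (lattice_pts r)) \<le> ennreal C"
    if r: "0 < r" "r \<le> R" for r z
  proof -
    have "(\<integral>\<^sup>+\<nu>. ennreal (r\<^sup>2 * exp (- \<beta> * (norm (z - \<nu>))\<^sup>2)) \<partial>count_space (lattice_pts r)) =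
        (\<integral>\<^sup>+u. ennreal (exp (- \<beta> * (norm (z - lattice_floor r u))\<^sup>2)) \<partial>lborel)"
      by (subst nn_integral_lattice_floor[OF r(1)]) (auto simp: ennreal_mult intro!: nn_integral_cong)
    also have "\<dots> \<le> (\<integral>\<^sup>+u. ennreal (exp (\<beta> * (2 * R)\<^sup>2)) * ennreal (exp (- (\<beta> / 2) * (norm (- z + u))\<^sup>2)) \<partial>lborel)"
    proof (intro nn_integral_mono)
      fix u
      have "norm (u - lattice_floor r u) \<le> 2 * R"
        using norm_diff_lattice_floor[OF r(1), of u] r by linarith
      from exp_neg_square_shift[OF assms(1) this, of z]
      show "ennreal (exp (- \<beta> * (norm (z - lattice_floor r u))\<^sup>2)) \<le>
          ennreal (exp (\<beta> * (2 * R)\<^sup>2)) * ennreal (exp (- (\<beta> / 2) * (norm (- z + u))\<^sup>2))"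
        by (simp add: norm_minus_commute flip: ennreal_mult)
    qed
    also have "\<dots> = ennreal (exp (\<beta> * (2 * R)\<^sup>2)) * I"
      unfolding I_def
      using nn_integral_translate[of "\<lambda>u. ennreal (exp (- (\<beta> / 2) * (norm u)\<^sup>2))" "- z"]
      by (simp add: nn_integral_cmult)
    also have "\<dots> = ennreal (exp (\<beta> * (2 * R)\<^sup>2) * enn2real I)"
      using I by (simp add: ennreal_mult)
    also have "\<dots> \<le> ennreal C"
      by (simp add: C_def ennreal_leI)
    finally show ?thesis .
  qed
  ultimately show ?thesis by blast
qed

subsection \<open>Weighted inequalities\<close>

text \<open>This is Hoelder's inequality in the form (int k g)^p <= (int k)^(p-1) int k g^p, that
  is, Jensen for the measure k dM. The real bounds \<open>x\<close> and \<open>A\<close> stand for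
  the first two integrals, which fits the one-sided estimates of the applications. \<open>M\<close>
  will be the plane, a lattice or the natural numbers.\<close>

lemma nn_integral_power_mean:
  fixes k g :: "'a \<Rightarrow> real"
  assumes p: "1 < p" and A: "0 < A" and x: "0 \<le> x"
    and [measurable]: "k \<in> borel_measurable M" "g \<in> borel_measurable M"
    and k: "\<And>u. 0 \<le> k u" and g: "\<And>u. 0 \<le> g u"
    and xle: "ennreal x \<le> (\<integral>\<^sup>+u. ennreal (k u * g u) \<partial>M)"
    and kA: "(\<integral>\<^sup>+u. ennreal (k u) \<partial>M) \<le> ennreal A"
  shows "ennreal (x powr p) \<le> ennreal (A powr (p - 1)) * (\<integral>\<^sup>+u. ennreal (k u * g u powr p) \<partial>M)"
proof (cases "(\<integral>\<^sup>+u. ennreal (k u * g u powr p) \<partial>M) = \<infinity> \<or> x = 0")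
  case True
  then show ?thesis
    using A by (auto simp: ennreal_mult_top)
next
  case False
  then obtain b where b: "(\<integral>\<^sup>+u. ennreal (k u * g u powr p) \<partial>M) = ennreal b" "0 \<le> b"
    by (cases "(\<integral>\<^sup>+u. ennreal (k u * g u powr p) \<partial>M)") auto
  have x0: "x > 0" using False x by auto
  \<comment> \<open>\<open>t\<close> is the candidate mean value of \<open>g\<close>. Young's
    inequality scaled by \<open>t\<close> bounds \<open>g\<close> by a constant plus a multiple of
    its p-th power; after integration the constant contributes x - x/p, and solving for the
    remaining x/p gives the claim.\<close>
  define t where "t = x / A"
  have t: "t > 0" using x0 A by (simp add: t_def)
  have young: "g u \<le> t * (1 - 1 / p) + t powr (1 - p) / p * g u powr p" for u
  proof -
    have "(g u / t) * 1 \<le> (g u / t) powr p / p + 1 powr (p / (p - 1)) / (p / (p - 1))"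
      by (rule Youngs_inequality) (use p g t in \<open>auto simp: field_simps\<close>)
    then have "t * (g u / t) \<le> t * ((g u / t) powr p / p + (1 - 1 / p))"
      using p t by (intro mult_left_mono) (auto simp: field_simps)
    also have "t * ((g u / t) powr p / p + (1 - 1 / p)) = t * (1 - 1 / p) + (t * (g u / t) powr p) / p"
      by (simp add: algebra_simps)
    also have "t * (g u / t) powr p = t powr (1 - p) * g u powr p"
      using t g by (simp add: powr_divide powr_diff)
    finally show ?thesis
      using t by simp
  qed
  have "ennreal x \<le> (\<integral>\<^sup>+u. ennreal (k u * g u) \<partial>M)" by (rule xle)
  also have "\<dots> \<le> (\<integral>\<^sup>+u. ennreal (t * (1 - 1 / p)) * ennreal (k u) +
      ennreal (t powr (1 - p) / p) * ennreal (k u * g u powr p) \<partial>M)"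
  proof (intro nn_integral_mono)
    fix u
    have "k u * g u \<le> k u * (t * (1 - 1 / p) + t powr (1 - p) / p * g u powr p)"
      by (intro mult_left_mono young k)
    also have "\<dots> = t * (1 - 1 / p) * k u + t powr (1 - p) / p * (k u * g u powr p)"
      by (simp add: algebra_simps)
    finally show "ennreal (k u * g u) \<le> ennreal (t * (1 - 1 / p)) * ennreal (k u) +
        ennreal (t powr (1 - p) / p) * ennreal (k u * g u powr p)"
      using p t k by (simp flip: ennreal_mult ennreal_plus)
  qed
  also have "\<dots> = ennreal (t * (1 - 1 / p)) * (\<integral>\<^sup>+u. ennreal (k u) \<partial>M) + ennreal (t powr (1 - p) / p) * ennreal b"
    by (simp add: nn_integral_add nn_integral_cmult b)
  also have "\<dots> \<le> ennreal (t * (1 - 1 / p)) * ennreal A + ennreal (t powr (1 - p) / p) * ennreal b"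
    by (intro add_right_mono mult_left_mono kA) simp
  also have "\<dots> = ennreal (t * (1 - 1 / p) * A + t powr (1 - p) / p * b)"
    using p t b A by (simp flip: ennreal_mult ennreal_plus)
  finally have "x \<le> t * (1 - 1 / p) * A + t powr (1 - p) / p * b"
    using p t b A by (subst (asm) ennreal_le_iff) auto
  also have "t * (1 - 1 / p) * A = x - x / p"
    using A p by (simp add: t_def field_simps)
  finally have "x \<le> t powr (1 - p) * b"
    using p by (simp add: field_simps)
  then have "x * t powr (p - 1) \<le> b * (t powr (1 - p) * t powr (p - 1))"
    using mult_right_mono[of x "t powr (1 - p) * b" "t powr (p - 1)"] by (simp add: algebra_simps)
  also have "t powr (1 - p) * t powr (p - 1) = 1"
    using t by (simp flip: powr_add)
  finally have "A powr (p - 1) * (x * t powr (p - 1)) \<le> A powr (p - 1) * b"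
    by (intro mult_left_mono) auto
  moreover have "A powr (p - 1) * (x * t powr (p - 1)) = x powr p"
    using x0 A by (simp add: t_def powr_divide powr_diff)
  ultimately show ?thesis
    using b by (simp add: ennreal_leI flip: ennreal_mult)
qed

lemma summable_on_iff_nn_integral:
  fixes f :: "'a \<Rightarrow> real"
  assumes "\<And>x. x \<in> A \<Longrightarrow> 0 \<le> f x"
  shows "f summable_on A \<longleftrightarrow> (\<integral>\<^sup>+x. ennreal (f x) \<partial>count_space A) < \<infinity>"
proof -
  have "f summable_on A \<longleftrightarrow> (\<lambda>x. norm (f x)) summable_on A"
    using assms by (intro summable_on_cong) auto
  also have "\<dots> \<longleftrightarrow> integrable (count_space A) f"
    using abs_summable_equivalent[of f A] by (simp add: Infinite_Set_Sum.abs_summable_on_def)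
  also have "\<dots> \<longleftrightarrow> (\<integral>\<^sup>+x. ennreal (norm (f x)) \<partial>count_space A) < \<infinity>"
    by (simp add: integrable_iff_bounded)
  also have "(\<integral>\<^sup>+x. ennreal (norm (f x)) \<partial>count_space A) = (\<integral>\<^sup>+x. ennreal (f x) \<partial>count_space A)"
    using assms by (intro nn_integral_cong) simp
  finally show ?thesis .
qed

lemma infsum_eq_nn_integral:
  fixes f :: "'a \<Rightarrow> real"
  assumes "\<And>x. x \<in> A \<Longrightarrow> 0 \<le> f x" "f summable_on A"
  shows "ennreal (infsum f A) = (\<integral>\<^sup>+x. ennreal (f x) \<partial>count_space A)"
proof -
  have "(\<lambda>x. norm (f x)) summable_on A"
    using assms by (auto intro!: summable_on_cong[THEN iffD1, OF _ assms(2)])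
  then have "Infinite_Set_Sum.abs_summable_on f A"
    using abs_summable_equivalent[of f A] by simp
  then show ?thesis
    using assms(1)
    by (subst nn_integral_eq_integral)
       (auto simp: AE_count_space infsetsum_def Infinite_Set_Sum.abs_summable_on_def simp flip: infsetsum_infsum)
qed

section \<open>The restricted A_p condition as a single integral inequality\<close>

definition centred_square :: "real \<Rightarrow> complex \<Rightarrow> complex set"
  where "centred_square s a = cbox (a - Complex (s / 2) (s / 2)) (a + Complex (s / 2) (s / 2))"

definition weighted_measure :: "(complex \<Rightarrow> real) \<Rightarrow> complex measure"
  where "weighted_measure w = density lebesgue (\<lambda>z. ennreal (w z))"

lemma square_eq_centred_square: "square (a - Complex (s / 2) (s / 2)) s = centred_square s a"
proof -
  have "a - Complex (s / 2) (s / 2) + Complex s s = a + Complex (s / 2) (s / 2)"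
    by (simp add: complex_eq_iff)
  then show ?thesis
    by (simp only: square_def centred_square_def)
qed

lemma sets_centred_square [measurable, simp]: "centred_square s a \<in> sets borel"
  by (simp add: centred_square_def)

lemma emeasure_centred_square:
  assumes "s \<ge> 0"
  shows "emeasure lborel (centred_square s a) = ennreal (s\<^sup>2)"
  using assms
  by (simp add: centred_square_def emeasure_lborel_cbox_eq Basis_complex_def power2_eq_square)

text \<open>Hoelder's inequality with the factors w^(-e) and g w^e, where e = 1/(p-1), turns the
  bound on the product of averages into an inequality free of the dual weight. The conventions for 0
  and infinity yield positive finite masses. Together with measurability and sign of
  \<open>w\<close>, these facts carry the rest of the argument.\<close>

lemma Ap_restricted_reverse_holder:
  assumes p: "1 < p" and w: "w \<in> Ap_restricted p"
  obtains s B where "0 < s" "0 < B"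
    and "\<And>a. emeasure (weighted_measure w) (centred_square s a) < \<infinity>"
    and "\<And>a. 0 < measure (weighted_measure w) (centred_square s a)"
    and "\<And>a (g :: complex \<Rightarrow> real) x. g \<in> borel_measurable borel \<Longrightarrow> (\<And>u. 0 \<le> g u) \<Longrightarrow> 0 \<le> x \<Longrightarrow>
      ennreal x \<le> (\<integral>\<^sup>+u\<in>centred_square s a. ennreal (g u) \<partial>lborel) \<Longrightarrow>
      ennreal (measure (weighted_measure w) (centred_square s a) * x powr p) \<le>
      ennreal B * (\<integral>\<^sup>+u\<in>centred_square s a. ennreal (g u powr p) \<partial>weighted_measure w)"
proof -
  have wt [measurable]: "w \<in> borel_measurable lebesgue" and w0: "\<And>z. 0 \<le> w z"
    using w by (auto simp: Ap_restricted_def weight_def)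
  define X where "X = (\<lambda>Q. \<integral>\<^sup>+z\<in>Q. ennreal (w z) \<partial>lebesgue)"
  define Y where "Y = (\<lambda>Q. \<integral>\<^sup>+z\<in>Q. neg_power (w z) (1 / (p - 1)) \<partial>lebesgue)"
  have q: "conj_exponent p / p = 1 / (p - 1)" "p / conj_exponent p = p - 1"
    using p by (auto simp: conj_exponent_def)
  obtain s where s: "s > 0" and fin: "(SUP a. mult_inf
        (average (square a s) (\<lambda>z. ennreal (w z)))
        (ennreal_power (average (square a s) (\<lambda>z. neg_power (w z) (1 / (p - 1)))) (p - 1))) < \<infinity>"
    using w unfolding Ap_restricted_def q by blast
  define S where "S = (SUP a. mult_inf
        (average (square a s) (\<lambda>z. ennreal (w z)))
        (ennreal_power (average (square a s) (\<lambda>z. neg_power (w z) (1 / (p - 1)))) (p - 1)))"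
  obtain B0 where B0: "S = ennreal B0" "B0 \<ge> 0"
    using fin unfolding S_def[symmetric] by (cases S) auto
  \<comment> \<open>The averages divide by the area s^2 once for \<open>X\<close> and p - 1 times
    for \<open>Y\<close>, which makes (s^2)^p in total. The summand 1 secures positivity.\<close>
  define B where "B = B0 * (s\<^sup>2) powr p + 1"
  have [measurable]: "centred_square s a \<in> sets lebesgue" for a
    by (simp add: sets_completionI_sets)
  have [measurable]: "(\<lambda>z. neg_power (w z) (1 / (p - 1))) \<in> borel_measurable lebesgue"
    unfolding neg_power_def by measurable
  have key: "X Q < \<infinity> \<and> Y Q < \<infinity> \<and> 0 < enn2real (X Q) \<and> 0 < enn2real (Y Q) \<and>
      enn2real (X Q) * enn2real (Y Q) powr (p - 1) \<le> B" if Q: "Q = centred_square s a" for Q a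
  proof -
    have Qm [measurable]: "Q \<in> sets lebesgue" by (simp add: Q)
    have eQ: "emeasure lebesgue Q = ennreal (s\<^sup>2)"
      using s emeasure_centred_square[of s a] by (simp add: Q)
    have "mult_inf (X Q / ennreal (s\<^sup>2)) (ennreal_power (Y Q / ennreal (s\<^sup>2)) (p - 1)) \<le> S"
      unfolding S_def
      by (rule SUP_upper2[of "a - Complex (s / 2) (s / 2)"])
         (simp_all only: square_eq_centred_square average_def X_def Y_def UNIV_I eQ[unfolded Q] Q)
    then have mi: "mult_inf (X Q / ennreal (s\<^sup>2)) (ennreal_power (Y Q / ennreal (s\<^sup>2)) (p - 1)) \<le> ennreal B0"
      by (simp add: B0)
    \<comment> \<open>With \<open>mult_inf\<close>, a finite product forces both factors to be
      finite even if one of them vanishes.\<close>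
    then have ne: "X Q / ennreal (s\<^sup>2) \<noteq> \<infinity>" "ennreal_power (Y Q / ennreal (s\<^sup>2)) (p - 1) \<noteq> \<infinity>"
      by (auto simp: mult_inf_def top_unique split: if_splits)
    then have "Y Q / ennreal (s\<^sup>2) \<noteq> \<infinity>"
      by (auto simp: ennreal_power_def)
    then have XYne: "X Q \<noteq> \<infinity>" "Y Q \<noteq> \<infinity>"
      using ne(1) s by (auto simp: ennreal_top_divide)
    obtain a b where ab: "X Q = ennreal a" "Y Q = ennreal b" "a \<ge> 0" "b \<ge> 0"
      using XYne by (cases "X Q"; cases "Y Q") auto
    have "(a / s\<^sup>2) * ((b / s\<^sup>2) powr (p - 1)) \<le> B0"
      using mi ab s B0
      by (simp add: mult_inf_def ennreal_power_def divide_ennreal flip: ennreal_mult)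
    also have "(a / s\<^sup>2) * ((b / s\<^sup>2) powr (p - 1)) = (a * b powr (p - 1)) / (s\<^sup>2) powr p"
      using s ab by (simp add: powr_divide powr_diff)
    finally have "a * b powr (p - 1) \<le> B0 * (s\<^sup>2) powr p"
      using s by (simp add: field_simps)
    \<comment> \<open>If \<open>w\<close> vanished almost everywhere on \<open>Q\<close>, then
      \<open>neg_power\<close> would be infinite there, and so would \<open>Y Q\<close>.\<close>
    moreover have "X Q \<noteq> 0"
    proof
      assume "X Q = 0"
      then have "AE z in lebesgue. ennreal (w z) * indicator Q z = 0"
        unfolding X_def by (subst (asm) nn_integral_0_iff_AE) auto
      then have "AE z in lebesgue. \<infinity> * indicator Q z \<le> neg_power (w z) (1 / (p - 1)) * indicator Q z"
        by eventually_elim (auto simp: neg_power_def w0 ennreal_eq_0_iff antisym split: split_indicator)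
      then have "(\<integral>\<^sup>+z. \<infinity> * indicator Q z \<partial>lebesgue) \<le> Y Q"
        unfolding Y_def by (rule nn_integral_mono_AE)
      then show False
        using s XYne eQ nn_integral_cmult_indicator[OF Qm, of \<infinity>]
        by (simp add: ennreal_top_mult top_unique del: nn_integral_indicator)
    qed
    \<comment> \<open>\<open>neg_power\<close> of a real number is never 0, so its integral vanishes
      only over a null set.\<close>
    moreover have "Y Q \<noteq> 0"
    proof
      assume "Y Q = 0"
      then have "AE z in lebesgue. neg_power (w z) (1 / (p - 1)) * indicator Q z = 0"
        unfolding Y_def by (subst (asm) nn_integral_0_iff_AE) auto
      then have "AE z in lebesgue. z \<notin> Q"
        by eventually_elim (auto simp: neg_power_def split: split_indicator_asm if_splits)
      then have "emeasure lebesgue Q = 0"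
        by (subst (asm) AE_iff_measurable[OF Qm]) auto
      then show False
        using eQ s by simp
    qed
    ultimately show ?thesis
      using ab XYne by (auto simp: B_def less_top zero_less_iff_neq_zero ennreal_eq_0_iff)
  qed
  have X: "emeasure (weighted_measure w) (centred_square s a) = X (centred_square s a)" for a
    by (simp add: weighted_measure_def emeasure_density X_def)
  show ?thesis
  proof
    show "0 < s" by (rule s)
    show "0 < B" using B0 by (auto simp: B_def intro!: add_nonneg_pos)
    show "emeasure (weighted_measure w) (centred_square s a) < \<infinity>" for a
      using key X by simp
    show "0 < measure (weighted_measure w) (centred_square s a)" for a
      using key X by (simp add: measure_def)
    fix a x and g :: "complex \<Rightarrow> real"
    assume gm [measurable]: "g \<in> borel_measurable borel" and g0: "\<And>u. 0 \<le> g u" and x: "0 \<le> x"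
      and xle: "ennreal x \<le> (\<integral>\<^sup>+u\<in>centred_square s a. ennreal (g u) \<partial>lborel)"
    define Q where "Q = centred_square s a"
    have Qm [measurable]: "Q \<in> sets lebesgue" by (simp add: Q_def)
    have gl [measurable]: "g \<in> borel_measurable lebesgue"
      using gm by (intro measurable_completion) simp
    note kQ = key[OF Q_def]
    define e where "e = 1 / (p - 1)"
    \<comment> \<open>The Hoelder splitting g = k h on \<open>Q\<close>, chosen so that k h^p = w
      g^p, because -e + e p = 1. Where w = 0, \<open>k\<close> is 0 instead of infinite; by
      \<open>wpos\<close> below this happens on a null subset of \<open>Q\<close> only.\<close>
    define k where "k = (\<lambda>u. indicator Q u * w u powr (- e))"
    define h where "h = (\<lambda>u. g u * w u powr e)"
    have km [measurable]: "k \<in> borel_measurable lebesgue" "h \<in> borel_measurable lebesgue"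
      unfolding k_def h_def by measurable
    have "AE z in lebesgue. neg_power (w z) (1 / (p - 1)) * indicator Q z \<noteq> \<infinity>"
      using kQ unfolding Y_def by (intro nn_integral_noteq_infinite) auto
    then have wpos: "AE z in lebesgue. z \<in> Q \<longrightarrow> w z > 0"
      by eventually_elim (auto simp: neg_power_def less_le w0 split: if_splits)
    have "(\<integral>\<^sup>+u\<in>Q. ennreal (g u) \<partial>lborel) = (\<integral>\<^sup>+u\<in>Q. ennreal (g u) \<partial>lebesgue)"
      unfolding Q_def by (subst nn_integral_completion) auto
    also have "\<dots> = (\<integral>\<^sup>+u. ennreal (k u * h u) \<partial>lebesgue)"
    proof (rule nn_integral_cong_AE)
      show "AE u in lebesgue. ennreal (g u) * indicator Q u = ennreal (k u * h u)"
        using wpos by eventually_elim (auto simp: k_def h_def powr_minus field_simps split: split_indicator)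
    qed
    finally have xle': "ennreal x \<le> (\<integral>\<^sup>+u. ennreal (k u * h u) \<partial>lebesgue)"
      using xle by (simp add: Q_def)
    have "(\<integral>\<^sup>+u. ennreal (k u) \<partial>lebesgue) \<le> Y Q"
      unfolding Y_def k_def e_def
      by (intro nn_integral_mono) (auto simp: neg_power_def split: split_indicator)
    then have kY: "(\<integral>\<^sup>+u. ennreal (k u) \<partial>lebesgue) \<le> ennreal (enn2real (Y Q))"
      using kQ by simp
    have "ennreal (x powr p) \<le>
        ennreal (enn2real (Y Q) powr (p - 1)) * (\<integral>\<^sup>+u. ennreal (k u * h u powr p) \<partial>lebesgue)"
      by (rule nn_integral_power_mean[OF p _ x km _ _ xle' kY])
         (use kQ g0 in \<open>auto simp: k_def h_def\<close>)
    also have "(\<integral>\<^sup>+u. ennreal (k u * h u powr p) \<partial>lebesgue) =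
        (\<integral>\<^sup>+u. ennreal (w u) * (ennreal (g u powr p) * indicator Q u) \<partial>lebesgue)"
    proof (intro nn_integral_cong)
      fix u
      have "w u powr (- e) * (g u * w u powr e) powr p = w u * g u powr p"
      proof (cases "w u = 0")
        case False
        then have wu: "w u > 0" using w0[of u] by simp
        have "w u powr (- e) * (g u * w u powr e) powr p = (w u powr (- e) * w u powr (e * p)) * g u powr p"
          using wu g0 by (simp add: powr_mult powr_powr)
        also have "w u powr (- e) * w u powr (e * p) = w u powr (- e + e * p)"
          by (simp only: powr_add)
        also have "- e + e * p = 1"
        proof -
          have "e * (p - 1) = 1" using p by (simp add: e_def)
          then show ?thesis by (simp add: algebra_simps)
        qed
        finally show ?thesis using wu by simp
      qed simp
      then show "ennreal (k u * h u powr p) = ennreal (w u) * (ennreal (g u powr p) * indicator Q u)"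
        using w0 by (auto simp: k_def h_def split: split_indicator simp flip: ennreal_mult)
    qed
    also have "\<dots> = (\<integral>\<^sup>+u\<in>Q. ennreal (g u powr p) \<partial>weighted_measure w)"
      unfolding weighted_measure_def by (subst nn_integral_density) auto
    finally have main: "ennreal (x powr p) \<le>
        ennreal (enn2real (Y Q) powr (p - 1)) * (\<integral>\<^sup>+u\<in>Q. ennreal (g u powr p) \<partial>weighted_measure w)" .
    have "ennreal (measure (weighted_measure w) Q * x powr p) = ennreal (enn2real (X Q)) * ennreal (x powr p)"
      using X[of a] by (simp add: measure_def Q_def ennreal_mult)
    also have "\<dots> \<le> ennreal (enn2real (X Q)) * (ennreal (enn2real (Y Q) powr (p - 1)) *
        (\<integral>\<^sup>+u\<in>Q. ennreal (g u powr p) \<partial>weighted_measure w))"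
      by (intro mult_left_mono main) simp
    also have "\<dots> = ennreal (enn2real (X Q) * enn2real (Y Q) powr (p - 1)) *
        (\<integral>\<^sup>+u\<in>Q. ennreal (g u powr p) \<partial>weighted_measure w)"
      by (simp add: ennreal_mult mult.assoc)
    also have "\<dots> \<le> ennreal B * (\<integral>\<^sup>+u\<in>Q. ennreal (g u powr p) \<partial>weighted_measure w)"
      using kQ by (intro mult_right_mono ennreal_leI) auto
    finally show "ennreal (measure (weighted_measure w) (centred_square s a) * x powr p) \<le>
      ennreal B * (\<integral>\<^sup>+u\<in>centred_square s a. ennreal (g u powr p) \<partial>weighted_measure w)"
      by (simp add: Q_def)
  qed
qed

subsection \<open>Local properties of the weight\<close>

text \<open>The p-th power of this modulus, integrated against \<open>weighted_measure w\<close>, is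
  the p-th power of the Fock norm.\<close>

definition gauss_modulus :: "real \<Rightarrow> (complex \<Rightarrow> complex) \<Rightarrow> complex \<Rightarrow> real"
  where "gauss_modulus \<alpha> f z = norm (f z) * exp (- (\<alpha> / 2) * (norm z)\<^sup>2)"

lemma gauss_modulus_nonneg [simp]: "0 \<le> gauss_modulus \<alpha> f z"
  by (simp add: gauss_modulus_def)

lemma gauss_modulus_measurable [measurable (raw)]:
  assumes "f \<in> borel_measurable borel"
  shows "gauss_modulus \<alpha> f \<in> borel_measurable borel"
proof -
  have "(\<lambda>z :: complex. exp (- (\<alpha> / 2) * (norm z)\<^sup>2)) \<in> borel_measurable borel"
    by (intro borel_measurable_continuous_onI continuous_intros)
  then show ?thesis
    using assms unfolding gauss_modulus_def by measurable
qed

lemma borel_measurable_entire: "f holomorphic_on UNIV \<Longrightarrow> f \<in> borel_measurable borel"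
  using borel_measurable_continuous_onI holomorphic_on_imp_continuous_on by blast

lemma norm_add_square_complex:
  "(norm (x + \<zeta> :: complex))\<^sup>2 = (norm x)\<^sup>2 + 2 * Re (cnj x * \<zeta>) + (norm \<zeta>)\<^sup>2"
  unfolding cmod_power2 by (simp add: power2_eq_square algebra_simps)

text \<open>Multiplying the translate of \<open>f\<close> by this exponential keeps it entire and
  cancels the cross term of |x + \<zeta>|^2. Holomorphic estimates at the origin thereby hold at
  every \<open>x\<close> with the same constants.\<close>

lemma gauss_modulus_translate:
  "norm (f (x + \<zeta>) * exp (- of_real \<alpha> * cnj x * \<zeta>)) =
    gauss_modulus \<alpha> f (x + \<zeta>) * exp (\<alpha> / 2 * ((norm x)\<^sup>2 + (norm \<zeta>)\<^sup>2))"
proof -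
  have "norm (exp (- of_real \<alpha> * cnj x * \<zeta>)) = exp (- \<alpha> * Re (cnj x * \<zeta>))"
    by (simp add: norm_exp_eq_Re algebra_simps)
  also have "- \<alpha> * Re (cnj x * \<zeta>) = - (\<alpha> / 2) * (norm (x + \<zeta>))\<^sup>2 + \<alpha> / 2 * ((norm x)\<^sup>2 + (norm \<zeta>)\<^sup>2)"
    unfolding norm_add_square_complex by (simp add: field_simps)
  finally show ?thesis
    by (simp only: gauss_modulus_def norm_mult exp_add mult.assoc)
qed

text \<open>Up to a height depending on \<open>\<nu>\<close> alone, the kernel is a Gaussian bump
  centred at \<open>\<nu>\<close>. This localisation is what makes kernels usable as atoms.\<close>

lemma gauss_modulus_kernel:
  "gauss_modulus \<alpha> (fock_kernel \<alpha> \<nu>) z = exp (\<alpha> / 2 * (norm \<nu>)\<^sup>2) * exp (- (\<alpha> / 2) * (norm (z - \<nu>))\<^sup>2)"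
proof -
  define R where "R = Re (cnj \<nu> * z)"
  have h: "(norm (z - \<nu>))\<^sup>2 = (norm \<nu>)\<^sup>2 - 2 * R + (norm z)\<^sup>2"
    using norm_add_square_complex[of "- \<nu>" z] by (simp add: R_def algebra_simps)
  have k: "norm (fock_kernel \<alpha> \<nu> z) = exp (\<alpha> * R)"
    by (simp add: fock_kernel_def R_def norm_exp_eq_Re algebra_simps)
  show ?thesis
    unfolding gauss_modulus_def k h by (simp add: mult_exp_exp algebra_simps)
qed

lemma holomorphic_on_fock_kernel: "fock_kernel \<alpha> \<nu> holomorphic_on A"
  unfolding fock_kernel_def by (intro holomorphic_intros)

lemma in_centred_square:
  "z \<in> centred_square s a \<longleftrightarrow> \<bar>Re z - Re a\<bar> \<le> s / 2 \<and> \<bar>Im z - Im a\<bar> \<le> s / 2"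
  unfolding centred_square_def in_cbox_complex_iff minus_complex.sel plus_complex.sel complex.sel
    atLeastAtMost_iff
  by arith

lemma norm_diff_centred_square: "z \<in> centred_square s a \<Longrightarrow> norm (z - a) \<le> s"
  using cmod_le[of "z - a"] by (auto simp: in_centred_square)

text \<open>The mean value property over a disc is applied to the twisted translate from
  \<open>gauss_modulus_translate\<close>; the leftover factor exp(alpha |\<zeta>|^2 / 2) is bounded
  on the disc uniformly in \<open>x\<close>. The constant stays inside the integral so that the
  integrand can be fed directly to \<open>reverse_holder\<close>.\<close>

lemma entire_sub_mean_value:
  assumes "0 \<le> \<alpha>" "0 < d"
  shows "\<exists>C>0. \<forall>f x. f holomorphic_on UNIV \<longrightarrow>
    ennreal (gauss_modulus \<alpha> f x) \<le> (\<integral>\<^sup>+u\<in>ball x d. ennreal (C * gauss_modulus \<alpha> f u) \<partial>lborel)"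
proof -
  define m where "m = measure lborel (ball (0 :: complex) d)"
  have m: "m > 0"
    using assms content_ball_pos by (simp add: m_def)
  define E where "E = exp (\<alpha> / 2 * d\<^sup>2)"
  have "ennreal (gauss_modulus \<alpha> f x) \<le> (\<integral>\<^sup>+u\<in>ball x d. ennreal (E / m * gauss_modulus \<alpha> f u) \<partial>lborel)"
    if f: "f holomorphic_on UNIV" for f x
  proof -
    note [measurable] = borel_measurable_entire[OF f]
    define H where "H = (\<lambda>u. ennreal (E / m * gauss_modulus \<alpha> f u) * indicator (ball x d) u)"
    have [measurable]: "H \<in> borel_measurable borel"
      unfolding H_def by (intro borel_measurable_times_ennreal borel_measurable_indicator) auto
    define g where "g = (\<lambda>\<zeta>. f (x + \<zeta>) * exp (- of_real \<alpha> * cnj x * \<zeta>))"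
    have "(\<lambda>\<zeta>. f (x + \<zeta>)) holomorphic_on UNIV"
      by (rule holomorphic_on_compose_gen[of _ _ f, unfolded o_def, OF _ f])
         (auto intro!: holomorphic_intros)
    then have g: "g holomorphic_on UNIV"
      unfolding g_def by (intro holomorphic_intros)
    note [measurable] = borel_measurable_entire[OF g]
    define \<phi> where "\<phi> = (indicator (ball 0 d) :: complex \<Rightarrow> real)"
    have \<phi>m [measurable]: "\<phi> \<in> borel_measurable borel"
      unfolding \<phi>_def by (intro borel_measurable_indicator) simp
    have [measurable]: "(\<lambda>\<zeta>. g \<zeta> * of_real (\<phi> \<zeta>)) \<in> borel_measurable borel" by measurable
    have "integrable lborel (\<lambda>\<zeta>. indicator (cball 0 d) \<zeta> *\<^sub>R g \<zeta>)"
      by (intro borel_integrable_compact holomorphic_on_imp_continuous_on)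
         (use g holomorphic_on_subset in auto)
    then have int: "integrable lborel (\<lambda>\<zeta>. g \<zeta> * of_real (\<phi> \<zeta>))"
      by (rule Bochner_Integration.integrable_bound)
         (simp, auto simp: \<phi>_def split: split_indicator)
    have "norm (f x * of_real m) = norm (\<integral>\<zeta>. g \<zeta> * of_real (\<phi> \<zeta>) \<partial>lborel)"
      by (subst radial_mean_value[OF g _ \<phi>m int])
         (auto simp: \<phi>_def norm_mult g_def m_def split: split_indicator)
    also have "ennreal \<dots> \<le> (\<integral>\<^sup>+\<zeta>. ennreal (norm (g \<zeta> * of_real (\<phi> \<zeta>))) \<partial>lborel)"
      by (rule integral_norm_bound_ennreal[OF int])
    also have "\<dots> \<le> (\<integral>\<^sup>+\<zeta>. ennreal (exp (\<alpha> / 2 * (norm x)\<^sup>2) * m) *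
        H (x + \<zeta>) \<partial>lborel)"
    proof (intro nn_integral_mono)
      fix \<zeta>
      show "ennreal (norm (g \<zeta> * of_real (\<phi> \<zeta>))) \<le> ennreal (exp (\<alpha> / 2 * (norm x)\<^sup>2) * m) *
        H (x + \<zeta>)"
      proof (cases "\<zeta> \<in> ball 0 d")
        case True
        then have "exp (\<alpha> / 2 * (norm \<zeta>)\<^sup>2) \<le> E"
          using assms unfolding E_def by (simp add: mult_left_mono power_mono)
        then have "norm (g \<zeta>) \<le> gauss_modulus \<alpha> f (x + \<zeta>) * (exp (\<alpha> / 2 * (norm x)\<^sup>2) * E)"
          unfolding g_def gauss_modulus_translate
          by (auto simp: distrib_left exp_add intro!: mult_left_mono)
        then show ?thesis
          using True m by (auto simp: H_def \<phi>_def dist_norm E_def algebra_simps simp flip: ennreal_mult intro!: ennreal_leI)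
      qed (simp add: \<phi>_def)
    qed
    also have "\<dots> = ennreal (exp (\<alpha> / 2 * (norm x)\<^sup>2) * m) *
        (\<integral>\<^sup>+u. H u \<partial>lborel)"
      by (simp add: nn_integral_cmult nn_integral_translate)
    also have "norm (f x * of_real m) = (exp (\<alpha> / 2 * (norm x)\<^sup>2) * m) * gauss_modulus \<alpha> f x"
      using m by (simp add: gauss_modulus_def norm_mult exp_minus field_simps)
    finally have "ennreal (exp (\<alpha> / 2 * (norm x)\<^sup>2) * m) * ennreal (gauss_modulus \<alpha> f x) \<le>
        ennreal (exp (\<alpha> / 2 * (norm x)\<^sup>2) * m) *
        (\<integral>\<^sup>+u. H u \<partial>lborel)"
      using m by (simp add: ennreal_mult)
    then show ?thesis
      using m unfolding H_def by (subst (asm) ennreal_mult_le_mult_iff) auto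
  qed
  moreover have "E / m > 0" using m by (simp add: E_def)
  ultimately show ?thesis by blast
qed

text \<open>\<open>s\<close> and \<open>B\<close> are supplied by
  \<open>Ap_restricted_reverse_holder\<close>. The scale \<open>s\<close> belongs to the weight and
  stays fixed while the lattice mesh varies.\<close>

locale ap_weight =
  fixes p \<alpha> s B :: real and w :: "complex \<Rightarrow> real"
  assumes p: "1 < p" and \<alpha>: "0 < \<alpha>" and s: "0 < s" and B: "0 < B"
    and w_measurable [measurable]: "w \<in> borel_measurable lebesgue"
    and w_nonneg: "\<And>z. 0 \<le> w z"
    and finite_square: "\<And>a. emeasure (weighted_measure w) (centred_square s a) < \<infinity>"
    and pos_square: "\<And>a. 0 < measure (weighted_measure w) (centred_square s a)"
    and reverse_holder: "\<And>a (g :: complex \<Rightarrow> real) x. g \<in> borel_measurable borel \<Longrightarrow> (\<And>u. 0 \<le> g u) \<Longrightarrow> 0 \<le> x \<Longrightarrow>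
      ennreal x \<le> (\<integral>\<^sup>+u\<in>centred_square s a. ennreal (g u) \<partial>lborel) \<Longrightarrow>
      ennreal (measure (weighted_measure w) (centred_square s a) * x powr p) \<le>
      ennreal B * (\<integral>\<^sup>+u\<in>centred_square s a. ennreal (g u powr p) \<partial>weighted_measure w)"
begin

abbreviation \<mu> :: "complex measure" where "\<mu> \<equiv> weighted_measure w"
abbreviation sq :: "complex \<Rightarrow> complex set" where "sq \<equiv> centred_square s"
abbreviation W :: "complex \<Rightarrow> real" where "W a \<equiv> measure \<mu> (sq a)"
abbreviation G :: "(complex \<Rightarrow> complex) \<Rightarrow> complex \<Rightarrow> real" where "G \<equiv> gauss_modulus \<alpha>"

lemma sets_\<mu> [measurable_cong, simp]: "sets \<mu> = sets lebesgue"
  by (simp add: weighted_measure_def)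

lemma borel_measurable_\<mu>: "f \<in> borel_measurable borel \<Longrightarrow> f \<in> borel_measurable \<mu>"
  by (subst measurable_cong_sets[OF sets_\<mu> refl]) (intro measurable_completion, simp)

lemma emeasure_sq: "emeasure \<mu> (sq a) = ennreal (W a)"
  using finite_square[of a] by (simp add: emeasure_eq_ennreal_measure less_top[symmetric])

lemma sets_borel_\<mu> [simp]: "A \<in> sets borel \<Longrightarrow> A \<in> sets \<mu>"
  by (simp add: sets_completionI_sets)

text \<open>\<open>reverse_holder\<close> is tested on the indicator of a square contained in both
  \<open>sq a\<close> and \<open>sq b\<close>: its mass is at most \<open>W b\<close>, while its
  area is a fixed quarter of s^2.\<close>

lemma W_doubling:
  assumes "norm (a - b) \<le> s / 2"
  shows "W a \<le> B / (s / 2)\<^sup>2 powr p * W b"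
proof -
  \<comment> \<open>The midpoint is within s/4 of both centres in each coordinate and
    \<open>E\<close> has half-side s/4, so \<open>E\<close> fits into both squares.\<close>
  define E where "E = centred_square (s / 2) ((a + b) / 2)"
  have [measurable]: "E \<in> sets borel" by (simp add: E_def)
  have ab: "\<bar>Re a - Re b\<bar> \<le> s / 2" "\<bar>Im a - Im b\<bar> \<le> s / 2"
    using assms abs_Re_le_cmod[of "a - b"] abs_Im_le_cmod[of "a - b"] by auto
  have sub: "E \<subseteq> sq a" "E \<subseteq> sq b"
  proof -
    have m: "Re ((a + b) / 2) = (Re a + Re b) / 2" "Im ((a + b) / 2) = (Im a + Im b) / 2"
      by simp_all
    have mid: "\<bar>x - c\<bar> \<le> t" "\<bar>x - d\<bar> \<le> t"
      if "\<bar>x - (c + d) / 2\<bar> \<le> t / 2" "\<bar>c - d\<bar> \<le> t" for x c d t :: real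
      using that by (auto simp: abs_le_iff field_simps)
    have "z \<in> sq a \<and> z \<in> sq b" if "z \<in> E" for z
      using that ab mid unfolding E_def in_centred_square m by blast
    then show "E \<subseteq> sq a" "E \<subseteq> sq b" by auto
  qed
  have "ennreal ((s / 2)\<^sup>2) = emeasure lborel E"
    using s by (simp add: E_def emeasure_centred_square)
  also have "\<dots> = (\<integral>\<^sup>+u. indicator E u \<partial>lborel)"
    by simp
  also have "\<dots> = (\<integral>\<^sup>+u\<in>sq a. ennreal (indicator E u) \<partial>lborel)"
    using sub by (intro nn_integral_cong) (auto split: split_indicator)
  finally have "ennreal (W a * (s / 2)\<^sup>2 powr p) \<le>
      ennreal B * (\<integral>\<^sup>+u\<in>sq a. ennreal (indicator E u powr p) \<partial>\<mu>)"
    by (intro reverse_holder) auto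
  also have "\<dots> \<le> ennreal B * (\<integral>\<^sup>+u. indicator (sq b) u \<partial>\<mu>)"
    using sub by (intro mult_left_mono nn_integral_mono) (auto split: split_indicator)
  also have "\<dots> = ennreal (B * W b)"
    using B by (simp add: emeasure_sq ennreal_mult)
  finally have "W a * (s / 2)\<^sup>2 powr p \<le> B * W b"
    using B by (subst (asm) ennreal_le_iff) auto
  then show ?thesis
    using s by (simp add: field_simps)
qed

text \<open>The segment between the points is cut into at most 2 |a-b| / s + 1 steps of length at
  most s/2, each costing a factor \<open>D\<close>. This replaces doubling at all scales, which may
  fail for the restricted class.\<close>

lemma W_exponential_growth: "\<exists>D>0. \<exists>\<kappa>\<ge>0. \<forall>a b. W a \<le> D * exp (\<kappa> * norm (a - b)) * W b"
proof -
  define D where "D = max 1 (B / (s / 2)\<^sup>2 powr p)"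
  have D: "D \<ge> 1" by (simp add: D_def)
  have step: "W a \<le> D * W b" if "norm (a - b) \<le> s / 2" for a b
  proof -
    have "W a \<le> B / (s / 2)\<^sup>2 powr p * W b" by (rule W_doubling[OF that])
    also have "\<dots> \<le> D * W b" by (intro mult_right_mono) (auto simp: D_def)
    finally show ?thesis .
  qed
  have chain: "norm (a - b) \<le> real n * (s / 2) \<Longrightarrow> W a \<le> D ^ n * W b" for n a b
  proof (induction n arbitrary: a b)
    case 0
    then show ?case by simp
  next
    case (Suc n)
    \<comment> \<open>The point reached from \<open>a\<close> after one of n + 1 equal steps towards
      \<open>b\<close>.\<close>
    define c where "c = a + (b - a) / of_nat (Suc n)"
    have 1: "norm (a - c) = norm (a - b) / (1 + real n)"
      by (simp add: c_def norm_divide norm_minus_commute del: of_nat_Suc)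
    have "c - b = (a - b) * of_real (real n / (1 + real n))"
      proof -
      have "1 + of_nat n \<noteq> (0 :: complex)"
        by (metis of_nat_Suc of_nat_eq_0_iff nat.distinct(1))
      then show ?thesis by (simp add: c_def field_simps)
    qed
    then have 2: "norm (c - b) = norm (a - b) * (real n / (1 + real n))"
      by (simp only: norm_mult norm_of_real) simp
    have 3: "norm (a - c) \<le> s / 2"
      unfolding 1 using Suc.prems by (simp add: field_simps)
    have "norm (c - b) \<le> (real (Suc n) * (s / 2)) * (real n / (1 + real n))"
      unfolding 2 by (intro mult_right_mono Suc.prems) simp
    also have "(real (Suc n) * (s / 2)) * (real n / (1 + real n)) = real n * (s / 2)"
      by (simp add: field_simps)
    finally have "W a \<le> D * W c" "W c \<le> D ^ n * W b"
      using 3 step Suc.IH by auto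
    then have "W a \<le> D * (D ^ n * W b)"
      using D by (meson mult_left_mono order_trans zero_le_one)
    then show ?case by (simp add: mult.assoc)
  qed
  define \<kappa> where "\<kappa> = 2 * ln D / s"
  have "W a \<le> D * exp (\<kappa> * norm (a - b)) * W b" for a b
  proof -
    \<comment> \<open>Rounding up adds at most one step, which becomes the prefactor
      \<open>D\<close>; the rest of the exponent becomes \<open>\<kappa>\<close>.\<close>
    define n where "n = nat \<lceil>norm (a - b) / (s / 2)\<rceil>"
    have n: "norm (a - b) / (s / 2) \<le> real n" "real n \<le> norm (a - b) / (s / 2) + 1"
      using s by (auto simp: n_def intro: real_nat_ceiling_ge)
    then have "norm (a - b) \<le> real n * (s / 2)"
      using s by (simp add: field_simps)
    then have "W a \<le> D ^ n * W b" by (rule chain)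
    also have "D ^ n = D powr real n"
      using D by (simp add: powr_realpow)
    also have "\<dots> \<le> D powr (norm (a - b) / (s / 2) + 1)"
      using D n by (intro powr_mono) auto
    also have "\<dots> = D * exp (\<kappa> * norm (a - b))"
      using D by (simp add: powr_add) (simp add: powr_def \<kappa>_def field_simps)
    finally show ?thesis
      by (simp add: mult_right_mono)
  qed
  moreover have "\<kappa> \<ge> 0" "D > 0" using D s by (auto simp: \<kappa>_def)
  ultimately show ?thesis by blast
qed

end

text \<open>Completing the square. It is used whenever exponential growth has to be absorbed by part
  of a Gaussian.\<close>

lemma linear_le_quadratic:
  fixes \<kappa> \<beta> t :: real
  assumes "\<beta> > 0"
  shows "\<kappa> * t \<le> \<beta> * t\<^sup>2 + \<kappa>\<^sup>2 / (4 * \<beta>)"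
proof -
  have "0 \<le> (2 * \<beta> * t - \<kappa>)\<^sup>2 / (4 * \<beta>)"
    using assms by simp
  also have "(2 * \<beta> * t - \<kappa>)\<^sup>2 / (4 * \<beta>) = \<beta> * t\<^sup>2 - \<kappa> * t + \<kappa>\<^sup>2 / (4 * \<beta>)"
    using assms by (simp add: power2_eq_square field_simps)
  finally show ?thesis by simp
qed

lemma summable_on_lattice_gaussian:
  assumes "\<beta> > 0" "r > 0"
  shows "(\<lambda>\<nu>. exp (- \<beta> * (norm (z - \<nu>))\<^sup>2)) summable_on lattice_pts r"
proof -
  obtain C where C: "(\<integral>\<^sup>+\<nu>. ennreal (r\<^sup>2 * exp (- \<beta> * (norm (z - \<nu>))\<^sup>2)) \<partial>count_space (lattice_pts r)) \<le> ennreal C"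
    using lattice_gaussian_sum_bound[OF assms] assms(2) by blast
  then have "(\<lambda>\<nu>. r\<^sup>2 * exp (- \<beta> * (norm (z - \<nu>))\<^sup>2)) summable_on lattice_pts r"
    by (subst summable_on_iff_nn_integral) (auto intro: le_less_trans)
  then show ?thesis
    using assms(2) by (subst (asm) summable_on_cmult_right') auto
qed

context ap_weight
begin

text \<open>The plane is covered by the squares around \<nu> + \<tau> with \<tau> in the lattice of
  mesh \<open>s\<close>. On each of them the Gaussian is controlled by a wider Gaussian at the
  centre, and the mass is at most an exponential factor times \<open>W \<nu>\<close>, so a lattice
  Gaussian dominates the sum.\<close>

lemma gaussian_weight_bound:
  assumes "\<beta> > 0"
  shows "\<exists>C>0. \<forall>\<nu>. (\<integral>\<^sup>+z. ennreal (exp (- \<beta> * (norm (z - \<nu>))\<^sup>2)) \<partial>\<mu>) \<le> ennreal (C * W \<nu>)"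
proof -
  obtain D \<kappa> where D: "D > 0" "\<kappa> \<ge> 0" and grow: "\<And>a b. W a \<le> D * exp (\<kappa> * norm (a - b)) * W b"
    using W_exponential_growth by blast
  obtain C1 where C1: "C1 > 0" and sum1:
    "\<And>z. (\<integral>\<^sup>+\<tau>. ennreal (s\<^sup>2 * exp (- (\<beta> / 4) * (norm (z - \<tau>))\<^sup>2)) \<partial>count_space (lattice_pts s)) \<le> ennreal C1"
    using lattice_gaussian_sum_bound[of "\<beta> / 4" s] assms s by auto
  let ?L = "count_space (lattice_pts s)"
  define E where "E = exp (\<beta> * s\<^sup>2) * (D * exp (\<kappa>\<^sup>2 / \<beta>)) / s\<^sup>2"
  have E: "E > 0" using D s by (simp add: E_def)
  have "(\<integral>\<^sup>+z. ennreal (exp (- \<beta> * (norm (z - \<nu>))\<^sup>2)) \<partial>\<mu>) \<le> ennreal (E * C1 * W \<nu>)" for \<nu>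
  proof -
    define F where "F = (\<lambda>\<tau> z. ennreal (exp (\<beta> * s\<^sup>2) * exp (- (\<beta> / 2) * (norm \<tau>)\<^sup>2)) * indicator (sq (\<nu> + \<tau>)) z)"
    have [measurable]: "F \<tau> \<in> borel_measurable \<mu>" for \<tau>
      unfolding F_def by (intro borel_measurable_times_ennreal borel_measurable_indicator) auto
    have "(\<integral>\<^sup>+z. ennreal (exp (- \<beta> * (norm (z - \<nu>))\<^sup>2)) \<partial>\<mu>) \<le> (\<integral>\<^sup>+z. \<integral>\<^sup>+\<tau>. F \<tau> z \<partial>?L \<partial>\<mu>)"
    proof (intro nn_integral_mono)
      fix z
      \<comment> \<open>\<open>lattice_floor\<close> returns a corner; adding half a side first
        makes \<tau> a nearest lattice point, so that the centred square at \<nu> + \<tau> contains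
        \<open>z\<close>.\<close>
      define u where "u = z - \<nu> + Complex (s / 2) (s / 2)"
      define \<tau> where "\<tau> = lattice_floor s u"
      have 1: "\<bar>x - s * of_int \<lfloor>(x + s / 2) / s\<rfloor>\<bar> \<le> s / 2" for x
      proof -
        have "s * ((x + s / 2) / s - of_int \<lfloor>(x + s / 2) / s\<rfloor>) \<le> s * 1"
          "0 \<le> s * ((x + s / 2) / s - of_int \<lfloor>(x + s / 2) / s\<rfloor>)"
          using s by (intro mult_left_mono mult_nonneg_nonneg; linarith)+
        then show ?thesis
          using s unfolding abs_le_iff by (simp add: right_diff_distrib)
      qed
      have "z \<in> sq (\<nu> + \<tau>)"
        using 1[of "Re z - Re \<nu>"] 1[of "Im z - Im \<nu>"]
        by (simp add: in_centred_square \<tau>_def u_def lattice_floor_def diff_diff_eq)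
      moreover from this have "norm ((\<nu> + \<tau>) - z) \<le> s"
        using norm_diff_centred_square norm_minus_commute by metis
      from exp_neg_square_shift[OF assms this, of \<nu>]
      have "exp (- \<beta> * (norm (z - \<nu>))\<^sup>2) \<le> exp (\<beta> * s\<^sup>2) * exp (- (\<beta> / 2) * (norm \<tau>)\<^sup>2)"
        by (simp add: norm_minus_commute)
      ultimately have "ennreal (exp (- \<beta> * (norm (z - \<nu>))\<^sup>2)) \<le> F \<tau> z"
        by (simp add: F_def ennreal_leI)
      also have "\<dots> = (\<integral>\<^sup>+\<tau>'. F \<tau>' z * indicator {\<tau>} \<tau>' \<partial>?L)"
        by (subst nn_integral_indicator_singleton) (auto simp: \<tau>_def lattice_floor_in)
      also have "\<dots> \<le> (\<integral>\<^sup>+\<tau>'. F \<tau>' z \<partial>?L)"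
        by (intro nn_integral_mono) (auto split: split_indicator)
      finally show "ennreal (exp (- \<beta> * (norm (z - \<nu>))\<^sup>2)) \<le> (\<integral>\<^sup>+\<tau>. F \<tau> z \<partial>?L)" .
    qed
    also have "\<dots> = (\<integral>\<^sup>+\<tau>. \<integral>\<^sup>+z. F \<tau> z \<partial>\<mu> \<partial>?L)"
      by (intro nn_integral_count_space_nn_integral countable_lattice_pts) auto
    also have "\<dots> \<le> (\<integral>\<^sup>+\<tau>. ennreal (E * W \<nu>) * ennreal (s\<^sup>2 * exp (- (\<beta> / 4) * (norm (0 - \<tau>))\<^sup>2)) \<partial>?L)"
    proof (intro nn_integral_mono)
      fix \<tau> :: complex
      have e: "exp (- (\<beta> / 2) * (norm \<tau>)\<^sup>2) * exp (\<kappa> * norm \<tau>) \<le> exp (\<kappa>\<^sup>2 / \<beta>) * exp (- (\<beta> / 4) * (norm \<tau>)\<^sup>2)"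
        using linear_le_quadratic[of "\<beta> / 4" \<kappa> "norm \<tau>"] assms by (simp add: mult_exp_exp)
      have "(\<integral>\<^sup>+z. F \<tau> z \<partial>\<mu>) = ennreal (exp (\<beta> * s\<^sup>2) * exp (- (\<beta> / 2) * (norm \<tau>)\<^sup>2)) * ennreal (W (\<nu> + \<tau>))"
        unfolding F_def by (subst nn_integral_cmult_indicator) (auto simp: emeasure_sq)
      also have "\<dots> = ennreal (exp (\<beta> * s\<^sup>2) * exp (- (\<beta> / 2) * (norm \<tau>)\<^sup>2) * W (\<nu> + \<tau>))"
        by (simp flip: ennreal_mult)
      also have "\<dots> \<le> ennreal (exp (\<beta> * s\<^sup>2) * exp (- (\<beta> / 2) * (norm \<tau>)\<^sup>2) * (D * exp (\<kappa> * norm \<tau>) * W \<nu>))"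
        using grow[of "\<nu> + \<tau>" \<nu>] by (intro ennreal_leI mult_left_mono) auto
      also have "exp (\<beta> * s\<^sup>2) * exp (- (\<beta> / 2) * (norm \<tau>)\<^sup>2) * (D * exp (\<kappa> * norm \<tau>) * W \<nu>) =
          exp (\<beta> * s\<^sup>2) * D * W \<nu> * (exp (- (\<beta> / 2) * (norm \<tau>)\<^sup>2) * exp (\<kappa> * norm \<tau>))"
        by (simp only: mult_ac)
      also have "ennreal \<dots> \<le> ennreal (exp (\<beta> * s\<^sup>2) * D * W \<nu> * (exp (\<kappa>\<^sup>2 / \<beta>) * exp (- (\<beta> / 4) * (norm \<tau>)\<^sup>2)))"
        using D by (intro ennreal_leI mult_left_mono e) auto
      also have "exp (\<beta> * s\<^sup>2) * D * W \<nu> * (exp (\<kappa>\<^sup>2 / \<beta>) * exp (- (\<beta> / 4) * (norm \<tau>)\<^sup>2)) =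
          E * W \<nu> * (s\<^sup>2 * exp (- (\<beta> / 4) * (norm \<tau>)\<^sup>2))"
        using s by (simp add: E_def)
      also have "ennreal \<dots> = ennreal (E * W \<nu>) * ennreal (s\<^sup>2 * exp (- (\<beta> / 4) * (norm (0 - \<tau>))\<^sup>2))"
        using E by (simp flip: ennreal_mult)
      finally show "(\<integral>\<^sup>+z. F \<tau> z \<partial>\<mu>) \<le> ennreal (E * W \<nu>) * ennreal (s\<^sup>2 * exp (- (\<beta> / 4) * (norm (0 - \<tau>))\<^sup>2))" .
    qed
    also have "\<dots> = ennreal (E * W \<nu>) *
        (\<integral>\<^sup>+\<tau>. ennreal (s\<^sup>2 * exp (- (\<beta> / 4) * (norm (0 - \<tau>))\<^sup>2)) \<partial>?L)"
      by (intro nn_integral_cmult) auto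
    also have "\<dots> \<le> ennreal (E * W \<nu>) * ennreal C1"
      by (intro mult_left_mono sum1) simp
    also have "\<dots> = ennreal (E * C1 * W \<nu>)"
      using E C1 by (simp add: mult_ac flip: ennreal_mult)
    finally show ?thesis .
  qed
  then show ?thesis
    using E C1 by (intro exI[of _ "E * C1"]) auto
qed

text \<open>The sub-mean value property and \<open>reverse_holder\<close> are applied at \<nu> +
  \<zeta>, and exponential growth moves the mass back to \<nu>. Radius \<rho> = 0 serves point
  values; \<rho> = 2 serves Cauchy estimates, which need a whole disc. The enlargement by 2 s covers
  the square around \<nu> + \<zeta>.\<close>

lemma local_sup_bound:
  assumes "0 \<le> \<rho>"
  shows "\<exists>C>0. \<forall>f \<nu> \<zeta>. f holomorphic_on UNIV \<longrightarrow> norm \<zeta> \<le> \<rho> \<longrightarrow>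
    ennreal (W \<nu> * G f (\<nu> + \<zeta>) powr p) \<le>
    ennreal C * (\<integral>\<^sup>+z. ennreal (G f z powr p) * indicator (ball \<nu> (\<rho> + 2 * s)) z \<partial>\<mu>)"
proof -
  obtain D \<kappa> where D: "D > 0" "\<kappa> \<ge> 0" and grow: "\<And>a b. W a \<le> D * exp (\<kappa> * norm (a - b)) * W b"
    using W_exponential_growth by blast
  obtain C1 where C1: "C1 > 0" and mv: "\<And>f x. f holomorphic_on UNIV \<Longrightarrow>
      ennreal (G f x) \<le> (\<integral>\<^sup>+u\<in>ball x (s / 2). ennreal (C1 * G f u) \<partial>lborel)"
    using entire_sub_mean_value[of \<alpha> "s / 2"] \<alpha> s by auto
  define C where "C = D * exp (\<kappa> * \<rho>) * (B * C1 powr p)"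
  have "C > 0" using D B C1 by (simp add: C_def)
  moreover have "ennreal (W \<nu> * G f (\<nu> + \<zeta>) powr p) \<le>
      ennreal C * (\<integral>\<^sup>+z. ennreal (G f z powr p) * indicator (ball \<nu> (\<rho> + 2 * s)) z \<partial>\<mu>)"
    if f: "f holomorphic_on UNIV" and \<zeta>: "norm \<zeta> \<le> \<rho>" for f \<nu> \<zeta>
  proof -
    note [measurable] = borel_measurable_entire[OF f]
    define x where "x = \<nu> + \<zeta>"
    have sub1: "ball x (s / 2) \<subseteq> sq x"
    proof
      fix z assume "z \<in> ball x (s / 2)"
      then show "z \<in> sq x"
        using abs_Re_le_cmod[of "z - x"] abs_Im_le_cmod[of "z - x"]
        by (auto simp: in_centred_square dist_norm norm_minus_commute)
    qed
    have sub2: "sq x \<subseteq> ball \<nu> (\<rho> + 2 * s)"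
    proof
      fix z assume "z \<in> sq x"
      then have "norm (z - x) \<le> s" by (rule norm_diff_centred_square)
      then have "norm (z - \<nu>) \<le> s + \<rho>"
        using norm_triangle_ineq[of "z - x" \<zeta>] \<zeta> by (simp add: x_def)
      then show "z \<in> ball \<nu> (\<rho> + 2 * s)"
        using s by (simp add: dist_norm norm_minus_commute)
    qed
    have "ennreal (G f x) \<le> (\<integral>\<^sup>+u\<in>ball x (s / 2). ennreal (C1 * G f u) \<partial>lborel)"
      by (rule mv[OF f])
    also have "\<dots> \<le> (\<integral>\<^sup>+u\<in>sq x. ennreal (C1 * G f u) \<partial>lborel)"
      using sub1 by (intro nn_integral_mono) (auto split: split_indicator)
    finally have "ennreal (W x * G f x powr p) \<le> ennreal B * (\<integral>\<^sup>+u\<in>sq x. ennreal ((C1 * G f u) powr p) \<partial>\<mu>)"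
      using C1 by (intro reverse_holder) auto
    also have "\<dots> \<le> ennreal B * (\<integral>\<^sup>+u. ennreal (C1 powr p) * (ennreal (G f u powr p) * indicator (ball \<nu> (\<rho> + 2 * s)) u) \<partial>\<mu>)"
      using sub2 C1
      by (intro mult_left_mono nn_integral_mono) (auto simp: powr_mult split: split_indicator simp flip: ennreal_mult)
    also have "\<dots> = ennreal (B * C1 powr p) * (\<integral>\<^sup>+u. ennreal (G f u powr p) * indicator (ball \<nu> (\<rho> + 2 * s)) u \<partial>\<mu>)"
    proof -
      have "(\<lambda>u. ennreal (G f u powr p) * indicator (ball \<nu> (\<rho> + 2 * s)) u) \<in> borel_measurable borel"
        by (intro borel_measurable_times_ennreal borel_measurable_indicator) auto
      from borel_measurable_\<mu>[OF this] show ?thesis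
        using B by (simp add: nn_integral_cmult ennreal_mult mult.assoc)
    qed
    finally have *: "ennreal (W x * G f x powr p) \<le>
        ennreal (B * C1 powr p) * (\<integral>\<^sup>+u. ennreal (G f u powr p) * indicator (ball \<nu> (\<rho> + 2 * s)) u \<partial>\<mu>)" .
    have "W \<nu> \<le> D * exp (\<kappa> * norm \<zeta>) * W x"
      using grow[of \<nu> x] by (simp add: x_def)
    also have "\<dots> \<le> D * exp (\<kappa> * \<rho>) * W x"
      using D \<zeta> by (intro mult_right_mono mult_left_mono) (auto intro: mult_left_mono)
    finally have "W \<nu> * G f x powr p \<le> D * exp (\<kappa> * \<rho>) * W x * G f x powr p"
      by (rule mult_right_mono) simp
    then have "ennreal (W \<nu> * G f x powr p) \<le> ennreal (D * exp (\<kappa> * \<rho>)) * ennreal (W x * G f x powr p)"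
      using D by (simp add: mult.assoc ennreal_leI flip: ennreal_mult)
    also have "\<dots> \<le> ennreal (D * exp (\<kappa> * \<rho>)) * (ennreal (B * C1 powr p) *
        (\<integral>\<^sup>+u. ennreal (G f u powr p) * indicator (ball \<nu> (\<rho> + 2 * s)) u \<partial>\<mu>))"
      by (intro mult_left_mono *) simp
    also have "\<dots> = ennreal C * (\<integral>\<^sup>+u. ennreal (G f u powr p) * indicator (ball \<nu> (\<rho> + 2 * s)) u \<partial>\<mu>)"
      using D B by (simp add: C_def ennreal_mult mult.assoc)
    finally show ?thesis by (simp add: x_def)
  qed
  ultimately show ?thesis by blast
qed

section \<open>The Fock norm as an integral against the weighted measure, and the norms of the
  kernels\<close>

lemma nn_integral_fock_integrand:
  assumes [measurable]: "f \<in> borel_measurable borel"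
  shows "(\<integral>\<^sup>+z. ennreal (fock_integrand p \<alpha> w f z) \<partial>lebesgue) = (\<integral>\<^sup>+z. ennreal (G f z powr p) \<partial>\<mu>)"
proof -
  have "(\<lambda>z. ennreal (G f z powr p)) \<in> borel_measurable lebesgue"
    by (intro measurable_completion) simp
  then have "(\<integral>\<^sup>+z. ennreal (G f z powr p) \<partial>\<mu>) = (\<integral>\<^sup>+z. ennreal (w z) * ennreal (G f z powr p) \<partial>lebesgue)"
    unfolding weighted_measure_def by (intro nn_integral_density) auto
  also have "\<dots> = (\<integral>\<^sup>+z. ennreal (fock_integrand p \<alpha> w f z) \<partial>lebesgue)"
  proof (intro nn_integral_cong)
    fix z
    have "G f z powr p = norm (f z) powr p * exp (- (p * \<alpha> / 2) * (norm z)\<^sup>2)"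
      by (simp add: gauss_modulus_def powr_mult exp_powr_real mult.commute)
    then show "ennreal (w z) * ennreal (G f z powr p) = ennreal (fock_integrand p \<alpha> w f z)"
      using w_nonneg by (simp add: fock_integrand_def mult_ac flip: ennreal_mult)
  qed
  finally show ?thesis ..
qed

lemma fock_space_iff:
  "f \<in> fock_space p \<alpha> w \<longleftrightarrow> f holomorphic_on UNIV \<and> (\<integral>\<^sup>+z. ennreal (G f z powr p) \<partial>\<mu>) < \<infinity>"
proof (cases "f holomorphic_on UNIV")
  case True
  note [measurable] = borel_measurable_entire[OF True]
  have fl [measurable]: "f \<in> borel_measurable lebesgue"
    by (intro measurable_completion) simp
  have "(\<lambda>z :: complex. exp (- (p * \<alpha> / 2) * (norm z)\<^sup>2)) \<in> borel_measurable borel"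
    by (intro borel_measurable_continuous_onI continuous_intros)
  then have [measurable]: "(\<lambda>z :: complex. exp (- (p * \<alpha> / 2) * (norm z)\<^sup>2)) \<in> borel_measurable lebesgue"
    by (intro measurable_completion) simp
  have [measurable]: "fock_integrand p \<alpha> w f \<in> borel_measurable lebesgue"
    unfolding fock_integrand_def by measurable
  have "0 \<le> fock_integrand p \<alpha> w f z" for z
    using w_nonneg by (simp add: fock_integrand_def)
  then have "integrable lebesgue (fock_integrand p \<alpha> w f) \<longleftrightarrow>
      (\<integral>\<^sup>+z. ennreal (fock_integrand p \<alpha> w f z) \<partial>lebesgue) < \<infinity>"
    by (simp add: integrable_iff_bounded)
  then show ?thesis
    using True by (simp add: fock_space_def nn_integral_fock_integrand)
qed (simp add: fock_space_def)

lemma fock_norm_powr: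
  assumes "f \<in> fock_space p \<alpha> w"
  shows "ennreal (fock_norm p \<alpha> w f powr p) = (\<integral>\<^sup>+z. ennreal (G f z powr p) \<partial>\<mu>)"
proof -
  have f: "f holomorphic_on UNIV" "integrable lebesgue (fock_integrand p \<alpha> w f)"
    using assms by (auto simp: fock_space_def)
  have nn: "0 \<le> fock_integrand p \<alpha> w f z" for z
    using w_nonneg by (simp add: fock_integrand_def)
  have "fock_norm p \<alpha> w f powr p = integral\<^sup>L lebesgue (fock_integrand p \<alpha> w f)"
    using p nn by (simp add: fock_norm_def powr_powr)
  also have "ennreal \<dots> = (\<integral>\<^sup>+z. ennreal (fock_integrand p \<alpha> w f z) \<partial>lebesgue)"
    using f nn by (intro nn_integral_eq_integral[symmetric]) auto
  finally show ?thesis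
    using f by (simp add: nn_integral_fock_integrand borel_measurable_entire)
qed

definition kernel_norm :: "complex \<Rightarrow> real"
  where "kernel_norm \<nu> = fock_norm p \<alpha> w (fock_kernel \<alpha> \<nu>)"

text \<open>The height of the Gaussian bump is divided out, which leaves a quantity comparable to
  the p-th root of \<open>W \<nu>\<close>.\<close>

definition reduced_norm :: "complex \<Rightarrow> real"
  where "reduced_norm \<nu> = kernel_norm \<nu> * exp (- (\<alpha> / 2) * (norm \<nu>)\<^sup>2)"

text \<open>The p-th power of \<open>reduced_norm \<nu>\<close> is the integral of a Gaussian
  centred at \<nu>. The upper bound is \<open>gaussian_weight_bound\<close>; for the lower one only
  \<open>sq \<nu>\<close> is kept, where the Gaussian is at least \<open>c\<close>. Kernel norms can
  thus be traded for masses of squares.\<close>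

lemma reduced_norm_bounds:
  "\<exists>c>0. \<exists>C>0. \<forall>\<nu>. 0 < reduced_norm \<nu> \<and> c * W \<nu> \<le> reduced_norm \<nu> powr p \<and> reduced_norm \<nu> powr p \<le> C * W \<nu>"
proof -
  obtain C where C: "C > 0" and bd:
      "\<And>\<nu>. (\<integral>\<^sup>+z. ennreal (exp (- (p * \<alpha> / 2) * (norm (z - \<nu>))\<^sup>2)) \<partial>\<mu>) \<le> ennreal (C * W \<nu>)"
    using gaussian_weight_bound[of "p * \<alpha> / 2"] p \<alpha> by auto
  define c where "c = exp (- (p * \<alpha> / 2) * s\<^sup>2)"
  have "0 < reduced_norm \<nu> \<and> c * W \<nu> \<le> reduced_norm \<nu> powr p \<and> reduced_norm \<nu> powr p \<le> C * W \<nu>" for \<nu>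
  proof -
    define J where "J = (\<integral>\<^sup>+z. ennreal (exp (- (p * \<alpha> / 2) * (norm (z - \<nu>))\<^sup>2)) \<partial>\<mu>)"
    have "G (fock_kernel \<alpha> \<nu>) z powr p = exp (p * \<alpha> / 2 * (norm \<nu>)\<^sup>2) * exp (- (p * \<alpha> / 2) * (norm (z - \<nu>))\<^sup>2)" for z
      by (simp add: gauss_modulus_kernel powr_mult exp_powr_real mult_ac)
    moreover have "(\<lambda>z. ennreal (exp (- (p * \<alpha> / 2) * (norm (z - \<nu>))\<^sup>2))) \<in> borel_measurable \<mu>"
      by (intro borel_measurable_\<mu> measurable_compose[OF _ measurable_ennreal]
          borel_measurable_continuous_onI continuous_intros)
    ultimately have eq: "(\<integral>\<^sup>+z. ennreal (G (fock_kernel \<alpha> \<nu>) z powr p) \<partial>\<mu>) = ennreal (exp (p * \<alpha> / 2 * (norm \<nu>)\<^sup>2)) * J"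
      by (simp add: J_def ennreal_mult nn_integral_cmult)
    have Jle: "J \<le> ennreal (C * W \<nu>)" unfolding J_def by (rule bd)
    then have "fock_kernel \<alpha> \<nu> \<in> fock_space p \<alpha> w"
      unfolding fock_space_iff eq using holomorphic_on_fock_kernel
      by (auto simp: ennreal_mult_less_top intro: le_less_trans)
    from fock_norm_powr[OF this] have N: "ennreal (kernel_norm \<nu> powr p) = ennreal (exp (p * \<alpha> / 2 * (norm \<nu>)\<^sup>2)) * J"
      by (simp add: eq kernel_norm_def)
    have "kernel_norm \<nu> \<ge> 0" by (simp add: kernel_norm_def fock_norm_def)
    then have "reduced_norm \<nu> powr p = kernel_norm \<nu> powr p * exp (- (p * \<alpha> / 2) * (norm \<nu>)\<^sup>2)"
      by (simp add: reduced_norm_def powr_mult exp_powr_real mult.commute)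
    then have "ennreal (reduced_norm \<nu> powr p) = ennreal (exp (p * \<alpha> / 2 * (norm \<nu>)\<^sup>2) * exp (- (p * \<alpha> / 2) * (norm \<nu>)\<^sup>2)) * J"
      using N by (simp add: ennreal_mult mult_ac)
    then have R: "ennreal (reduced_norm \<nu> powr p) = J"
      by (simp add: mult_exp_exp)
    have up: "reduced_norm \<nu> powr p \<le> C * W \<nu>"
      using Jle C unfolding R[symmetric] by (subst (asm) ennreal_le_iff) auto
    have "ennreal (c * W \<nu>) = (\<integral>\<^sup>+z. ennreal c * indicator (sq \<nu>) z \<partial>\<mu>)"
      by (subst nn_integral_cmult_indicator) (auto simp: c_def emeasure_sq ennreal_mult)
    also have "\<dots> \<le> J"
      unfolding J_def
    proof (intro nn_integral_mono)
      fix z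
      have "exp (- (p * \<alpha> / 2) * s\<^sup>2) \<le> exp (- (p * \<alpha> / 2) * (norm (z - \<nu>))\<^sup>2)" if "z \<in> sq \<nu>"
        using norm_diff_centred_square[OF that] p \<alpha> by (simp add: mult_left_mono power_mono)
      then show "ennreal c * indicator (sq \<nu>) z \<le> ennreal (exp (- (p * \<alpha> / 2) * (norm (z - \<nu>))\<^sup>2))"
        by (auto simp: c_def split: split_indicator)
    qed
    finally have low: "c * W \<nu> \<le> reduced_norm \<nu> powr p"
      unfolding R[symmetric] by (subst (asm) ennreal_le_iff) auto
    have "0 < c * W \<nu>" using pos_square by (simp add: c_def)
    then have "reduced_norm \<nu> \<noteq> 0" using low by auto
    moreover have "reduced_norm \<nu> \<ge> 0" by (simp add: reduced_norm_def kernel_norm_def fock_norm_def)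
    ultimately show ?thesis using low up by simp
  qed
  moreover have "c > 0" by (simp add: c_def)
  ultimately show ?thesis using C by blast
qed

end

subsection \<open>Synthesis\<close>

lemma lp_space_iff:
  "c \<in> lp_space p A \<longleftrightarrow> (\<integral>\<^sup>+\<nu>. ennreal (norm (c \<nu>) powr p) \<partial>count_space A) < \<infinity>"
  unfolding lp_space_def by (simp add: summable_on_iff_nn_integral)

lemma lp_norm_powr:
  assumes "c \<in> lp_space p A" "p \<noteq> 0"
  shows "ennreal (lp_norm p A c powr p) = (\<integral>\<^sup>+\<nu>. ennreal (norm (c \<nu>) powr p) \<partial>count_space A)"
proof -
  have "lp_norm p A c powr p = (\<Sum>\<^sub>\<infinity>\<nu>\<in>A. norm (c \<nu>) powr p)"
    using assms by (simp add: lp_norm_def powr_powr infsum_nonneg)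
  then show ?thesis
    using assms by (simp add: infsum_eq_nn_integral lp_space_def)
qed

lemma le_of_nn_integral_count_space_le:
  assumes "(\<integral>\<^sup>+\<nu>. ennreal (g \<nu>) \<partial>count_space A) \<le> ennreal b" "\<nu> \<in> A" "0 \<le> b"
  shows "g \<nu> \<le> b"
proof -
  have "ennreal (g \<nu>) \<le> (\<integral>\<^sup>+\<nu>. ennreal (g \<nu>) \<partial>count_space A)"
    by (rule nn_integral_ge_point[OF assms(2)])
  also have "\<dots> \<le> ennreal b" by (rule assms(1))
  finally show ?thesis
    using assms(3) by (simp add: ennreal_le_iff)
qed

lemma norm_le_lp_norm:
  assumes "c \<in> lp_space p A" "0 < p" "\<nu> \<in> A"
  shows "norm (c \<nu>) \<le> lp_norm p A c"
proof -
  have "norm (c \<nu>) powr p \<le> lp_norm p A c powr p"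
    by (rule le_of_nn_integral_count_space_le[OF _ assms(3)])
       (use lp_norm_powr[OF assms(1)] assms(2) in auto)
  moreover have "0 \<le> lp_norm p A c"
    by (simp add: lp_norm_def)
  ultimately show ?thesis
    using powr_less_mono2[OF assms(2), of "lp_norm p A c" "norm (c \<nu>)"] by force
qed

context ap_weight
begin

lemma kernel_norm_pos: "0 < kernel_norm \<nu>"
proof -
  have "0 < reduced_norm \<nu>"
    using reduced_norm_bounds by blast
  then show ?thesis
    by (simp add: reduced_norm_def zero_less_mult_iff)
qed

text \<open>On the disc the kernel is at most exp(alpha \<rho> |\<nu>|), whereas its norm is at
  least exp(alpha |\<nu>|^2 / 2) up to an exponential factor. The quotient has a summable Gaussian
  majorant, so bounded coefficients give locally uniform convergence.\<close>

lemma kernel_quotient_majorant: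
  assumes "r > 0" "\<rho> \<ge> 0"
  shows "\<exists>M. (\<forall>\<nu>. 0 \<le> M \<nu>) \<and> M summable_on lattice_pts r \<and>
    (\<forall>z \<nu>. norm z \<le> \<rho> \<longrightarrow> norm (fock_kernel \<alpha> \<nu> z / of_real (kernel_norm \<nu>)) \<le> M \<nu>)"
proof -
  obtain D \<kappa> where D: "D > 0" "\<kappa> \<ge> 0" and grow: "\<And>a b. W a \<le> D * exp (\<kappa> * norm (a - b)) * W b"
    using W_exponential_growth by blast
  obtain c where c: "c > 0" and low: "\<And>\<nu>. c * W \<nu> \<le> reduced_norm \<nu> powr p" and pos: "\<And>\<nu>. 0 < reduced_norm \<nu>"
    using reduced_norm_bounds by blast
  define q where "q = (c * W 0 / D) powr (1 / p)"
  have q: "q > 0" using c D pos_square[of 0] by (simp add: q_def)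
  have red: "q * exp (- (\<kappa> / p) * norm \<nu>) \<le> reduced_norm \<nu>" for \<nu>
  proof -
    have "q * exp (- (\<kappa> / p) * norm \<nu>) = (c * W 0 / D) powr (1 / p) * exp (- \<kappa> * norm \<nu>) powr (1 / p)"
      by (simp add: q_def exp_powr_real)
    also have "\<dots> = (c * W 0 / D * exp (- \<kappa> * norm \<nu>)) powr (1 / p)"
      by (rule powr_mult[symmetric])
    finally have split: "q * exp (- (\<kappa> / p) * norm \<nu>) = (c * W 0 / D * exp (- \<kappa> * norm \<nu>)) powr (1 / p)" .
    have "c * W 0 / D * exp (- \<kappa> * norm \<nu>) \<le> c * W \<nu>"
      using grow[of 0 \<nu>] D c by (simp add: exp_minus field_simps)
    also have "\<dots> \<le> reduced_norm \<nu> powr p" by (rule low)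
    finally have "(c * W 0 / D * exp (- \<kappa> * norm \<nu>)) powr (1 / p) \<le> (reduced_norm \<nu> powr p) powr (1 / p)"
      using c D p by (intro powr_mono2) auto
    then show ?thesis
      unfolding split using p pos[of \<nu>] by (simp add: powr_powr)
  qed
  \<comment> \<open>The cost of absorbing the linear exponent (alpha \<rho> + \<kappa>/p) |\<nu>|
    into one half of the available alpha/2.\<close>
  define e where "e = (\<alpha> * \<rho> + \<kappa> / p)\<^sup>2 / (4 * (\<alpha> / 4))"
  define M where "M = (\<lambda>\<nu> :: complex. exp e / q * exp (- (\<alpha> / 4) * (norm (0 - \<nu>))\<^sup>2))"
  have "norm (fock_kernel \<alpha> \<nu> z / of_real (kernel_norm \<nu>)) \<le> M \<nu>" if z: "norm z \<le> \<rho>" for z \<nu>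
  proof -
    have "Re (cnj \<nu> * z) \<le> norm (cnj \<nu> * z)"
      by (rule complex_Re_le_cmod)
    also have "\<dots> \<le> norm \<nu> * \<rho>"
      using z by (simp add: norm_mult mult_left_mono)
    finally have "\<alpha> * Re (cnj \<nu> * z) \<le> \<alpha> * (norm \<nu> * \<rho>)"
      using \<alpha> by simp
    moreover have "norm (fock_kernel \<alpha> \<nu> z) = exp (\<alpha> * Re (cnj \<nu> * z))"
      by (simp add: fock_kernel_def norm_exp_eq_Re algebra_simps)
    ultimately have 1: "norm (fock_kernel \<alpha> \<nu> z) \<le> exp (\<alpha> * \<rho> * norm \<nu>)"
      by (simp add: mult_ac)
    have "kernel_norm \<nu> = reduced_norm \<nu> * exp ((\<alpha> / 2) * (norm \<nu>)\<^sup>2)"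
      by (simp add: reduced_norm_def mult.assoc mult_exp_exp)
    then have 2: "q * exp (- (\<kappa> / p) * norm \<nu>) * exp ((\<alpha> / 2) * (norm \<nu>)\<^sup>2) \<le> kernel_norm \<nu>"
      using red by simp
    have "norm (fock_kernel \<alpha> \<nu> z / of_real (kernel_norm \<nu>)) = norm (fock_kernel \<alpha> \<nu> z) / kernel_norm \<nu>"
      using kernel_norm_pos[of \<nu>] by (simp add: norm_divide)
    also have "\<dots> \<le> exp (\<alpha> * \<rho> * norm \<nu>) / (q * exp (- (\<kappa> / p) * norm \<nu>) * exp ((\<alpha> / 2) * (norm \<nu>)\<^sup>2))"
      using q by (intro frac_le 1 2) auto
    also have "\<dots> = exp ((\<alpha> * \<rho> + \<kappa> / p) * norm \<nu> - (\<alpha> / 2) * (norm \<nu>)\<^sup>2) / q"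
    proof -
      have "exp a / (q * exp (- b) * exp t) = exp (a + b - t) / q" for a b t
        using q by (simp add: exp_minus exp_diff exp_add field_simps)
      from this[of _ "\<kappa> / p * norm \<nu>"] show ?thesis
        by (simp add: distrib_right)
    qed
    also have "\<dots> \<le> exp (e - (\<alpha> / 4) * (norm \<nu>)\<^sup>2) / q"
    proof (rule divide_right_mono)
      have "(\<alpha> * \<rho> + \<kappa> / p) * norm \<nu> \<le> (\<alpha> / 4) * (norm \<nu>)\<^sup>2 + e"
        unfolding e_def using \<alpha> by (intro linear_le_quadratic) simp
      then show "exp ((\<alpha> * \<rho> + \<kappa> / p) * norm \<nu> - (\<alpha> / 2) * (norm \<nu>)\<^sup>2) \<le> exp (e - (\<alpha> / 4) * (norm \<nu>)\<^sup>2)"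
        by simp
    qed (use q in simp)
    also have "\<dots> = M \<nu>"
      by (simp add: M_def mult_exp_exp)
    finally show ?thesis .
  qed
  moreover have "M summable_on lattice_pts r"
    unfolding M_def using summable_on_lattice_gaussian[of "\<alpha> / 4" r 0] \<alpha> assms
    by (intro summable_on_cmult_right) auto
  moreover have "0 \<le> M \<nu>" for \<nu> using q by (simp add: M_def)
  ultimately show ?thesis by blast
qed

section \<open>The operator from coefficients to kernel series\<close>

definition synthesis :: "real \<Rightarrow> (complex \<Rightarrow> complex) \<Rightarrow> complex \<Rightarrow> complex"
  where "synthesis r c z = (\<Sum>\<^sub>\<infinity>\<nu>\<in>lattice_pts r. c \<nu> * (fock_kernel \<alpha> \<nu> z / of_real (kernel_norm \<nu>)))"

lemma abs_summable_synthesis: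
  assumes "r > 0" "\<And>\<nu>. \<nu> \<in> lattice_pts r \<Longrightarrow> norm (c \<nu>) \<le> b"
  shows "(\<lambda>\<nu>. norm (c \<nu> * (fock_kernel \<alpha> \<nu> z / of_real (kernel_norm \<nu>)))) summable_on lattice_pts r"
proof -
  obtain M where M: "\<And>\<nu>. 0 \<le> M \<nu>" "M summable_on lattice_pts r"
    "\<And>\<nu>. norm (fock_kernel \<alpha> \<nu> z / of_real (kernel_norm \<nu>)) \<le> M \<nu>"
    using kernel_quotient_majorant[OF assms(1), of "norm z"] by auto
  have "(\<lambda>\<nu>. b * M \<nu>) summable_on lattice_pts r"
    by (intro summable_on_cmult_right M)
  then show ?thesis
  proof (rule summable_on_comparison_test)
    fix \<nu> assume \<nu>: "\<nu> \<in> lattice_pts r"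
    show "norm (c \<nu> * (fock_kernel \<alpha> \<nu> z / of_real (kernel_norm \<nu>))) \<le> b * M \<nu>"
      unfolding norm_mult using assms(2)[OF \<nu>] M
      by (intro mult_mono) (auto intro: order_trans[OF norm_ge_zero])
  qed simp
qed

lemma has_sum_synthesis:
  assumes "r > 0" "\<And>\<nu>. \<nu> \<in> lattice_pts r \<Longrightarrow> norm (c \<nu>) \<le> b"
  shows "((\<lambda>\<nu>. c \<nu> * (fock_kernel \<alpha> \<nu> z / of_real (kernel_norm \<nu>))) has_sum synthesis r c z) (lattice_pts r)"
  unfolding synthesis_def
  by (rule has_sum_infsum[OF abs_summable_summable[OF abs_summable_synthesis[OF assms]]])

text \<open>At a fixed point the series is continuous in the supremum norm of the coefficients. This
  lets limits of coefficient sequences pass through the series.\<close>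

lemma synthesis_bound:
  assumes "r > 0"
  shows "\<exists>C. \<forall>c b. (\<forall>\<nu>\<in>lattice_pts r. norm (c \<nu>) \<le> b) \<longrightarrow> norm (synthesis r c z) \<le> C * b"
proof -
  obtain M where M: "\<And>\<nu>. 0 \<le> M \<nu>" "M summable_on lattice_pts r"
    "\<And>\<nu>. norm (fock_kernel \<alpha> \<nu> z / of_real (kernel_norm \<nu>)) \<le> M \<nu>"
    using kernel_quotient_majorant[OF assms(1), of "norm z"] by auto
  have "norm (synthesis r c z) \<le> infsum M (lattice_pts r) * b"
    if "\<forall>\<nu>\<in>lattice_pts r. norm (c \<nu>) \<le> b" for c b
  proof -
    have "norm (synthesis r c z) \<le> (\<Sum>\<^sub>\<infinity>\<nu>\<in>lattice_pts r. norm (c \<nu> * (fock_kernel \<alpha> \<nu> z / of_real (kernel_norm \<nu>))))"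
      unfolding synthesis_def using that
      by (intro norm_infsum_bound abs_summable_synthesis[OF assms, of c b]) auto
    also have "\<dots> \<le> (\<Sum>\<^sub>\<infinity>\<nu>\<in>lattice_pts r. M \<nu> * b)"
    proof (rule infsum_mono)
      fix \<nu> assume \<nu>: "\<nu> \<in> lattice_pts r"
      show "norm (c \<nu> * (fock_kernel \<alpha> \<nu> z / of_real (kernel_norm \<nu>))) \<le> M \<nu> * b"
        unfolding norm_mult mult.commute[of "M \<nu>"] using that \<nu> M
        by (intro mult_mono) (auto intro: order_trans[OF norm_ge_zero])
    next
      show "(\<lambda>\<nu>. norm (c \<nu> * (fock_kernel \<alpha> \<nu> z / of_real (kernel_norm \<nu>)))) summable_on lattice_pts r"
        using that by (intro abs_summable_synthesis[OF assms, of c b]) auto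
    qed (intro summable_on_cmult_left M)
    also have "\<dots> = infsum M (lattice_pts r) * b"
      using M by (intro infsum_cmult_left) auto
    finally show ?thesis .
  qed
  then show ?thesis by blast
qed

text \<open>Weierstrass M-test on every disc: finite partial sums are entire and converge uniformly
  along the finite subsets of the lattice.\<close>

lemma holomorphic_synthesis:
  assumes "r > 0" "\<And>\<nu>. \<nu> \<in> lattice_pts r \<Longrightarrow> norm (c \<nu>) \<le> b"
  shows "synthesis r c holomorphic_on UNIV"
proof -
  have "synthesis r c holomorphic_on ball 0 \<rho>" if \<rho>: "\<rho> > 0" for \<rho>
  proof -
    obtain M where M: "\<And>\<nu>. 0 \<le> M \<nu>" "M summable_on lattice_pts r"
      "\<And>z \<nu>. norm z \<le> \<rho> \<Longrightarrow> norm (fock_kernel \<alpha> \<nu> z / of_real (kernel_norm \<nu>)) \<le> M \<nu>"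
      using kernel_quotient_majorant[OF assms(1), of \<rho>] \<rho> by auto
    let ?t = "\<lambda>\<nu> z. c \<nu> * (fock_kernel \<alpha> \<nu> z / of_real (kernel_norm \<nu>))"
    have u: "uniform_limit (cball 0 \<rho>) (\<lambda>X z. \<Sum>\<nu>\<in>X. ?t \<nu> z) (\<lambda>z. \<Sum>\<^sub>\<infinity>\<nu>\<in>lattice_pts r. ?t \<nu> z)
        (finite_subsets_at_top (lattice_pts r))"
    proof (rule Weierstrass_m_test_general)
      fix \<nu> z assume "\<nu> \<in> lattice_pts r" "z \<in> cball (0 :: complex) \<rho>"
      then show "norm (?t \<nu> z) \<le> b * M \<nu>"
        unfolding norm_mult using assms(2)[of \<nu>] M
        by (intro mult_mono) (auto intro: order_trans[OF norm_ge_zero])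
    qed (intro summable_on_cmult_right M)
    have h: "(\<lambda>z. \<Sum>\<nu>\<in>X. ?t \<nu> z) holomorphic_on A" for X A
      using kernel_norm_pos
      by (intro holomorphic_intros holomorphic_on_fock_kernel) (auto simp: less_le)
    have "\<forall>\<^sub>F X in finite_subsets_at_top (lattice_pts r).
        continuous_on (cball 0 \<rho>) (\<lambda>z. \<Sum>\<nu>\<in>X. ?t \<nu> z) \<and> (\<lambda>z. \<Sum>\<nu>\<in>X. ?t \<nu> z) holomorphic_on ball 0 \<rho>"
      using h holomorphic_on_imp_continuous_on by (intro always_eventually) blast
    from holomorphic_uniform_limit[OF this u] show ?thesis
      by (auto simp: synthesis_def[abs_def])
  qed
  then have "synthesis r c holomorphic_on (\<Union>\<rho>\<in>{0<..}. ball 0 \<rho>)"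
    by (intro holomorphic_on_UN_open) auto
  moreover have "(\<Union>\<rho>\<in>{0<..}. ball 0 \<rho>) = (UNIV :: complex set)"
  proof -
    have "z \<in> ball 0 (norm z + 1)" "norm z + 1 \<in> {0<..}" for z :: complex
      by (auto intro: add_nonneg_pos)
    then show ?thesis by blast
  qed
  ultimately show ?thesis by simp
qed

text \<open>A Schur-type estimate. Pointwise the modulus is at most a lattice Gaussian convolution
  of |c| / \<open>reduced_norm\<close>; the power mean inequality and integration in
  \<open>z\<close> produce \<open>W\<close> at each lattice point, which cancels against
  \<open>reduced_norm\<close>. The bound \<open>b\<close> guarantees convergence, and
  \<open>C\<close> is independent of it.\<close>

lemma synthesis_norm_bound:
  assumes r: "r > 0"
  shows "\<exists>C>0. \<forall>c b. (\<forall>\<nu>\<in>lattice_pts r. norm (c \<nu>) \<le> b) \<longrightarrow>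
    (\<integral>\<^sup>+z. ennreal (G (synthesis r c) z powr p) \<partial>\<mu>) \<le>
    ennreal C * (\<integral>\<^sup>+\<nu>. ennreal (norm (c \<nu>) powr p) \<partial>count_space (lattice_pts r))"
proof -
  let ?L = "count_space (lattice_pts r)"
  obtain C1 where C1: "C1 > 0" and sum1:
    "\<And>z. (\<integral>\<^sup>+\<tau>. ennreal (r\<^sup>2 * exp (- (\<alpha> / 2) * (norm (z - \<tau>))\<^sup>2)) \<partial>?L) \<le> ennreal C1"
    using lattice_gaussian_sum_bound[of "\<alpha> / 2" r] \<alpha> r by auto
  obtain C2 where C2: "C2 > 0" and bd:
      "\<And>\<nu>. (\<integral>\<^sup>+z. ennreal (exp (- (\<alpha> / 2) * (norm (z - \<nu>))\<^sup>2)) \<partial>\<mu>) \<le> ennreal (C2 * W \<nu>)"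
    using gaussian_weight_bound[of "\<alpha> / 2"] \<alpha> by auto
  obtain c1 where c1: "c1 > 0" and low: "\<And>\<nu>. c1 * W \<nu> \<le> reduced_norm \<nu> powr p" and pos: "\<And>\<nu>. 0 < reduced_norm \<nu>"
    using reduced_norm_bounds by blast
  \<comment> \<open>The uniform lattice bound carries the factor r^2, which is divided out here;
    this constant may depend on \<open>r\<close>.\<close>
  define A where "A = C1 / r\<^sup>2"
  have A: "A > 0" using C1 r by (simp add: A_def)
  define k where "k = (\<lambda>z \<nu> :: complex. exp (- (\<alpha> / 2) * (norm (z - \<nu>))\<^sup>2))"
  have kA: "(\<integral>\<^sup>+\<nu>. ennreal (k z \<nu>) \<partial>?L) \<le> ennreal A" for z
  proof -
    have "(\<integral>\<^sup>+\<nu>. ennreal (k z \<nu>) \<partial>?L) =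
        (\<integral>\<^sup>+\<nu>. ennreal (1 / r\<^sup>2) * ennreal (r\<^sup>2 * exp (- (\<alpha> / 2) * (norm (z - \<nu>))\<^sup>2)) \<partial>?L)"
      using r by (intro nn_integral_cong) (simp add: k_def flip: ennreal_mult)
    also have "\<dots> = ennreal (1 / r\<^sup>2) * (\<integral>\<^sup>+\<nu>. ennreal (r\<^sup>2 * exp (- (\<alpha> / 2) * (norm (z - \<nu>))\<^sup>2)) \<partial>?L)"
      by (intro nn_integral_cmult) auto
    also have "\<dots> \<le> ennreal (1 / r\<^sup>2) * ennreal C1"
      by (intro mult_left_mono sum1) simp
    also have "\<dots> = ennreal A"
      using C1 by (simp add: A_def flip: ennreal_mult)
    finally show ?thesis .
  qed
  define C where "C = A powr (p - 1) * (C2 / c1)"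
  have "(\<integral>\<^sup>+z. ennreal (G (synthesis r c) z powr p) \<partial>\<mu>) \<le>
      ennreal C * (\<integral>\<^sup>+\<nu>. ennreal (norm (c \<nu>) powr p) \<partial>?L)"
    if bnd: "\<forall>\<nu>\<in>lattice_pts r. norm (c \<nu>) \<le> b" for c b
  proof -
    define g where "g = (\<lambda>\<nu>. norm (c \<nu>) / reduced_norm \<nu>)"
    have g0: "0 \<le> g \<nu>" for \<nu> using pos[of \<nu>] by (simp add: g_def)
    have pw: "ennreal (G (synthesis r c) z powr p) \<le>
        ennreal (A powr (p - 1)) * (\<integral>\<^sup>+\<nu>. ennreal (k z \<nu> * g \<nu> powr p) \<partial>?L)" for z
    proof (rule nn_integral_power_mean[OF p A])
      let ?t = "\<lambda>\<nu>. c \<nu> * (fock_kernel \<alpha> \<nu> z / of_real (kernel_norm \<nu>))"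
      let ?e = "exp (- (\<alpha> / 2) * (norm z)\<^sup>2)"
      have sm: "(\<lambda>\<nu>. norm (?t \<nu>)) summable_on lattice_pts r"
        using abs_summable_synthesis[OF r] bnd by blast
      have eq: "norm (?t \<nu>) * ?e = k z \<nu> * g \<nu>" for \<nu>
      proof -
        have "norm (?t \<nu>) * ?e = norm (c \<nu>) * G (fock_kernel \<alpha> \<nu>) z / kernel_norm \<nu>"
          using kernel_norm_pos[of \<nu>] by (simp add: norm_mult norm_divide gauss_modulus_def)
        also have "\<dots> = norm (c \<nu>) * G (fock_kernel \<alpha> \<nu>) z / (reduced_norm \<nu> * exp (\<alpha> / 2 * (norm \<nu>)\<^sup>2))"
          by (simp add: reduced_norm_def mult.assoc mult_exp_exp)
        finally show ?thesis
          using pos[of \<nu>] by (simp add: gauss_modulus_kernel k_def g_def)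
      qed
      have "norm (synthesis r c z) \<le> (\<Sum>\<^sub>\<infinity>\<nu>\<in>lattice_pts r. norm (?t \<nu>))"
        unfolding synthesis_def by (rule norm_infsum_bound[OF sm])
      then have "G (synthesis r c) z \<le> (\<Sum>\<^sub>\<infinity>\<nu>\<in>lattice_pts r. norm (?t \<nu>)) * ?e"
        unfolding gauss_modulus_def by (intro mult_right_mono) auto
      also have "\<dots> = (\<Sum>\<^sub>\<infinity>\<nu>\<in>lattice_pts r. norm (?t \<nu>) * ?e)"
        using sm by (intro infsum_cmult_left[symmetric]) auto
      also have "\<dots> = (\<Sum>\<^sub>\<infinity>\<nu>\<in>lattice_pts r. k z \<nu> * g \<nu>)"
        by (simp only: eq)
      also have "ennreal \<dots> = (\<integral>\<^sup>+\<nu>. ennreal (k z \<nu> * g \<nu>) \<partial>?L)"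
      proof (rule infsum_eq_nn_integral)
        show "(\<lambda>\<nu>. k z \<nu> * g \<nu>) summable_on lattice_pts r"
          unfolding eq[symmetric] by (intro summable_on_cmult_left sm)
      qed (use g0 in \<open>simp add: k_def\<close>)
      finally show "ennreal (G (synthesis r c) z) \<le> (\<integral>\<^sup>+\<nu>. ennreal (k z \<nu> * g \<nu>) \<partial>?L)"
        by (simp add: ennreal_leI)
    qed (use g0 kA in \<open>auto simp: k_def\<close>)
    have km: "(\<lambda>z. k z \<nu> * t) \<in> borel_measurable \<mu>" for \<nu> t
      unfolding k_def by (intro borel_measurable_\<mu> borel_measurable_continuous_onI continuous_intros)
    have "(\<integral>\<^sup>+z. ennreal (G (synthesis r c) z powr p) \<partial>\<mu>) \<le>
        (\<integral>\<^sup>+z. ennreal (A powr (p - 1)) * (\<integral>\<^sup>+\<nu>. ennreal (k z \<nu> * g \<nu> powr p) \<partial>?L) \<partial>\<mu>)"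
      by (intro nn_integral_mono pw)
    also have "\<dots> = (\<integral>\<^sup>+z. (\<integral>\<^sup>+\<nu>. ennreal (A powr (p - 1)) * ennreal (k z \<nu> * g \<nu> powr p) \<partial>?L) \<partial>\<mu>)"
      by (intro nn_integral_cong nn_integral_cmult[symmetric]) auto
    also have "\<dots> = (\<integral>\<^sup>+\<nu>. (\<integral>\<^sup>+z. ennreal (A powr (p - 1)) * ennreal (k z \<nu> * g \<nu> powr p) \<partial>\<mu>) \<partial>?L)"
      using km by (intro nn_integral_count_space_nn_integral countable_lattice_pts) simp
    also have "\<dots> \<le> (\<integral>\<^sup>+\<nu>. ennreal C * ennreal (norm (c \<nu>) powr p) \<partial>?L)"
    proof (intro nn_integral_mono)
      fix \<nu>
      have km1: "(\<lambda>z. k z \<nu>) \<in> borel_measurable \<mu>" using km[of \<nu> 1] by simp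
      have "(\<integral>\<^sup>+z. ennreal (A powr (p - 1)) * ennreal (k z \<nu> * g \<nu> powr p) \<partial>\<mu>) =
          (\<integral>\<^sup>+z. ennreal (A powr (p - 1) * g \<nu> powr p) * ennreal (k z \<nu>) \<partial>\<mu>)"
        by (intro nn_integral_cong) (simp add: k_def mult_ac flip: ennreal_mult)
      also have "\<dots> = ennreal (A powr (p - 1) * g \<nu> powr p) * (\<integral>\<^sup>+z. ennreal (k z \<nu>) \<partial>\<mu>)"
        using km1 by (intro nn_integral_cmult) simp
      also have "\<dots> \<le> ennreal (A powr (p - 1) * g \<nu> powr p) * ennreal (C2 * W \<nu>)"
        unfolding k_def by (intro mult_left_mono bd) simp
      also have "\<dots> = ennreal (A powr (p - 1) * (g \<nu> powr p * (C2 * W \<nu>)))"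
        using C2 by (simp add: mult.assoc flip: ennreal_mult)
      also have "\<dots> \<le> ennreal (A powr (p - 1) * (norm (c \<nu>) powr p * (C2 / c1)))"
      proof (intro ennreal_leI mult_left_mono)
        have "g \<nu> powr p * (C2 * W \<nu>) = norm (c \<nu>) powr p * (C2 * (W \<nu> / reduced_norm \<nu> powr p))"
          using pos[of \<nu>] by (simp add: g_def powr_divide)
        also have "\<dots> \<le> norm (c \<nu>) powr p * (C2 * (1 / c1))"
          using low[of \<nu>] c1 C2 pos[of \<nu>] by (intro mult_left_mono) (auto simp: field_simps)
        finally show "g \<nu> powr p * (C2 * W \<nu>) \<le> norm (c \<nu>) powr p * (C2 / c1)" by simp
      qed simp
      also have "\<dots> = ennreal C * ennreal (norm (c \<nu>) powr p)"
        using C2 c1 by (simp add: C_def mult_ac flip: ennreal_mult)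
      finally show "(\<integral>\<^sup>+z. ennreal (A powr (p - 1)) * ennreal (k z \<nu> * g \<nu> powr p) \<partial>\<mu>) \<le>
          ennreal C * ennreal (norm (c \<nu>) powr p)" .
    qed
    also have "\<dots> = ennreal C * (\<integral>\<^sup>+\<nu>. ennreal (norm (c \<nu>) powr p) \<partial>?L)"
      by (intro nn_integral_cmult) auto
    finally show ?thesis .
  qed
  moreover have "C > 0" using A C2 c1 by (simp add: C_def)
  ultimately show ?thesis by blast
qed

end

subsection \<open>Discretizing the reproducing formula\<close>

lemma lborel_integral_translate:
  fixes f :: "'a :: euclidean_space \<Rightarrow> 'b :: {banach, second_countable_topology}"
  assumes [measurable]: "f \<in> borel_measurable borel"
  shows "(\<integral>x. f (c + x) \<partial>lborel) = (\<integral>x. f x \<partial>lborel)"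
    and "integrable lborel (\<lambda>x. f (c + x)) \<longleftrightarrow> integrable lborel f"
proof -
  show "(\<integral>x. f (c + x) \<partial>lborel) = (\<integral>x. f x \<partial>lborel)"
    by (subst lborel_distr_plus[of c, symmetric], subst integral_distr) auto
  show "integrable lborel (\<lambda>x. f (c + x)) \<longleftrightarrow> integrable lborel f"
    by (subst (2) lborel_distr_plus[of c, symmetric], subst integrable_distr_eq) auto
qed

lemma borel_measurable_gaussian [measurable]:
  "(\<lambda>u :: complex. exp (- \<beta> * (norm (z - u))\<^sup>2)) \<in> borel_measurable borel"
  by (intro borel_measurable_continuous_onI continuous_intros)

lemma integrable_gaussian:
  assumes "\<beta> > 0"
  shows "integrable lborel (\<lambda>u :: complex. exp (- \<beta> * (norm (z - u))\<^sup>2))"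
proof -
  have "integrable lborel (\<lambda>u :: complex. exp (- \<beta> * (norm (0 - u))\<^sup>2))"
    using nn_integral_gaussian_finite[OF assms] borel_measurable_gaussian[of \<beta> 0]
    by (simp add: integrable_iff_bounded)
  then have "integrable lborel (\<lambda>u :: complex. exp (- \<beta> * (norm (0 - (- z + u)))\<^sup>2))"
    by (subst lborel_integral_translate(2)) auto
  then show ?thesis by simp
qed

section \<open>Oscillation of the reproducing integrand over a lattice cell\<close>

lemma norm_exp_diff_one:
  fixes \<xi> :: complex
  shows "norm (exp \<xi> - 1) \<le> norm \<xi> * exp (norm \<xi>)"
proof -
  have "norm (exp \<xi> - exp 0) \<le> exp (norm \<xi>) * norm (\<xi> - 0)"
  proof (rule field_differentiable_bound[of "cball 0 (norm \<xi>)" exp exp])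
    fix x :: complex assume "x \<in> cball 0 (norm \<xi>)"
    then show "norm (exp x) \<le> exp (norm \<xi>)"
      using complex_Re_le_cmod[of x] by (simp add: norm_exp_eq_Re)
  qed (auto intro: DERIV_exp has_field_derivative_at_within)
  then show ?thesis by (simp add: mult.commute)
qed

text \<open>Cauchy's estimate on unit circles around points of the unit disc bounds the derivative
  there; these circles stay in the disc of radius 2, hence the radius in the hypothesis.\<close>

lemma entire_lipschitz_at_0:
  assumes F: "F holomorphic_on UNIV" and K: "\<And>\<zeta>. norm \<zeta> \<le> 2 \<Longrightarrow> norm (F \<zeta>) \<le> K"
    and \<zeta>: "norm \<zeta> \<le> 1"
  shows "norm (F \<zeta> - F 0) \<le> K * norm \<zeta>"
proof -
  have "norm (F \<zeta> - F 0) \<le> K * norm (\<zeta> - 0)"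
  proof (rule field_differentiable_bound[of "cball 0 1" F "deriv F"])
    fix x :: complex assume x: "x \<in> cball 0 1"
    show "(F has_field_derivative deriv F x) (at x within cball 0 1)"
      using F by (meson UNIV_I has_field_derivative_at_within holomorphic_derivI open_UNIV)
    have "norm ((deriv ^^ 1) F x) \<le> fact 1 * K / 1 ^ 1"
    proof (rule Cauchy_inequality)
      show "F holomorphic_on ball x 1" "continuous_on (cball x 1) F"
        using F holomorphic_on_subset holomorphic_on_imp_continuous_on by blast+
      fix y assume "norm (x - y) = 1"
      then have "norm y \<le> 2"
        using x norm_triangle_ineq4[of x "x - y"] by auto
      then show "norm (F y) \<le> K" by (rule K)
    qed simp
    then show "norm (deriv F x) \<le> K" by simp
  qed (use \<zeta> in auto)
  then show ?thesis by simp
qed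

text \<open>This is f(u) K_u(z) exp(-alpha |u|^2), with a single exponential in \<open>u\<close> and
  \<open>cnj u\<close> so that translating \<open>u\<close> is algebra in the exponent.\<close>

definition fock_reproducing_integrand :: "real \<Rightarrow> (complex \<Rightarrow> complex) \<Rightarrow> complex \<Rightarrow> complex \<Rightarrow> complex"
  where "fock_reproducing_integrand \<alpha> f z u = f u * exp (of_real \<alpha> * (z * cnj u - u * cnj u))"

lemma norm_fock_reproducing_integrand:
  "norm (fock_reproducing_integrand \<alpha> f z u) =
    exp (\<alpha> / 2 * (norm z)\<^sup>2) * (gauss_modulus \<alpha> f u * exp (- (\<alpha> / 2) * (norm (z - u))\<^sup>2))"
proof -
  define R where "R = Re (z * cnj u)"
  have h: "(norm (z - u))\<^sup>2 = (norm u)\<^sup>2 - 2 * R + (norm z)\<^sup>2"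
    using norm_add_square_complex[of "- u" z] by (simp add: R_def algebra_simps)
  have "Re (u * cnj u) = (norm u)\<^sup>2"
    by (metis complex_norm_square Re_complex_of_real)
  then have "norm (exp (of_real \<alpha> * (z * cnj u - u * cnj u))) = exp (\<alpha> * (R - (norm u)\<^sup>2))"
    by (simp only: norm_exp_eq_Re R_def minus_complex.sel Re_complex_of_real times_complex.sel(1) Im_complex_of_real) simp
  then show ?thesis
    unfolding fock_reproducing_integrand_def norm_mult gauss_modulus_def h
    by (simp add: mult_exp_exp algebra_simps)
qed

text \<open>The variation in \<zeta> is isolated: a prefactor free of \<zeta>, an entire function of
  \<zeta>, and a non-holomorphic exponential equal to 1 at \<zeta> = 0. Each varying factor is then
  estimated on its own.\<close>

lemma fock_reproducing_integrand_translate: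
  "fock_reproducing_integrand \<alpha> f z (\<nu> + \<zeta>) =
    exp (of_real \<alpha> * (z * cnj \<nu> - \<nu> * cnj \<nu> / 2)) *
    (f (\<nu> + \<zeta>) * exp (- of_real \<alpha> * cnj \<nu> * \<zeta>) * exp (- of_real \<alpha> * (\<nu> * cnj \<nu> / 2)) *
     exp (of_real \<alpha> * ((z - \<nu>) * cnj \<zeta> - \<zeta> * cnj \<zeta>)))"
  unfolding fock_reproducing_integrand_def
  by (simp add: exp_add[symmetric] algebra_simps)

text \<open>The factor \<open>d\<close> is the gain behind the contraction: the entire factor is
  Lipschitz by Cauchy's estimate, the exponential by the mean value inequality, and the losses in |z
  - \<nu>| are absorbed by half of the Gaussian. The bound is relative to the local supremum
  \<open>K\<close>, since the modulus of \<open>f\<close> may be unbounded globally.\<close>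

lemma fock_reproducing_integrand_lipschitz:
  assumes \<alpha>: "0 < \<alpha>" and f: "f holomorphic_on UNIV"
    and K: "\<And>\<zeta>. norm \<zeta> \<le> 2 \<Longrightarrow> gauss_modulus \<alpha> f (\<nu> + \<zeta>) \<le> K"
    and \<zeta>: "norm \<zeta> \<le> d" and d: "d \<le> 1"
  shows "norm (fock_reproducing_integrand \<alpha> f z (\<nu> + \<zeta>) - fock_reproducing_integrand \<alpha> f z \<nu>) \<le>
    exp (\<alpha> / 2 * (norm z)\<^sup>2) * (d * K * exp (8 * \<alpha>) * exp (- (\<alpha> / 4) * (norm (z - \<nu>))\<^sup>2))"
proof -
  define F where "F = (\<lambda>\<zeta>. f (\<nu> + \<zeta>) * exp (- of_real \<alpha> * cnj \<nu> * \<zeta>) * exp (- of_real \<alpha> * (\<nu> * cnj \<nu> / 2)))"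
  define \<xi> where "\<xi> = of_real \<alpha> * ((z - \<nu>) * cnj \<zeta> - \<zeta> * cnj \<zeta>)"
  define P where "P = exp (of_real \<alpha> * (z * cnj \<nu> - \<nu> * cnj \<nu> / 2))"
  have d0: "0 \<le> d" using \<zeta> norm_ge_zero order_trans by blast
  have K0: "0 \<le> K" using K[of 0] by (simp add: order_trans[OF gauss_modulus_nonneg])
  have "(\<lambda>\<zeta>. f (\<nu> + \<zeta>)) holomorphic_on UNIV"
    by (rule holomorphic_on_compose_gen[of _ _ f, unfolded o_def, OF _ f])
       (auto intro!: holomorphic_intros)
  then have F: "F holomorphic_on UNIV"
    unfolding F_def by (intro holomorphic_intros)
  have sq: "Re (\<nu> * cnj \<nu>) = (norm \<nu>)\<^sup>2"
    by (metis complex_norm_square Re_complex_of_real)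
  have FK: "norm (F \<zeta>') \<le> K * exp (2 * \<alpha>)" if "norm \<zeta>' \<le> 2" for \<zeta>'
  proof -
    have "norm (exp (- of_real \<alpha> * (\<nu> * cnj \<nu> / 2))) = exp (- (\<alpha> / 2) * (norm \<nu>)\<^sup>2)"
      using sq by (simp add: norm_exp_eq_Re)
    then have "norm (F \<zeta>') = gauss_modulus \<alpha> f (\<nu> + \<zeta>') * exp (\<alpha> / 2 * ((norm \<nu>)\<^sup>2 + (norm \<zeta>')\<^sup>2)) *
        exp (- (\<alpha> / 2) * (norm \<nu>)\<^sup>2)"
      unfolding F_def norm_mult[of _ "exp (- of_real \<alpha> * (\<nu> * cnj \<nu> / 2))"] gauss_modulus_translate by simp
    also have "\<dots> = gauss_modulus \<alpha> f (\<nu> + \<zeta>') * exp (\<alpha> / 2 * (norm \<zeta>')\<^sup>2)"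
      by (simp add: mult.assoc mult_exp_exp algebra_simps)
    also have "\<dots> \<le> K * exp (2 * \<alpha>)"
    proof (intro mult_mono K[OF that] K0)
      have "(norm \<zeta>')\<^sup>2 \<le> 2\<^sup>2" using that by (intro power_mono) auto
      then show "exp (\<alpha> / 2 * (norm \<zeta>')\<^sup>2) \<le> exp (2 * \<alpha>)"
        using \<alpha> by (simp add: field_simps)
    qed auto
    finally show ?thesis .
  qed
  define x where "x = norm (z - \<nu>)"
  \<comment> \<open>Chosen so that |\<xi>| <= d y; the two error terms then share the factor (1 + y)
    exp y, which is at most exp (2 y).\<close>
  define y where "y = \<alpha> * (x + 1)"
  have x0: "x \<ge> 0" and y0: "y \<ge> 0" using \<alpha> by (auto simp: x_def y_def)
  have "norm \<xi> \<le> \<alpha> * (norm ((z - \<nu>) * cnj \<zeta>) + norm (\<zeta> * cnj \<zeta>))"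
    unfolding \<xi>_def norm_mult[of "of_real \<alpha>"] using \<alpha> norm_triangle_ineq4 by simp
  also have "\<dots> = \<alpha> * ((x + norm \<zeta>) * norm \<zeta>)"
    by (simp add: norm_mult x_def distrib_left distrib_right mult_ac)
  also have "\<dots> \<le> \<alpha> * ((x + 1) * d)"
    using \<alpha> x0 \<zeta> d by (intro mult_left_mono mult_mono) auto
  finally have \<xi>: "norm \<xi> \<le> d * y" by (simp add: y_def mult_ac)
  also have "d * y \<le> 1 * y" using d y0 by (intro mult_right_mono)
  finally have \<xi>y: "exp (norm \<xi>) \<le> exp y" by simp
  have "norm (F \<zeta> * exp \<xi> - F 0) = norm ((F \<zeta> - F 0) * exp \<xi> + F 0 * (exp \<xi> - 1))"
    by (simp add: algebra_simps)
  also have "\<dots> \<le> norm (F \<zeta> - F 0) * norm (exp \<xi>) + norm (F 0) * norm (exp \<xi> - 1)"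
    by (metis norm_mult norm_triangle_ineq)
  also have "\<dots> \<le> (K * exp (2 * \<alpha>) * d) * exp y + K * exp (2 * \<alpha>) * (d * y * exp y)"
  proof (intro add_mono mult_mono)
    have "norm (F \<zeta> - F 0) \<le> K * exp (2 * \<alpha>) * norm \<zeta>"
      using \<zeta> d by (intro entire_lipschitz_at_0[OF F FK]) auto
    also have "\<dots> \<le> K * exp (2 * \<alpha>) * d"
      using K0 \<zeta> by (intro mult_left_mono) auto
    finally show "norm (F \<zeta> - F 0) \<le> K * exp (2 * \<alpha>) * d" .
    show "norm (exp \<xi>) \<le> exp y"
      using \<xi>y complex_Re_le_cmod[of \<xi>] by (simp add: norm_exp_eq_Re)
    show "norm (F 0) \<le> K * exp (2 * \<alpha>)" using FK[of 0] by simp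
    have "norm (exp \<xi> - 1) \<le> norm \<xi> * exp (norm \<xi>)" by (rule norm_exp_diff_one)
    also have "\<dots> \<le> d * y * exp y"
      using \<xi> \<xi>y d0 y0 by (intro mult_mono) auto
    finally show "norm (exp \<xi> - 1) \<le> d * y * exp y" .
  qed (use K0 d0 in auto)
  also have "\<dots> = K * d * exp (2 * \<alpha>) * ((1 + y) * exp y)"
    by (simp add: algebra_simps)
  also have "\<dots> \<le> K * d * exp (2 * \<alpha>) * (exp y * exp y)"
    using K0 d0 exp_ge_add_one_self[of y] by (intro mult_left_mono mult_right_mono) auto
  finally have main: "norm (F \<zeta> * exp \<xi> - F 0) \<le> K * d * exp (2 * \<alpha>) * (exp y * exp y)" .
  have normP: "norm P = exp (\<alpha> / 2 * (norm z)\<^sup>2) * exp (- (\<alpha> / 2) * x\<^sup>2)"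
  proof -
    define R where "R = Re (z * cnj \<nu>)"
    have h: "x\<^sup>2 = (norm \<nu>)\<^sup>2 - 2 * R + (norm z)\<^sup>2"
      using norm_add_square_complex[of "- \<nu>" z] by (simp add: x_def R_def algebra_simps)
    have "norm P = exp (\<alpha> * (R - (norm \<nu>)\<^sup>2 / 2))"
      using sq unfolding P_def by (simp add: norm_exp_eq_Re R_def)
    then show ?thesis
      unfolding h by (simp add: mult_exp_exp algebra_simps)
  qed
  have "norm (fock_reproducing_integrand \<alpha> f z (\<nu> + \<zeta>) - fock_reproducing_integrand \<alpha> f z \<nu>) =
      norm (P * (F \<zeta> * exp \<xi> - F 0))"
    using fock_reproducing_integrand_translate[of \<alpha> f z \<nu> \<zeta>] fock_reproducing_integrand_translate[of \<alpha> f z \<nu> 0]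
    by (simp add: F_def P_def \<xi>_def right_diff_distrib)
  also have "\<dots> \<le> exp (\<alpha> / 2 * (norm z)\<^sup>2) * exp (- (\<alpha> / 2) * x\<^sup>2) * (K * d * exp (2 * \<alpha>) * (exp y * exp y))"
    unfolding norm_mult normP by (intro mult_left_mono main) auto
  also have "\<dots> = exp (\<alpha> / 2 * (norm z)\<^sup>2) * (d * K * (exp (2 * \<alpha>) * exp (- (\<alpha> / 2) * x\<^sup>2) * (exp y * exp y)))"
    by (simp only: mult_ac)
  also have "\<dots> \<le> exp (\<alpha> / 2 * (norm z)\<^sup>2) * (d * K * (exp (8 * \<alpha>) * exp (- (\<alpha> / 4) * x\<^sup>2)))"
  proof (intro mult_left_mono)
    \<comment> \<open>Absorbing 2 alpha x costs 4 alpha; with 2 alpha left over from exp (2 y) and 2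
      alpha from the bound on \<open>F\<close>, this makes 8 alpha.\<close>
    have "(2 * \<alpha>) * x \<le> \<alpha> / 4 * x\<^sup>2 + (2 * \<alpha>)\<^sup>2 / (4 * (\<alpha> / 4))"
      using \<alpha> by (intro linear_le_quadratic) simp
    also have "(2 * \<alpha>)\<^sup>2 / (4 * (\<alpha> / 4)) = 4 * \<alpha>"
      using \<alpha> by (simp add: power2_eq_square)
    finally show "exp (2 * \<alpha>) * exp (- (\<alpha> / 2) * x\<^sup>2) * (exp y * exp y) \<le> exp (8 * \<alpha>) * exp (- (\<alpha> / 4) * x\<^sup>2)"
      by (simp add: mult_exp_exp y_def algebra_simps)
  qed (use K0 d0 in auto)
  finally show ?thesis by (simp add: x_def mult.assoc)
qed

text \<open>Equal to pi / alpha, the normalising constant of the reproducing formula;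
  \<open>0 - u\<close> matches the form of \<open>integrable_gaussian\<close>.\<close>

definition gaussian_mass :: "real \<Rightarrow> real"
  where "gaussian_mass \<alpha> = (\<integral>u. exp (- \<alpha> * (norm (0 - u :: complex))\<^sup>2) \<partial>lborel)"

lemma gaussian_mass_pos:
  assumes "\<alpha> > 0"
  shows "gaussian_mass \<alpha> > 0"
proof -
  have "gaussian_mass \<alpha> \<noteq> 0"
    unfolding gaussian_mass_def
    by (subst integral_nonneg_eq_0_iff_AE[OF integrable_gaussian[OF assms]])
       (auto simp: trivial_limit_def[symmetric] ae_filter_eq_bot_iff)
  moreover have "gaussian_mass \<alpha> \<ge> 0"
    by (simp add: gaussian_mass_def)
  ultimately show ?thesis by simp
qed

text \<open>Centred at \<open>z\<close>, the integrand is an entire function with value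
  \<open>f z\<close> at the origin times a radial Gaussian, so \<open>radial_mean_value\<close>
  applies. For the weighted space, integrability is supplied by pointwise growth.\<close>

lemma fock_reproducing_formula:
  assumes f: "f holomorphic_on UNIV" and int: "integrable lborel (fock_reproducing_integrand \<alpha> f z)"
  shows "(\<integral>u. fock_reproducing_integrand \<alpha> f z u \<partial>lborel) = f z * of_real (gaussian_mass \<alpha>)"
proof -
  note [measurable] = borel_measurable_entire[OF f]
  define g where "g = (\<lambda>\<zeta>. f (z + \<zeta>) * exp (- of_real \<alpha> * cnj z * \<zeta>))"
  have "(\<lambda>\<zeta>. f (z + \<zeta>)) holomorphic_on UNIV"
    by (rule holomorphic_on_compose_gen[of _ _ f, unfolded o_def, OF _ f])
       (auto intro!: holomorphic_intros)
  then have g: "g holomorphic_on UNIV"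
    unfolding g_def by (intro holomorphic_intros)
  have [measurable]: "fock_reproducing_integrand \<alpha> f z \<in> borel_measurable borel"
    using int by (simp add: borel_measurable_integrable)
  define \<phi> where "\<phi> = (\<lambda>u :: complex. exp (- \<alpha> * (norm u)\<^sup>2))"
  have \<phi>m: "\<phi> \<in> borel_measurable borel"
    unfolding \<phi>_def by (intro borel_measurable_continuous_onI continuous_intros)
  have eq: "fock_reproducing_integrand \<alpha> f z (z + \<zeta>) = g \<zeta> * of_real (\<phi> \<zeta>)" for \<zeta>
  proof -
    have "of_real (\<phi> \<zeta>) = exp (- of_real \<alpha> * (\<zeta> * cnj \<zeta>))"
    proof -
      have "- of_real \<alpha> * (\<zeta> * cnj \<zeta>) = of_real (- \<alpha> * (norm \<zeta>)\<^sup>2)"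
        by (simp only: of_real_mult of_real_minus complex_norm_square)
      then show ?thesis
        by (simp only: \<phi>_def exp_of_real)
    qed
    then show ?thesis
      unfolding fock_reproducing_integrand_def g_def
      by (simp add: exp_add[symmetric] algebra_simps)
  qed
  have "(\<integral>u. fock_reproducing_integrand \<alpha> f z u \<partial>lborel) = (\<integral>\<zeta>. g \<zeta> * of_real (\<phi> \<zeta>) \<partial>lborel)"
    by (subst lborel_integral_translate(1)[of _ z, symmetric]) (auto simp: eq)
  also have "\<dots> = g 0 * of_real (\<integral>u. \<phi> u \<partial>lborel)"
  proof (rule radial_mean_value[OF g _ \<phi>m])
    show "integrable lborel (\<lambda>\<zeta>. g \<zeta> * of_real (\<phi> \<zeta>))"
      using int lborel_integral_translate(2)[of "fock_reproducing_integrand \<alpha> f z" z] by (simp add: eq)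
  qed (auto simp: \<phi>_def norm_mult)
  finally show ?thesis by (simp add: g_def \<phi>_def gaussian_mass_def)
qed

section \<open>The discretised reproducing operator on the weighted space\<close>

context ap_weight
begin

text \<open>\<open>local_sup_bound\<close> at radius 0, combined with the at most exponential decay
  of \<open>W\<close> away from the origin. The bound is linear in \<open>A\<close>, so decay of
  norms yields decay of values.\<close>

lemma pointwise_growth:
  "\<exists>C>0. \<exists>\<kappa>\<ge>0. \<forall>f A z. f holomorphic_on UNIV \<longrightarrow> 0 \<le> A \<longrightarrow>
    (\<integral>\<^sup>+z. ennreal (G f z powr p) \<partial>\<mu>) \<le> ennreal A \<longrightarrow> G f z powr p \<le> C * A * exp (\<kappa> * norm z)"
proof -
  obtain D \<kappa> where D: "D > 0" "\<kappa> \<ge> 0" and grow: "\<And>a b. W a \<le> D * exp (\<kappa> * norm (a - b)) * W b"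
    using W_exponential_growth by blast
  obtain C1 where C1: "C1 > 0" and loc: "\<And>f \<nu> \<zeta>. f holomorphic_on UNIV \<Longrightarrow> norm \<zeta> \<le> 0 \<Longrightarrow>
    ennreal (W \<nu> * G f (\<nu> + \<zeta>) powr p) \<le>
    ennreal C1 * (\<integral>\<^sup>+z. ennreal (G f z powr p) * indicator (ball \<nu> (0 + 2 * s)) z \<partial>\<mu>)"
    using local_sup_bound[of 0] by blast
  define C where "C = C1 * D / W 0"
  have W0: "W 0 > 0" by (rule pos_square)
  have "G f z powr p \<le> C * A * exp (\<kappa> * norm z)"
    if f: "f holomorphic_on UNIV" and A: "0 \<le> A" "(\<integral>\<^sup>+z. ennreal (G f z powr p) \<partial>\<mu>) \<le> ennreal A" for f A z
  proof -
    have "ennreal (W z * G f z powr p) \<le>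
        ennreal C1 * (\<integral>\<^sup>+u. ennreal (G f u powr p) * indicator (ball z (0 + 2 * s)) u \<partial>\<mu>)"
      using loc[OF f, of 0 z] by simp
    also have "\<dots> \<le> ennreal C1 * (\<integral>\<^sup>+u. ennreal (G f u powr p) \<partial>\<mu>)"
      by (intro mult_left_mono nn_integral_mono) (auto split: split_indicator)
    also have "\<dots> \<le> ennreal C1 * ennreal A"
      by (intro mult_left_mono A) simp
    finally have "W z * G f z powr p \<le> C1 * A"
      using A C1 by (simp add: ennreal_le_iff flip: ennreal_mult)
    moreover have "W 0 / (D * exp (\<kappa> * norm z)) \<le> W z"
      using grow[of 0 z] D by (simp add: field_simps)
    ultimately have "W 0 / (D * exp (\<kappa> * norm z)) * G f z powr p \<le> C1 * A"
      by (meson mult_right_mono order_trans powr_ge_zero)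
    then show ?thesis
      using D W0 by (simp add: C_def field_simps)
  qed
  moreover have "C > 0" using C1 D W0 by (simp add: C_def)
  ultimately show ?thesis using D by blast
qed

text \<open>The exponential growth of the modulus of \<open>f\<close> is absorbed by half of the
  Gaussian in z - u. \<open>Q\<close> may depend on \<open>f\<close> and \<open>z\<close>, as the
  aim is integrability for each of them.\<close>

lemma reproducing_integrand_bound:
  assumes f: "f \<in> fock_space p \<alpha> w"
  shows "\<exists>Q\<ge>0. \<forall>u. norm (fock_reproducing_integrand \<alpha> f z u) \<le> Q * exp (- (\<alpha> / 4) * (norm (z - u))\<^sup>2)"
proof -
  have hol: "f holomorphic_on UNIV" and fin: "(\<integral>\<^sup>+z. ennreal (G f z powr p) \<partial>\<mu>) < \<infinity>"
    using f by (auto simp: fock_space_iff)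
  obtain A where A: "0 \<le> A" "(\<integral>\<^sup>+z. ennreal (G f z powr p) \<partial>\<mu>) = ennreal A"
    using fin by (cases "\<integral>\<^sup>+z. ennreal (G f z powr p) \<partial>\<mu>") auto
  obtain C \<kappa> where C: "C > 0" "\<kappa> \<ge> 0" and "\<forall>f A z. f holomorphic_on UNIV \<longrightarrow> 0 \<le> A \<longrightarrow>
    (\<integral>\<^sup>+z. ennreal (G f z powr p) \<partial>\<mu>) \<le> ennreal A \<longrightarrow> G f z powr p \<le> C * A * exp (\<kappa> * norm z)"
    using pointwise_growth by blast
  then have gr: "G f u powr p \<le> C * A * exp (\<kappa> * norm u)" for u
    using hol A by auto
  define \<kappa>' where "\<kappa>' = \<kappa> / p"
  have \<kappa>': "\<kappa>' \<ge> 0" using C p by (simp add: \<kappa>'_def)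
  define e where "e = \<kappa>'\<^sup>2 / (4 * (\<alpha> / 4))"
  define Q where "Q = exp (\<alpha> / 2 * (norm z)\<^sup>2) * ((C * A) powr (1 / p) * exp (\<kappa>' * norm z) * exp e)"
  have "norm (fock_reproducing_integrand \<alpha> f z u) \<le> Q * exp (- (\<alpha> / 4) * (norm (z - u))\<^sup>2)" for u
  proof -
    define t where "t = norm (z - u)"
    have "G f u = (G f u powr p) powr (1 / p)"
      using p by (simp add: powr_powr)
    also have "\<dots> \<le> (C * A * exp (\<kappa> * norm u)) powr (1 / p)"
      using p by (intro powr_mono2 gr) auto
    also have "\<dots> = (C * A) powr (1 / p) * exp (\<kappa>' * norm u)"
      by (simp add: powr_mult exp_powr_real \<kappa>'_def)
    also have "\<dots> \<le> (C * A) powr (1 / p) * exp (\<kappa>' * norm z + \<kappa>' * t)"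
    proof (intro mult_left_mono)
      have "norm u \<le> norm z + t"
        using norm_triangle_ineq4[of z "z - u"] by (simp add: t_def)
      from mult_left_mono[OF this \<kappa>'] show "exp (\<kappa>' * norm u) \<le> exp (\<kappa>' * norm z + \<kappa>' * t)"
        by (simp add: algebra_simps)
    qed simp
    finally have 1: "G f u \<le> (C * A) powr (1 / p) * exp (\<kappa>' * norm z + \<kappa>' * t)" .
    have "\<kappa>' * t \<le> \<alpha> / 4 * t\<^sup>2 + e"
      unfolding e_def using \<alpha> by (intro linear_le_quadratic) simp
    then have 2: "exp (\<kappa>' * norm z + \<kappa>' * t) * exp (- (\<alpha> / 2) * t\<^sup>2) \<le> exp (\<kappa>' * norm z) * exp e * exp (- (\<alpha> / 4) * t\<^sup>2)"
      by (simp add: mult_exp_exp)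
    have "G f u * exp (- (\<alpha> / 2) * t\<^sup>2) \<le> (C * A) powr (1 / p) * exp (\<kappa>' * norm z + \<kappa>' * t) * exp (- (\<alpha> / 2) * t\<^sup>2)"
      by (intro mult_right_mono 1) simp
    also have "\<dots> \<le> (C * A) powr (1 / p) * (exp (\<kappa>' * norm z) * exp e * exp (- (\<alpha> / 4) * t\<^sup>2))"
      unfolding mult.assoc[of "(C * A) powr (1 / p)"] by (intro mult_left_mono 2) simp
    finally have "exp (\<alpha> / 2 * (norm z)\<^sup>2) * (G f u * exp (- (\<alpha> / 2) * t\<^sup>2)) \<le>
        exp (\<alpha> / 2 * (norm z)\<^sup>2) * ((C * A) powr (1 / p) * (exp (\<kappa>' * norm z) * exp e * exp (- (\<alpha> / 4) * t\<^sup>2)))"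
      by (rule mult_left_mono) simp
    then show ?thesis
      unfolding norm_fock_reproducing_integrand by (simp only: Q_def t_def mult_ac)
  qed
  moreover have "Q \<ge> 0" by (simp add: Q_def)
  ultimately show ?thesis by blast
qed

lemma measurable_reproducing_integrand:
  assumes "f holomorphic_on UNIV"
  shows "fock_reproducing_integrand \<alpha> f z \<in> borel_measurable borel"
  unfolding fock_reproducing_integrand_def
  by (intro borel_measurable_continuous_onI continuous_intros holomorphic_on_imp_continuous_on[OF assms])

lemma integrable_reproducing_integrand:
  assumes f: "f \<in> fock_space p \<alpha> w"
  shows "integrable lborel (fock_reproducing_integrand \<alpha> f z)"
proof -
  obtain Q where Q: "Q \<ge> 0"
      "\<And>u. norm (fock_reproducing_integrand \<alpha> f z u) \<le> Q * exp (- (\<alpha> / 4) * (norm (z - u))\<^sup>2)"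
    using reproducing_integrand_bound[OF f] by blast
  have "integrable lborel (\<lambda>u. Q * exp (- (\<alpha> / 4) * (norm (z - u))\<^sup>2))"
    using \<alpha> by (intro integrable_mult_right integrable_gaussian) simp
  then show ?thesis
    by (rule Bochner_Integration.integrable_bound)
       (use Q f in \<open>auto simp: fock_space_iff abs_mult intro!: measurable_reproducing_integrand AE_I2\<close>)
qed

lemma measurable_comp_lattice_floor:
  assumes "r > 0" "\<And>\<nu>. h \<nu> \<in> space M"
  shows "(\<lambda>u. h (lattice_floor r u)) \<in> measurable lborel M"
  by (rule measurable_compose[OF measurable_lattice_floor[OF assms(1)]]) (use assms(2) in simp)

lemma integrable_reproducing_integrand_lattice:
  assumes f: "f \<in> fock_space p \<alpha> w" and r: "r > 0"
  shows "integrable lborel (\<lambda>u. fock_reproducing_integrand \<alpha> f z (lattice_floor r u))"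
proof -
  obtain Q where Q: "Q \<ge> 0"
      "\<And>u. norm (fock_reproducing_integrand \<alpha> f z u) \<le> Q * exp (- (\<alpha> / 4) * (norm (z - u))\<^sup>2)"
    using reproducing_integrand_bound[OF f] by blast
  have "integrable lborel (\<lambda>u. Q * (exp (\<alpha> / 4 * (2 * r)\<^sup>2) * exp (- (\<alpha> / 4 / 2) * (norm (z - u))\<^sup>2)))"
    using \<alpha> by (intro integrable_mult_right integrable_gaussian) simp
  then show ?thesis
  proof (rule Bochner_Integration.integrable_bound)
    show "(\<lambda>u. fock_reproducing_integrand \<alpha> f z (lattice_floor r u)) \<in> borel_measurable lborel"
      by (rule measurable_comp_lattice_floor[OF r]) simp
    show "AE u in lborel. norm (fock_reproducing_integrand \<alpha> f z (lattice_floor r u)) \<le>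
        norm (Q * (exp (\<alpha> / 4 * (2 * r)\<^sup>2) * exp (- (\<alpha> / 4 / 2) * (norm (z - u))\<^sup>2)))"
    proof (rule AE_I2)
      fix u
      have "norm (fock_reproducing_integrand \<alpha> f z (lattice_floor r u)) \<le>
          Q * exp (- (\<alpha> / 4) * (norm (z - lattice_floor r u))\<^sup>2)"
        by (rule Q)
      also have "\<dots> \<le> Q * (exp (\<alpha> / 4 * (2 * r)\<^sup>2) * exp (- (\<alpha> / 4 / 2) * (norm (z - u))\<^sup>2))"
        using \<alpha> Q by (intro mult_left_mono exp_neg_square_shift norm_diff_lattice_floor r) auto
      also have "\<dots> = norm (Q * (exp (\<alpha> / 4 * (2 * r)\<^sup>2) * exp (- (\<alpha> / 4 / 2) * (norm (z - u))\<^sup>2)))"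
        using Q by (simp add: abs_mult)
      finally show "norm (fock_reproducing_integrand \<alpha> f z (lattice_floor r u)) \<le>
          norm (Q * (exp (\<alpha> / 4 * (2 * r)\<^sup>2) * exp (- (\<alpha> / 4 / 2) * (norm (z - u))\<^sup>2)))" .
    qed
  qed
qed

text \<open>The coefficient of K_\<nu> in the Riemann sum of the normalised reproducing formula;
  \<open>kernel_norm \<nu>\<close> undoes the normalisation of the atom.\<close>

definition analysis_coeff :: "real \<Rightarrow> (complex \<Rightarrow> complex) \<Rightarrow> complex \<Rightarrow> complex"
  where "analysis_coeff r f \<nu> =
    f \<nu> * of_real (r\<^sup>2 / gaussian_mass \<alpha> * exp (- \<alpha> * (norm \<nu>)\<^sup>2) * kernel_norm \<nu>)"

lemma synthesis_analysis_coeff: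
  assumes f: "f \<in> fock_space p \<alpha> w" and r: "r > 0"
  shows "synthesis r (analysis_coeff r f) z =
    (\<integral>u. fock_reproducing_integrand \<alpha> f z (lattice_floor r u) \<partial>lborel) / of_real (gaussian_mass \<alpha>)"
proof -
  have eq: "analysis_coeff r f \<nu> * (fock_kernel \<alpha> \<nu> z / of_real (kernel_norm \<nu>)) =
      of_real (r\<^sup>2) * fock_reproducing_integrand \<alpha> f z \<nu> * (1 / of_real (gaussian_mass \<alpha>))" for \<nu>
  proof -
    have "complex_of_real (- \<alpha> * (norm \<nu>)\<^sup>2) = - of_real \<alpha> * (\<nu> * cnj \<nu>)"
      by (simp only: of_real_mult of_real_minus complex_norm_square)
    then have "complex_of_real (exp (- \<alpha> * (norm \<nu>)\<^sup>2)) = exp (- of_real \<alpha> * (\<nu> * cnj \<nu>))"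
      by (simp only: exp_of_real[symmetric])
    moreover have "exp (- of_real \<alpha> * (\<nu> * cnj \<nu>)) * fock_kernel \<alpha> \<nu> z = exp (of_real \<alpha> * (z * cnj \<nu> - \<nu> * cnj \<nu>))"
      unfolding fock_kernel_def mult_exp_exp by (simp add: algebra_simps)
    moreover have "analysis_coeff r f \<nu> * (fock_kernel \<alpha> \<nu> z / of_real (kernel_norm \<nu>)) =
        of_real (r\<^sup>2) * (f \<nu> * (complex_of_real (exp (- \<alpha> * (norm \<nu>)\<^sup>2)) * fock_kernel \<alpha> \<nu> z)) * (1 / of_real (gaussian_mass \<alpha>))"
      using kernel_norm_pos[of \<nu>] gaussian_mass_pos[OF \<alpha>]
      unfolding analysis_coeff_def of_real_mult of_real_divide by simp
    ultimately show ?thesis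
      by (simp only: fock_reproducing_integrand_def)
  qed
  have "((\<lambda>\<nu>. of_real (r\<^sup>2) * fock_reproducing_integrand \<alpha> f z \<nu> * (1 / of_real (gaussian_mass \<alpha>))) has_sum
      (\<integral>u. fock_reproducing_integrand \<alpha> f z (lattice_floor r u) \<partial>lborel) * (1 / of_real (gaussian_mass \<alpha>)))
      (lattice_pts r)"
    by (intro has_sum_cmult_left has_sum_lattice_floor r integrable_reproducing_integrand_lattice f)
  then show ?thesis
    unfolding synthesis_def eq by (simp add: infsumI)
qed

text \<open>A point has O(1/r^2) lattice points within distance \<open>R\<close>, and the weight r^2
  makes the bound uniform in \<open>r\<close>. The count comes from majorising the indicator of the
  ball by exp(R^2) times a Gaussian.\<close>

lemma lattice_overlap_bound:
  "\<exists>C>0. \<forall>r g. 0 < r \<longrightarrow> r \<le> 1 \<longrightarrow> g \<in> borel_measurable \<mu> \<longrightarrow>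
    (\<integral>\<^sup>+\<nu>. ennreal (r\<^sup>2) * (\<integral>\<^sup>+z. g z * indicator (ball \<nu> R) z \<partial>\<mu>) \<partial>count_space (lattice_pts r)) \<le>
    ennreal C * (\<integral>\<^sup>+z. g z \<partial>\<mu>)"
proof -
  obtain C where C: "C > 0" and sum: "\<And>r z. 0 < r \<Longrightarrow> r \<le> 1 \<Longrightarrow>
      (\<integral>\<^sup>+\<nu>. ennreal (r\<^sup>2 * exp (- 1 * (norm (z - \<nu>))\<^sup>2)) \<partial>count_space (lattice_pts r)) \<le> ennreal C"
    using lattice_gaussian_sum_bound[of 1 1] by auto
  define E where "E = exp (R\<^sup>2)"
  have "(\<integral>\<^sup>+\<nu>. ennreal (r\<^sup>2) * (\<integral>\<^sup>+z. g z * indicator (ball \<nu> R) z \<partial>\<mu>) \<partial>count_space (lattice_pts r)) \<le>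
    ennreal (E * C) * (\<integral>\<^sup>+z. g z \<partial>\<mu>)" if r: "0 < r" "r \<le> 1" and gm [measurable]: "g \<in> borel_measurable \<mu>" for r g
  proof -
    let ?L = "count_space (lattice_pts r)"
    have m1: "(\<lambda>z. g z * indicator (ball \<nu> R) z) \<in> borel_measurable \<mu>" for \<nu>
      by (intro borel_measurable_times_ennreal borel_measurable_indicator gm) auto
    have "(\<integral>\<^sup>+\<nu>. ennreal (r\<^sup>2) * (\<integral>\<^sup>+z. g z * indicator (ball \<nu> R) z \<partial>\<mu>) \<partial>?L) =
        (\<integral>\<^sup>+\<nu>. (\<integral>\<^sup>+z. ennreal (r\<^sup>2) * (g z * indicator (ball \<nu> R) z) \<partial>\<mu>) \<partial>?L)"
      by (intro nn_integral_cong nn_integral_cmult[symmetric] m1)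
    also have "\<dots> = (\<integral>\<^sup>+z. (\<integral>\<^sup>+\<nu>. ennreal (r\<^sup>2) * (g z * indicator (ball \<nu> R) z) \<partial>?L) \<partial>\<mu>)"
      by (intro nn_integral_count_space_nn_integral[symmetric] countable_lattice_pts
          borel_measurable_times_ennreal m1) auto
    also have "\<dots> \<le> (\<integral>\<^sup>+z. ennreal (E * C) * g z \<partial>\<mu>)"
    proof (intro nn_integral_mono)
      fix z
      have "(\<integral>\<^sup>+\<nu>. ennreal (r\<^sup>2) * (g z * indicator (ball \<nu> R) z) \<partial>?L) \<le>
          (\<integral>\<^sup>+\<nu>. (g z * ennreal E) * ennreal (r\<^sup>2 * exp (- 1 * (norm (z - \<nu>))\<^sup>2)) \<partial>?L)"
      proof (intro nn_integral_mono)
        fix \<nu>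
        have "indicator (ball \<nu> R) z \<le> E * exp (- 1 * (norm (z - \<nu>))\<^sup>2)"
        proof (cases "z \<in> ball \<nu> R")
          case True
          then have "(norm (z - \<nu>))\<^sup>2 \<le> R\<^sup>2"
            by (intro power_mono) (auto simp: dist_norm norm_minus_commute)
          then show ?thesis
            using True by (simp add: E_def mult_exp_exp)
        qed (simp add: E_def)
        then have "ennreal (r\<^sup>2) * ennreal (indicator (ball \<nu> R) z) \<le>
            ennreal (r\<^sup>2) * ennreal (E * exp (- 1 * (norm (z - \<nu>))\<^sup>2))"
          by (intro mult_left_mono ennreal_leI) auto
        then have "g z * (ennreal (r\<^sup>2) * ennreal (indicator (ball \<nu> R) z)) \<le>
            g z * (ennreal (r\<^sup>2) * ennreal (E * exp (- 1 * (norm (z - \<nu>))\<^sup>2)))"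
          by (rule mult_left_mono) simp
        then show "ennreal (r\<^sup>2) * (g z * indicator (ball \<nu> R) z) \<le>
            (g z * ennreal E) * ennreal (r\<^sup>2 * exp (- 1 * (norm (z - \<nu>))\<^sup>2))"
          by (simp add: E_def ennreal_mult ennreal_indicator mult_ac)
      qed
      also have "\<dots> = (g z * ennreal E) * (\<integral>\<^sup>+\<nu>. ennreal (r\<^sup>2 * exp (- 1 * (norm (z - \<nu>))\<^sup>2)) \<partial>?L)"
        by (intro nn_integral_cmult) auto
      also have "\<dots> \<le> (g z * ennreal E) * ennreal C"
        using sum[OF r] by (intro mult_left_mono) auto
      also have "\<dots> = ennreal (E * C) * g z"
        using C by (simp add: E_def ennreal_mult mult_ac)
      finally show "(\<integral>\<^sup>+\<nu>. ennreal (r\<^sup>2) * (g z * indicator (ball \<nu> R) z) \<partial>?L) \<le> ennreal (E * C) * g z" .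
    qed
    also have "\<dots> = ennreal (E * C) * (\<integral>\<^sup>+z. g z \<partial>\<mu>)"
      by (intro nn_integral_cmult) auto
    finally show ?thesis .
  qed
  moreover have "E * C > 0" using C by (simp add: E_def)
  ultimately show ?thesis by blast
qed

lemma measurable_G_powr:
  assumes "f holomorphic_on UNIV"
  shows "(\<lambda>z. ennreal (G f z powr p)) \<in> borel_measurable \<mu>"
proof -
  note [measurable] = borel_measurable_entire[OF assms]
  show ?thesis by (intro borel_measurable_\<mu>) simp
qed

text \<open>Each coefficient is a multiple of \<open>G f \<nu>\<close> times
  \<open>reduced_norm \<nu>\<close>, so its p-th power is controlled by \<open>W \<nu>\<close> times
  that of \<open>G f \<nu>\<close>, hence by the local norm around \<nu>; the overlap of these
  neighbourhoods is bounded.\<close>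

lemma analysis_coeff_bound:
  assumes r: "0 < r" "r \<le> 1"
  shows "\<exists>C>0. \<forall>f\<in>fock_space p \<alpha> w.
    (\<integral>\<^sup>+\<nu>. ennreal (norm (analysis_coeff r f \<nu>) powr p) \<partial>count_space (lattice_pts r)) \<le>
    ennreal C * (\<integral>\<^sup>+z. ennreal (G f z powr p) \<partial>\<mu>)"
proof -
  let ?L = "count_space (lattice_pts r)"
  define m where "m = gaussian_mass \<alpha>"
  have m: "m > 0" unfolding m_def by (rule gaussian_mass_pos[OF \<alpha>])
  obtain C1 where C1: "C1 > 0" and loc: "\<And>f \<nu> \<zeta>. f holomorphic_on UNIV \<Longrightarrow> norm \<zeta> \<le> 0 \<Longrightarrow>
    ennreal (W \<nu> * G f (\<nu> + \<zeta>) powr p) \<le>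
    ennreal C1 * (\<integral>\<^sup>+z. ennreal (G f z powr p) * indicator (ball \<nu> (0 + 2 * s)) z \<partial>\<mu>)"
    using local_sup_bound[of 0] by blast
  obtain c2 where c2: "c2 > 0" and up: "\<And>\<nu>. reduced_norm \<nu> powr p \<le> c2 * W \<nu>" and pos: "\<And>\<nu>. 0 < reduced_norm \<nu>"
    using reduced_norm_bounds by blast
  obtain C4 where C4: "C4 > 0" and ov: "\<And>g. g \<in> borel_measurable \<mu> \<Longrightarrow>
    (\<integral>\<^sup>+\<nu>. ennreal (r\<^sup>2) * (\<integral>\<^sup>+z. g z * indicator (ball \<nu> (0 + 2 * s)) z \<partial>\<mu>) \<partial>?L) \<le> ennreal C4 * (\<integral>\<^sup>+z. g z \<partial>\<mu>)"
    using lattice_overlap_bound[of "0 + 2 * s"] r by blast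
  define E where "E = (r\<^sup>2 / m) powr p * c2 * C1 / r\<^sup>2"
  have E: "E > 0" using r m c2 C1 by (simp add: E_def)
  have "(\<integral>\<^sup>+\<nu>. ennreal (norm (analysis_coeff r f \<nu>) powr p) \<partial>?L) \<le>
    ennreal (E * C4) * (\<integral>\<^sup>+z. ennreal (G f z powr p) \<partial>\<mu>)" if f: "f \<in> fock_space p \<alpha> w" for f
  proof -
    have hol: "f holomorphic_on UNIV" using f by (simp add: fock_space_iff)
    have "(\<integral>\<^sup>+\<nu>. ennreal (norm (analysis_coeff r f \<nu>) powr p) \<partial>?L) \<le>
      (\<integral>\<^sup>+\<nu>. ennreal E * (ennreal (r\<^sup>2) * (\<integral>\<^sup>+z. ennreal (G f z powr p) * indicator (ball \<nu> (0 + 2 * s)) z \<partial>\<mu>)) \<partial>?L)"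
    proof (intro nn_integral_mono)
      fix \<nu>
      have "norm (analysis_coeff r f \<nu>) = r\<^sup>2 / m * (norm (f \<nu>) * exp (- \<alpha> * (norm \<nu>)\<^sup>2) * kernel_norm \<nu>)"
        using m kernel_norm_pos[of \<nu>] by (simp add: analysis_coeff_def norm_mult norm_divide m_def norm_power abs_mult)
      \<comment> \<open>One half of the exponent completes \<open>f\<close> to \<open>G f\<close>,
        the other half completes \<open>kernel_norm\<close> to \<open>reduced_norm\<close>.\<close>
      also have "exp (- \<alpha> * (norm \<nu>)\<^sup>2) = exp (- (\<alpha> / 2) * (norm \<nu>)\<^sup>2) * exp (- (\<alpha> / 2) * (norm \<nu>)\<^sup>2)"
        by (simp add: mult_exp_exp)
      finally have "norm (analysis_coeff r f \<nu>) = r\<^sup>2 / m * (G f \<nu> * reduced_norm \<nu>)"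
        by (simp only: gauss_modulus_def reduced_norm_def mult_ac)
      then have "norm (analysis_coeff r f \<nu>) powr p = (r\<^sup>2 / m) powr p * (G f \<nu> powr p * reduced_norm \<nu> powr p)"
        by (simp only: powr_mult)
      also have "\<dots> \<le> (r\<^sup>2 / m) powr p * (G f \<nu> powr p * (c2 * W \<nu>))"
        by (intro mult_left_mono up) auto
      also have "\<dots> = ((r\<^sup>2 / m) powr p * c2) * (W \<nu> * G f \<nu> powr p)"
        by (simp only: mult_ac)
      finally have "ennreal (norm (analysis_coeff r f \<nu>) powr p) \<le>
          ennreal ((r\<^sup>2 / m) powr p * c2) * ennreal (W \<nu> * G f \<nu> powr p)"
        using c2 by (simp add: ennreal_leI flip: ennreal_mult)
      also have "\<dots> \<le> ennreal ((r\<^sup>2 / m) powr p * c2) * (ennreal C1 *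
          (\<integral>\<^sup>+z. ennreal (G f z powr p) * indicator (ball \<nu> (0 + 2 * s)) z \<partial>\<mu>))"
        using loc[OF hol, of 0 \<nu>] by (intro mult_left_mono) auto
      also have "\<dots> = ennreal ((r\<^sup>2 / m) powr p * c2 * C1) *
          (\<integral>\<^sup>+z. ennreal (G f z powr p) * indicator (ball \<nu> (0 + 2 * s)) z \<partial>\<mu>)"
        using c2 C1 by (simp add: ennreal_mult mult.assoc)
      also have "(r\<^sup>2 / m) powr p * c2 * C1 = E * r\<^sup>2"
        using r by (simp add: E_def)
      also have "ennreal (E * r\<^sup>2) = ennreal E * ennreal (r\<^sup>2)"
        using E by (simp add: ennreal_mult)
      finally show "ennreal (norm (analysis_coeff r f \<nu>) powr p) \<le>
          ennreal E * (ennreal (r\<^sup>2) * (\<integral>\<^sup>+z. ennreal (G f z powr p) * indicator (ball \<nu> (0 + 2 * s)) z \<partial>\<mu>))"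
        by (simp add: mult.assoc)
    qed
    also have "\<dots> = ennreal E * (\<integral>\<^sup>+\<nu>. ennreal (r\<^sup>2) * (\<integral>\<^sup>+z. ennreal (G f z powr p) * indicator (ball \<nu> (0 + 2 * s)) z \<partial>\<mu>) \<partial>?L)"
      by (intro nn_integral_cmult) auto
    also have "\<dots> \<le> ennreal E * (ennreal C4 * (\<integral>\<^sup>+z. ennreal (G f z powr p) \<partial>\<mu>))"
      by (intro mult_left_mono ov measurable_G_powr hol) auto
    also have "\<dots> = ennreal (E * C4) * (\<integral>\<^sup>+z. ennreal (G f z powr p) \<partial>\<mu>)"
      using E C4 by (simp add: ennreal_mult mult.assoc)
    finally show ?thesis .
  qed
  then show ?thesis
    using E C4 by (intro exI[of _ "E * C4"]) auto
qed


text \<open>\<open>C\<close> is chosen before \<open>r\<close>, so the lattice sums keep their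
  weight r^2 throughout. On a cell the integrand deviates from its value at the lattice point by at
  most 2 r times a Gaussian and the local supremum \<open>K\<close>; r <= 1/2 keeps the displacement
  2 r in the range of the Lipschitz estimate.\<close>

lemma discretization_norm_bound:
  "\<exists>C>0. \<forall>r f. 0 < r \<longrightarrow> r \<le> 1 / 2 \<longrightarrow> f \<in> fock_space p \<alpha> w \<longrightarrow>
    (\<integral>\<^sup>+z. ennreal (G (\<lambda>z. f z - synthesis r (analysis_coeff r f) z) z powr p) \<partial>\<mu>) \<le>
    ennreal (C * r powr p) * (\<integral>\<^sup>+z. ennreal (G f z powr p) \<partial>\<mu>)"
proof -
  define m where "m = gaussian_mass \<alpha>"
  have m: "m > 0" unfolding m_def by (rule gaussian_mass_pos[OF \<alpha>])
  \<comment> \<open>The disc of radius 2 from the Cauchy estimate, enlarged by 2 s in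
    \<open>local_sup_bound\<close>.\<close>
  define R where "R = 2 + 2 * s"
  obtain C1 where C1: "C1 > 0" and loc: "\<And>f \<nu> \<zeta>. f holomorphic_on UNIV \<Longrightarrow> norm \<zeta> \<le> 2 \<Longrightarrow>
    ennreal (W \<nu> * G f (\<nu> + \<zeta>) powr p) \<le>
    ennreal C1 * (\<integral>\<^sup>+z. ennreal (G f z powr p) * indicator (ball \<nu> R) z \<partial>\<mu>)"
    using local_sup_bound[of 2] unfolding R_def by auto
  obtain C2 where C2: "C2 > 0" and sum2: "\<And>r z. 0 < r \<Longrightarrow> r \<le> 1 \<Longrightarrow>
    (\<integral>\<^sup>+\<nu>. ennreal (r\<^sup>2 * exp (- (\<alpha> / 4) * (norm (z - \<nu>))\<^sup>2)) \<partial>count_space (lattice_pts r)) \<le> ennreal C2"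
    using lattice_gaussian_sum_bound[of "\<alpha> / 4" 1] \<alpha> by auto
  obtain C3 where C3: "C3 > 0" and bd:
      "\<And>\<nu>. (\<integral>\<^sup>+z. ennreal (exp (- (\<alpha> / 4) * (norm (z - \<nu>))\<^sup>2)) \<partial>\<mu>) \<le> ennreal (C3 * W \<nu>)"
    using gaussian_weight_bound[of "\<alpha> / 4"] \<alpha> by auto
  obtain C4 where C4: "C4 > 0" and ov: "\<And>r g. 0 < r \<Longrightarrow> r \<le> 1 \<Longrightarrow> g \<in> borel_measurable \<mu> \<Longrightarrow>
    (\<integral>\<^sup>+\<nu>. ennreal (r\<^sup>2) * (\<integral>\<^sup>+z. g z * indicator (ball \<nu> R) z \<partial>\<mu>) \<partial>count_space (lattice_pts r)) \<le>
    ennreal C4 * (\<integral>\<^sup>+z. g z \<partial>\<mu>)"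
    using lattice_overlap_bound[of R] by blast
  \<comment> \<open>2 stems from the displacement bound 2 r, exp (8 alpha) from the Lipschitz
    estimate, and 1/m from normalising the reproducing formula.\<close>
  define b where "b = 2 * exp (8 * \<alpha>) / m"
  have b: "b > 0" using m by (simp add: b_def)
  define E where "E = C2 powr (p - 1) * (C3 * b powr p * C1)"
  have E: "E > 0" using C1 C2 C3 b by (simp add: E_def)
  have "(\<integral>\<^sup>+z. ennreal (G (\<lambda>z. f z - synthesis r (analysis_coeff r f) z) z powr p) \<partial>\<mu>) \<le>
    ennreal (E * C4 * r powr p) * (\<integral>\<^sup>+z. ennreal (G f z powr p) \<partial>\<mu>)"
    if r: "0 < r" "r \<le> 1 / 2" and f: "f \<in> fock_space p \<alpha> w" for r f
  proof -
    let ?L = "count_space (lattice_pts r)"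
    have hol: "f holomorphic_on UNIV" and fin: "(\<integral>\<^sup>+z. ennreal (G f z powr p) \<partial>\<mu>) < \<infinity>"
      using f by (auto simp: fock_space_iff)
    define V where "V = (\<lambda>\<nu>. \<integral>\<^sup>+z. ennreal (G f z powr p) * indicator (ball \<nu> R) z \<partial>\<mu>)"
    define v where "v = (\<lambda>\<nu>. enn2real (V \<nu>))"
    have V: "V \<nu> = ennreal (v \<nu>)" for \<nu>
    proof -
      have "V \<nu> \<le> (\<integral>\<^sup>+z. ennreal (G f z powr p) \<partial>\<mu>)"
        unfolding V_def by (intro nn_integral_mono) (auto split: split_indicator)
      then show ?thesis using fin by (simp add: v_def)
    qed
    have v0: "v \<nu> \<ge> 0" for \<nu> by (simp add: v_def)
    \<comment> \<open>A bound for \<open>G f\<close> on the disc of radius 2 around \<nu>, solved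
      from \<open>local_sup_bound\<close>. Its p-th power times \<open>W \<nu>\<close> is a multiple
      of the local norm \<open>v \<nu>\<close>, so the masses cancel in \<open>gW\<close>.\<close>
    define K where "K = (\<lambda>\<nu>. (C1 * v \<nu> / W \<nu>) powr (1 / p))"
    have K0: "0 \<le> K \<nu>" for \<nu> by (simp add: K_def)
    have GK: "G f (\<nu> + \<zeta>) \<le> K \<nu>" if "norm \<zeta> \<le> 2" for \<nu> \<zeta>
    proof -
      have "ennreal (W \<nu> * G f (\<nu> + \<zeta>) powr p) \<le> ennreal C1 * ennreal (v \<nu>)"
        using loc[OF hol that, of \<nu>] V[of \<nu>] by (simp add: V_def)
      then have "W \<nu> * G f (\<nu> + \<zeta>) powr p \<le> C1 * v \<nu>"
        using C1 v0 by (simp add: ennreal_le_iff flip: ennreal_mult)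
      then have "G f (\<nu> + \<zeta>) powr p \<le> C1 * v \<nu> / W \<nu>"
        using pos_square[of \<nu>] by (simp add: field_simps)
      then have "(G f (\<nu> + \<zeta>) powr p) powr (1 / p) \<le> K \<nu>"
        unfolding K_def using p by (intro powr_mono2) auto
      then show ?thesis using p by (simp add: powr_powr)
    qed
    define g where "g = (\<lambda>\<nu>. b * r * K \<nu>)"
    have g0: "0 \<le> g \<nu>" for \<nu> using b r K0 by (simp add: g_def)
    have gW: "g \<nu> powr p * (C3 * W \<nu>) = (b powr p * C1 * C3) * r powr p * v \<nu>" for \<nu>
    proof -
      have "K \<nu> powr p = C1 * v \<nu> / W \<nu>"
        using p C1 v0[of \<nu>] by (simp add: K_def powr_powr)
      then show ?thesis
        using pos_square[of \<nu>] by (simp add: g_def powr_mult less_le)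
    qed
    define k where "k = (\<lambda>z \<nu> :: complex. r\<^sup>2 * exp (- (\<alpha> / 4) * (norm (z - \<nu>))\<^sup>2))"
    let ?F = "\<lambda>z. f z - synthesis r (analysis_coeff r f) z"
    have pw1: "ennreal (G ?F z) \<le> (\<integral>\<^sup>+\<nu>. ennreal (k z \<nu> * g \<nu>) \<partial>?L)" for z
    proof -
      let ?H = "fock_reproducing_integrand \<alpha> f z"
      define e where "e = exp (\<alpha> / 2 * (norm z)\<^sup>2)"
      have e: "e > 0" by (simp add: e_def)
      note i1 = integrable_reproducing_integrand[OF f, of z]
      note i2 = integrable_reproducing_integrand_lattice[OF f r(1), of z]
      have "f z * of_real m = (\<integral>u. ?H u \<partial>lborel)"
        using fock_reproducing_formula[OF hol i1] by (simp add: m_def)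
      moreover have "synthesis r (analysis_coeff r f) z * of_real m = (\<integral>u. ?H (lattice_floor r u) \<partial>lborel)"
        using synthesis_analysis_coeff[OF f r(1), of z] m by (simp add: m_def)
      ultimately have "?F z * of_real m = (\<integral>u. ?H u - ?H (lattice_floor r u) \<partial>lborel)"
        using i1 i2 by (simp add: left_diff_distrib)
      then have "norm (?F z) * m = norm (\<integral>u. ?H u - ?H (lattice_floor r u) \<partial>lborel)"
        using m by (metis abs_of_pos norm_mult norm_of_real)
      then have "ennreal (norm (?F z) * m) \<le> (\<integral>\<^sup>+u. ennreal (norm (?H u - ?H (lattice_floor r u))) \<partial>lborel)"
        using integral_norm_bound_ennreal[OF Bochner_Integration.integrable_diff[OF i1 i2]] by simp
      also have "\<dots> \<le> (\<integral>\<^sup>+u. (\<lambda>\<nu>. ennreal (e * m * (exp (- (\<alpha> / 4) * (norm (z - \<nu>))\<^sup>2) * g \<nu>))) (lattice_floor r u) \<partial>lborel)"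
      proof (intro nn_integral_mono)
        fix u
        define \<nu> where "\<nu> = lattice_floor r u"
        have "norm (?H (\<nu> + (u - \<nu>)) - ?H \<nu>) \<le>
            exp (\<alpha> / 2 * (norm z)\<^sup>2) * ((2 * r) * K \<nu> * exp (8 * \<alpha>) * exp (- (\<alpha> / 4) * (norm (z - \<nu>))\<^sup>2))"
          using r norm_diff_lattice_floor[OF r(1), of u] unfolding \<nu>_def
          by (intro fock_reproducing_integrand_lipschitz \<alpha> hol GK) auto
        also have "\<dots> = e * m * (exp (- (\<alpha> / 4) * (norm (z - \<nu>))\<^sup>2) * g \<nu>)"
          using m by (simp add: e_def g_def b_def)
        finally show "ennreal (norm (?H u - ?H (lattice_floor r u))) \<le>
            (\<lambda>\<nu>. ennreal (e * m * (exp (- (\<alpha> / 4) * (norm (z - \<nu>))\<^sup>2) * g \<nu>))) (lattice_floor r u)"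
          by (simp add: \<nu>_def ennreal_leI)
      qed
      also have "\<dots> = (\<integral>\<^sup>+\<nu>. ennreal (r\<^sup>2) * ennreal (e * m * (exp (- (\<alpha> / 4) * (norm (z - \<nu>))\<^sup>2) * g \<nu>)) \<partial>?L)"
        by (rule nn_integral_lattice_floor[OF r(1)])
      also have "\<dots> = (\<integral>\<^sup>+\<nu>. ennreal (e * m) * ennreal (k z \<nu> * g \<nu>) \<partial>?L)"
        using e m g0 by (intro nn_integral_cong) (simp add: k_def mult_ac flip: ennreal_mult)
      also have "\<dots> = ennreal (e * m) * (\<integral>\<^sup>+\<nu>. ennreal (k z \<nu> * g \<nu>) \<partial>?L)"
        by (intro nn_integral_cmult) auto
      also have "norm (?F z) * m = e * m * G ?F z"
      proof -
        have "norm (?F z) * m = (e * exp (- (\<alpha> / 2) * (norm z)\<^sup>2)) * (norm (?F z) * m)"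
          by (simp add: e_def mult_exp_exp)
        then show ?thesis
          by (simp only: gauss_modulus_def mult_ac)
      qed
      finally have "ennreal (e * m) * ennreal (G ?F z) \<le> ennreal (e * m) * (\<integral>\<^sup>+\<nu>. ennreal (k z \<nu> * g \<nu>) \<partial>?L)"
        using e m by (simp add: ennreal_mult)
      then show ?thesis
        using e m by (subst (asm) ennreal_mult_le_mult_iff) auto
    qed
    have pw: "ennreal (G ?F z powr p) \<le> ennreal (C2 powr (p - 1)) * (\<integral>\<^sup>+\<nu>. ennreal (k z \<nu> * g \<nu> powr p) \<partial>?L)" for z
    proof (rule nn_integral_power_mean[OF p C2 gauss_modulus_nonneg _ _ _ g0 pw1])
      show "(\<integral>\<^sup>+\<nu>. ennreal (k z \<nu>) \<partial>?L) \<le> ennreal C2"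
        unfolding k_def using r by (intro sum2) auto
    qed (auto simp: k_def)
    have km: "(\<lambda>z. k z \<nu> * t) \<in> borel_measurable \<mu>" for \<nu> t
      unfolding k_def by (intro borel_measurable_\<mu> borel_measurable_continuous_onI continuous_intros)
    have "(\<integral>\<^sup>+z. ennreal (G ?F z powr p) \<partial>\<mu>) \<le>
        (\<integral>\<^sup>+z. ennreal (C2 powr (p - 1)) * (\<integral>\<^sup>+\<nu>. ennreal (k z \<nu> * g \<nu> powr p) \<partial>?L) \<partial>\<mu>)"
      by (intro nn_integral_mono pw)
    also have "\<dots> = (\<integral>\<^sup>+z. (\<integral>\<^sup>+\<nu>. ennreal (C2 powr (p - 1)) * ennreal (k z \<nu> * g \<nu> powr p) \<partial>?L) \<partial>\<mu>)"
      by (intro nn_integral_cong nn_integral_cmult[symmetric]) auto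
    also have "\<dots> = (\<integral>\<^sup>+\<nu>. (\<integral>\<^sup>+z. ennreal (C2 powr (p - 1)) * ennreal (k z \<nu> * g \<nu> powr p) \<partial>\<mu>) \<partial>?L)"
      using km by (intro nn_integral_count_space_nn_integral countable_lattice_pts) simp
    also have "\<dots> \<le> (\<integral>\<^sup>+\<nu>. ennreal (E * r powr p) * (ennreal (r\<^sup>2) * V \<nu>) \<partial>?L)"
    proof (intro nn_integral_mono)
      fix \<nu>
      define d where "d = C2 powr (p - 1) * g \<nu> powr p * r\<^sup>2"
      have d0: "d \<ge> 0" by (simp add: d_def)
      have m1: "(\<lambda>z. exp (- (\<alpha> / 4) * (norm (z - \<nu>))\<^sup>2)) \<in> borel_measurable \<mu>"
        by (intro borel_measurable_\<mu> borel_measurable_continuous_onI continuous_intros)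
      have "(\<integral>\<^sup>+z. ennreal (C2 powr (p - 1)) * ennreal (k z \<nu> * g \<nu> powr p) \<partial>\<mu>) =
          (\<integral>\<^sup>+z. ennreal d * ennreal (exp (- (\<alpha> / 4) * (norm (z - \<nu>))\<^sup>2)) \<partial>\<mu>)"
        by (intro nn_integral_cong) (simp add: k_def d_def mult_ac flip: ennreal_mult)
      also have "\<dots> = ennreal d * (\<integral>\<^sup>+z. ennreal (exp (- (\<alpha> / 4) * (norm (z - \<nu>))\<^sup>2)) \<partial>\<mu>)"
        using m1 by (intro nn_integral_cmult) simp
      also have "\<dots> \<le> ennreal d * ennreal (C3 * W \<nu>)"
        by (intro mult_left_mono bd) simp
      also have "\<dots> = ennreal (C2 powr (p - 1) * r\<^sup>2 * (g \<nu> powr p * (C3 * W \<nu>)))"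
        using C3 d0 by (simp add: d_def mult_ac flip: ennreal_mult)
      also have "C2 powr (p - 1) * r\<^sup>2 * (g \<nu> powr p * (C3 * W \<nu>)) = (E * r powr p) * (r\<^sup>2 * v \<nu>)"
        unfolding gW by (simp add: E_def mult_ac)
      also have "ennreal \<dots> = ennreal (E * r powr p) * (ennreal (r\<^sup>2) * V \<nu>)"
        unfolding V using E v0 by (simp add: ennreal_mult)
      finally show "(\<integral>\<^sup>+z. ennreal (C2 powr (p - 1)) * ennreal (k z \<nu> * g \<nu> powr p) \<partial>\<mu>) \<le>
          ennreal (E * r powr p) * (ennreal (r\<^sup>2) * V \<nu>)" .
    qed
    also have "\<dots> = ennreal (E * r powr p) * (\<integral>\<^sup>+\<nu>. ennreal (r\<^sup>2) * V \<nu> \<partial>?L)"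
      by (intro nn_integral_cmult) auto
    also have "\<dots> \<le> ennreal (E * r powr p) * (ennreal C4 * (\<integral>\<^sup>+z. ennreal (G f z powr p) \<partial>\<mu>))"
      unfolding V_def using r by (intro mult_left_mono ov measurable_G_powr hol) auto
    also have "\<dots> = ennreal (E * C4 * r powr p) * (\<integral>\<^sup>+z. ennreal (G f z powr p) \<partial>\<mu>)"
      using E C4 by (simp add: ennreal_mult mult_ac)
    finally show ?thesis .
  qed
  then show ?thesis
    using E C4 by (intro exI[of _ "E * C4"]) auto
qed

end

subsection \<open>Inverting the discretized reproducing formula\<close>

lemma le_root_of_powr_le:
  fixes x y C p :: real
  assumes "0 < p" "0 \<le> x" "0 \<le> y" "x powr p \<le> C * y powr p"
  shows "x \<le> C powr (1 / p) * y"
proof -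
  have "x = (x powr p) powr (1 / p)"
    using assms by (simp add: powr_powr)
  also have "\<dots> \<le> (C * y powr p) powr (1 / p)"
    using assms by (intro powr_mono2) auto
  also have "\<dots> = C powr (1 / p) * y"
    using assms by (simp add: powr_mult powr_powr)
  finally show ?thesis .
qed

context ap_weight
begin

lemma synthesis_add:
  assumes r: "r > 0"
    and c: "\<And>\<nu>. \<nu> \<in> lattice_pts r \<Longrightarrow> norm (c \<nu>) \<le> b"
    and d: "\<And>\<nu>. \<nu> \<in> lattice_pts r \<Longrightarrow> norm (d \<nu>) \<le> b'"
  shows "synthesis r (\<lambda>\<nu>. c \<nu> + d \<nu>) z = synthesis r c z + synthesis r d z"
proof -
  let ?k = "\<lambda>\<nu>. fock_kernel \<alpha> \<nu> z / of_real (kernel_norm \<nu>)"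
  have "((\<lambda>\<nu>. c \<nu> * ?k \<nu>) has_sum synthesis r c z) (lattice_pts r)"
    "((\<lambda>\<nu>. d \<nu> * ?k \<nu>) has_sum synthesis r d z) (lattice_pts r)"
    by (rule has_sum_synthesis[OF r], erule c, rule has_sum_synthesis[OF r], erule d)
  then have "((\<lambda>\<nu>. (c \<nu> + d \<nu>) * ?k \<nu>) has_sum (synthesis r c z + synthesis r d z)) (lattice_pts r)"
    unfolding distrib_right by (rule has_sum_add)
  then show ?thesis
    unfolding synthesis_def[of r "\<lambda>\<nu>. c \<nu> + d \<nu>"] by (rule infsumI)
qed

text \<open>A Neumann series with ratio 1/4 in norm. Coefficient sequences are added pointwise: a
  geometric supremum bound gives convergence, and a weighted power mean over the iterates gives the
  p-th power estimate, in place of an appeal to completeness of the sequence space.\<close>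

lemma decomposition_with_bound:
  assumes r: "0 < r" "r \<le> 1 / 2"
    and contraction: "\<And>f. f \<in> fock_space p \<alpha> w \<Longrightarrow>
      (\<integral>\<^sup>+z. ennreal (G (\<lambda>z. f z - synthesis r (analysis_coeff r f) z) z powr p) \<partial>\<mu>) \<le>
      ennreal (4 powr (- p)) * (\<integral>\<^sup>+z. ennreal (G f z powr p) \<partial>\<mu>)"
  shows "\<exists>C>0. \<forall>f\<in>fock_space p \<alpha> w. \<exists>c\<in>lp_space p (lattice_pts r).
    (\<integral>\<^sup>+\<nu>. ennreal (norm (c \<nu>) powr p) \<partial>count_space (lattice_pts r)) \<le> ennreal C * (\<integral>\<^sup>+z. ennreal (G f z powr p) \<partial>\<mu>) \<and>
    f = synthesis r c"
proof -
  let ?L = "count_space (lattice_pts r)"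
  obtain Ca where Ca: "Ca > 0" and an: "\<And>f. f \<in> fock_space p \<alpha> w \<Longrightarrow>
    (\<integral>\<^sup>+\<nu>. ennreal (norm (analysis_coeff r f \<nu>) powr p) \<partial>?L) \<le> ennreal Ca * (\<integral>\<^sup>+z. ennreal (G f z powr p) \<partial>\<mu>)"
    using analysis_coeff_bound[of r] r by auto
  obtain Cg \<kappa> where Cg: "Cg > 0" "\<kappa> \<ge> 0" and "\<forall>f A z. f holomorphic_on UNIV \<longrightarrow> 0 \<le> A \<longrightarrow>
    (\<integral>\<^sup>+z. ennreal (G f z powr p) \<partial>\<mu>) \<le> ennreal A \<longrightarrow> G f z powr p \<le> Cg * A * exp (\<kappa> * norm z)"
    using pointwise_growth by blast
  then have gr: "\<And>f A z. f holomorphic_on UNIV \<Longrightarrow> 0 \<le> A \<Longrightarrow>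
    (\<integral>\<^sup>+z. ennreal (G f z powr p) \<partial>\<mu>) \<le> ennreal A \<Longrightarrow> G f z powr p \<le> Cg * A * exp (\<kappa> * norm z)"
    by blast
  have p0: "0 < p" using p by simp
  have "\<exists>c\<in>lp_space p (lattice_pts r).
    (\<integral>\<^sup>+\<nu>. ennreal (norm (c \<nu>) powr p) \<partial>?L) \<le> ennreal (2 powr p * Ca) * (\<integral>\<^sup>+z. ennreal (G f z powr p) \<partial>\<mu>) \<and>
    f = synthesis r c" if f: "f \<in> fock_space p \<alpha> w" for f
  proof -
    obtain A where A: "0 \<le> A" "(\<integral>\<^sup>+z. ennreal (G f z powr p) \<partial>\<mu>) = ennreal A"
      using f by (cases "\<integral>\<^sup>+z. ennreal (G f z powr p) \<partial>\<mu>") (auto simp: fock_space_iff)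
    \<comment> \<open>Here \<open>T\<close> denotes the error map, identity minus the operator
      called T in the overview.\<close>
    define T where "T = (\<lambda>f z. f z - synthesis r (analysis_coeff r f) z)"
    define F where "F = (\<lambda>n. (T ^^ n) f)"
    define cs where "cs = (\<lambda>n. analysis_coeff r (F n))"
    define b where "b = (Ca * A) powr (1 / p)"
    have b0: "b \<ge> 0" by (simp add: b_def)
    have F0: "F 0 = f" and FS: "F (Suc n) = (\<lambda>z. F n z - synthesis r (cs n) z)" for n
      by (auto simp: F_def T_def cs_def)
    have coeff: "(\<integral>\<^sup>+\<nu>. ennreal (norm (cs n \<nu>) powr p) \<partial>?L) \<le> ennreal (Ca * (A * (4 powr (- p)) ^ n))"
        "\<And>\<nu>. \<nu> \<in> lattice_pts r \<Longrightarrow> norm (cs n \<nu>) \<le> b * (1 / 4) ^ n"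
      if "F n \<in> fock_space p \<alpha> w" "(\<integral>\<^sup>+z. ennreal (G (F n) z powr p) \<partial>\<mu>) \<le> ennreal (A * (4 powr (- p)) ^ n)" for n
    proof -
      have "(\<integral>\<^sup>+\<nu>. ennreal (norm (cs n \<nu>) powr p) \<partial>?L) \<le> ennreal Ca * (\<integral>\<^sup>+z. ennreal (G (F n) z powr p) \<partial>\<mu>)"
        unfolding cs_def by (rule an[OF that(1)])
      also have "\<dots> \<le> ennreal Ca * ennreal (A * (4 powr (- p)) ^ n)"
        by (intro mult_left_mono that(2)) simp
      also have "\<dots> = ennreal (Ca * (A * (4 powr (- p)) ^ n))"
        using Ca A by (simp flip: ennreal_mult)
      finally show 1: "(\<integral>\<^sup>+\<nu>. ennreal (norm (cs n \<nu>) powr p) \<partial>?L) \<le> ennreal (Ca * (A * (4 powr (- p)) ^ n))" .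
      fix \<nu> assume \<nu>: "\<nu> \<in> lattice_pts r"
      have q: "((4 powr (- p)) ^ n) = ((1 / 4) ^ n) powr p"
        by (simp add: powr_realpow[symmetric] powr_powr powr_minus powr_divide mult.commute
            inverse_eq_divide)
      have "norm (cs n \<nu>) powr p \<le> Ca * (A * (4 powr (- p)) ^ n)"
        using Ca A by (intro le_of_nn_integral_count_space_le[OF 1 \<nu>]) auto
      also have "\<dots> = (Ca * A) * ((1 / 4) ^ n) powr p"
        by (simp only: q mult_ac)
      finally show "norm (cs n \<nu>) \<le> b * (1 / 4) ^ n"
        unfolding b_def by (intro le_root_of_powr_le[OF p0]) auto
    qed
    have Fn: "F n \<in> fock_space p \<alpha> w \<and> (\<integral>\<^sup>+z. ennreal (G (F n) z powr p) \<partial>\<mu>) \<le> ennreal (A * (4 powr (- p)) ^ n)" for n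
    proof (induction n)
      case 0
      then show ?case using f A F0 by simp
    next
      case (Suc n)
      have "synthesis r (cs n) holomorphic_on UNIV"
        using coeff(2)[of n] Suc.IH by (intro holomorphic_synthesis[OF r(1)]) auto
      then have hol: "F (Suc n) holomorphic_on UNIV"
        unfolding FS using Suc.IH by (intro holomorphic_intros) (auto simp: fock_space_iff)
      have "(\<integral>\<^sup>+z. ennreal (G (F (Suc n)) z powr p) \<partial>\<mu>) \<le>
          ennreal (4 powr (- p)) * (\<integral>\<^sup>+z. ennreal (G (F n) z powr p) \<partial>\<mu>)"
        unfolding FS cs_def using contraction Suc.IH by blast
      also have "\<dots> \<le> ennreal (4 powr (- p)) * ennreal (A * (4 powr (- p)) ^ n)"
        using Suc.IH by (intro mult_left_mono) auto
      also have "\<dots> = ennreal (A * (4 powr (- p)) ^ Suc n)"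
        using A by (simp add: mult_ac flip: ennreal_mult)
      finally have "(\<integral>\<^sup>+z. ennreal (G (F (Suc n)) z powr p) \<partial>\<mu>) \<le> ennreal (A * (4 powr (- p)) ^ Suc n)" .
      with hol show ?case
        by (auto simp: fock_space_iff intro: le_less_trans)
    qed
    have cs1: "(\<integral>\<^sup>+\<nu>. ennreal (norm (cs n \<nu>) powr p) \<partial>?L) \<le> ennreal (Ca * (A * (4 powr (- p)) ^ n))"
      and cs2: "\<nu> \<in> lattice_pts r \<Longrightarrow> norm (cs n \<nu>) \<le> b * (1 / 4) ^ n" for n \<nu>
      using coeff Fn by blast+
    have sm: "summable (\<lambda>n. norm (cs n \<nu>))" if "\<nu> \<in> lattice_pts r" for \<nu>
      by (rule summable_comparison_test'[of "\<lambda>n. b * (1 / 4) ^ n" 0])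
         (use cs2[OF that] in \<open>auto intro!: summable_mult summable_geometric\<close>)
    define c where "c = (\<lambda>\<nu>. \<Sum>n. cs n \<nu>)"
    \<comment> \<open>The geometric tail contributes 4/3, rounded up to 2. The case n = 0 bounds
      \<open>c\<close> itself.\<close>
    have tail: "norm (c \<nu> - (\<Sum>k<n. cs k \<nu>)) \<le> 2 * b * (1 / 4) ^ n" if \<nu>: "\<nu> \<in> lattice_pts r" for n \<nu>
    proof -
      have "c \<nu> - (\<Sum>k<n. cs k \<nu>) = (\<Sum>k. cs (k + n) \<nu>)"
        unfolding c_def using suminf_minus_initial_segment[OF summable_norm_cancel[OF sm[OF \<nu>]]] by simp
      also have "norm \<dots> \<le> (\<Sum>k. norm (cs (k + n) \<nu>))"
        by (intro summable_norm summable_ignore_initial_segment sm \<nu>)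
      also have "\<dots> \<le> (\<Sum>k. (b * (1 / 4) ^ n) * (1 / 4) ^ k)"
      proof (intro suminf_le)
        show "norm (cs (k + n) \<nu>) \<le> (b * (1 / 4) ^ n) * (1 / 4) ^ k" for k
          using cs2[OF \<nu>, of "k + n"] by (simp add: power_add mult_ac)
      qed (intro summable_ignore_initial_segment sm \<nu> summable_mult summable_geometric; simp)+
      also have "\<dots> = (b * (1 / 4) ^ n) * (4 / 3)"
        by (subst suminf_mult) (auto simp: suminf_geometric summable_geometric)
      also have "\<dots> \<le> 2 * b * (1 / 4) ^ n"
        using b0 by (simp add: mult_ac)
      finally show ?thesis .
    qed
    have cb: "norm (c \<nu>) \<le> 2 * b" if "\<nu> \<in> lattice_pts r" for \<nu>
      using tail[OF that, of 0] by simp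
    have partial_bound: "norm (\<Sum>k<n. cs k \<nu>) \<le> 4 * b" if \<nu>: "\<nu> \<in> lattice_pts r" for n \<nu>
    proof -
      have "norm (\<Sum>k<n. cs k \<nu>) \<le> norm (c \<nu>) + norm (c \<nu> - (\<Sum>k<n. cs k \<nu>))"
        using norm_triangle_ineq4[of "c \<nu>" "c \<nu> - (\<Sum>k<n. cs k \<nu>)"] by simp
      also have "\<dots> \<le> 2 * b + 2 * b * (1 / 4) ^ n"
        by (intro add_mono cb tail \<nu>)
      also have "\<dots> \<le> 2 * b + 2 * b * 1"
        using b0 by (intro add_mono mult_left_mono power_le_one) auto
      finally show ?thesis by simp
    qed
    \<comment> \<open>Telescoping: \<open>F n\<close> is exactly what the first n coefficient
      sequences fail to reproduce.\<close>
    have Fn_eq: "f z = F n z + synthesis r (\<lambda>\<nu>. \<Sum>k<n. cs k \<nu>) z" for n z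
    proof (induction n)
      case 0
      then show ?case by (simp add: F0 synthesis_def)
    next
      case (Suc n)
      have "synthesis r (\<lambda>\<nu>. (\<Sum>k<n. cs k \<nu>) + cs n \<nu>) z =
          synthesis r (\<lambda>\<nu>. \<Sum>k<n. cs k \<nu>) z + synthesis r (cs n) z"
        by (rule synthesis_add[OF r(1) partial_bound cs2])
      then show ?case using Suc.IH by (simp add: FS)
    qed
    have "f z = synthesis r c z" for z
    proof -
      obtain Cz where Cz: "\<And>c b. (\<forall>\<nu>\<in>lattice_pts r. norm (c \<nu>) \<le> b) \<Longrightarrow> norm (synthesis r c z) \<le> Cz * b"
        using synthesis_bound[OF r(1), of z] by blast
      define M where "M = (Cg * A * exp (\<kappa> * norm z)) powr (1 / p) * exp (\<alpha> / 2 * (norm z)\<^sup>2)"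
      \<comment> \<open>Two errors decay geometrically: \<open>F n z\<close> by
        \<open>pointwise_growth\<close>, and the missing coefficients through
        \<open>synthesis_bound\<close>.\<close>
      have bound: "norm (f z - synthesis r c z) \<le> (M + Cz * (2 * b)) * (1 / 4) ^ n" for n
      proof -
        have "synthesis r (\<lambda>\<nu>. (\<Sum>k<n. cs k \<nu>) + (c \<nu> - (\<Sum>k<n. cs k \<nu>))) z =
            synthesis r (\<lambda>\<nu>. \<Sum>k<n. cs k \<nu>) z + synthesis r (\<lambda>\<nu>. c \<nu> - (\<Sum>k<n. cs k \<nu>)) z"
          by (rule synthesis_add[OF r(1) partial_bound tail])
        then have "f z - synthesis r c z = F n z - synthesis r (\<lambda>\<nu>. c \<nu> - (\<Sum>k<n. cs k \<nu>)) z"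
          using Fn_eq[of z n] by simp
        also have "norm \<dots> \<le> norm (F n z) + norm (synthesis r (\<lambda>\<nu>. c \<nu> - (\<Sum>k<n. cs k \<nu>)) z)"
          by (rule norm_triangle_ineq4)
        also have "norm (synthesis r (\<lambda>\<nu>. c \<nu> - (\<Sum>k<n. cs k \<nu>)) z) \<le> Cz * (2 * b * (1 / 4) ^ n)"
          using tail by (intro Cz) blast
        also have "norm (F n z) \<le> M * (1 / 4) ^ n"
        proof -
          have q: "((4 powr (- p)) ^ n) = ((1 / 4) ^ n) powr p"
            by (simp add: powr_realpow[symmetric] powr_powr powr_minus powr_divide mult.commute
                inverse_eq_divide)
          have "G (F n) z powr p \<le> Cg * (A * (4 powr (- p)) ^ n) * exp (\<kappa> * norm z)"
            using Fn[of n] A by (intro gr) (auto simp: fock_space_iff)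
          also have "\<dots> = (Cg * A * exp (\<kappa> * norm z)) * ((1 / 4) ^ n) powr p"
            by (simp only: q mult_ac)
          finally have "G (F n) z \<le> (Cg * A * exp (\<kappa> * norm z)) powr (1 / p) * (1 / 4) ^ n"
            by (intro le_root_of_powr_le[OF p0]) auto
          from mult_right_mono[OF this, of "exp (\<alpha> / 2 * (norm z)\<^sup>2)"]
          have "G (F n) z * exp (\<alpha> / 2 * (norm z)\<^sup>2) \<le> M * (1 / 4) ^ n"
            by (simp only: M_def mult_ac exp_ge_zero)
          moreover have "norm (F n z) = G (F n) z * exp (\<alpha> / 2 * (norm z)\<^sup>2)"
            by (simp add: gauss_modulus_def mult.assoc mult_exp_exp)
          ultimately show ?thesis by simp
        qed
        finally show ?thesis by (simp add: algebra_simps)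
      qed
      have "(\<lambda>n. (M + Cz * (2 * b)) * (1 / 4) ^ n) \<longlonglongrightarrow> (M + Cz * (2 * b)) * 0"
        by (intro tendsto_mult tendsto_const LIMSEQ_power_zero) simp
      then have "norm (f z - synthesis r c z) \<le> 0"
        by (intro Lim_bounded2[where N = 0]) (use bound in auto)
      then show ?thesis by simp
    qed
    then have fS: "f = synthesis r c" by blast
    have lim: "(\<integral>\<^sup>+\<nu>. ennreal (norm (c \<nu>) powr p) \<partial>?L) \<le> ennreal (2 powr p * Ca * A)"
    proof -
      \<comment> \<open>The weights 2^(-n), of total mass 2, let the power mean inequality act on
        the sum over n. The factor 2^(n p) that this puts on the p-th powers is outweighed by their
        decay 4^(-n p).\<close>
      define k where "k = (\<lambda>n. (1 / 2) ^ n :: real)"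
      define g where "g = (\<lambda>\<nu> n. 2 ^ n * norm (cs n \<nu>))"
      have kg: "k n * g \<nu> n = norm (cs n \<nu>)" for n \<nu>
        by (simp add: k_def g_def power_divide)
      have k2: "(\<integral>\<^sup>+n. ennreal (k n) \<partial>count_space UNIV) = ennreal 2"
        using suminf_geometric[of "1 / 2 :: real"] unfolding k_def
        by (subst nn_integral_count_space_nat, subst suminf_ennreal2) (auto simp: summable_geometric)
      have "(\<integral>\<^sup>+\<nu>. ennreal (norm (c \<nu>) powr p) \<partial>?L) \<le>
          (\<integral>\<^sup>+\<nu>. ennreal (2 powr (p - 1)) * (\<integral>\<^sup>+n. ennreal (k n * g \<nu> n powr p) \<partial>count_space UNIV) \<partial>?L)"
      proof (intro nn_integral_mono)
        fix \<nu> assume "\<nu> \<in> space ?L"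
        then have \<nu>: "\<nu> \<in> lattice_pts r" by simp
        have "norm (c \<nu>) \<le> (\<Sum>n. norm (cs n \<nu>))"
          unfolding c_def by (rule summable_norm[OF sm[OF \<nu>]])
        also have "ennreal \<dots> = (\<integral>\<^sup>+n. ennreal (k n * g \<nu> n) \<partial>count_space UNIV)"
          unfolding kg by (subst nn_integral_count_space_nat, subst suminf_ennreal2) (auto simp: sm \<nu>)
        finally show "ennreal (norm (c \<nu>) powr p) \<le>
            ennreal (2 powr (p - 1)) * (\<integral>\<^sup>+n. ennreal (k n * g \<nu> n powr p) \<partial>count_space UNIV)"
          by (intro nn_integral_power_mean[OF p]) (auto simp: k2 ennreal_leI, auto simp: k_def g_def)
      qed
      also have "\<dots> = ennreal (2 powr (p - 1)) * (\<integral>\<^sup>+\<nu>. (\<integral>\<^sup>+n. ennreal (k n * g \<nu> n powr p) \<partial>count_space UNIV) \<partial>?L)"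
        by (intro nn_integral_cmult) auto
      also have "(\<integral>\<^sup>+\<nu>. (\<integral>\<^sup>+n. ennreal (k n * g \<nu> n powr p) \<partial>count_space UNIV) \<partial>?L) =
          (\<integral>\<^sup>+n. (\<integral>\<^sup>+\<nu>. ennreal (k n * g \<nu> n powr p) \<partial>?L) \<partial>count_space UNIV)"
        by (intro nn_integral_count_space_nn_integral) auto
      also have "\<dots> \<le> (\<integral>\<^sup>+n. ennreal (Ca * A) * ennreal (k n) \<partial>count_space UNIV)"
      proof (intro nn_integral_mono)
        fix n
        have "(\<integral>\<^sup>+\<nu>. ennreal (k n * g \<nu> n powr p) \<partial>?L) =
            (\<integral>\<^sup>+\<nu>. ennreal (k n * (2 ^ n) powr p) * ennreal (norm (cs n \<nu>) powr p) \<partial>?L)"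
          by (intro nn_integral_cong) (simp add: g_def k_def powr_mult mult.assoc flip: ennreal_mult)
        also have "\<dots> = ennreal (k n * (2 ^ n) powr p) * (\<integral>\<^sup>+\<nu>. ennreal (norm (cs n \<nu>) powr p) \<partial>?L)"
          by (intro nn_integral_cmult) auto
        also have "\<dots> \<le> ennreal (k n * (2 ^ n) powr p) * ennreal (Ca * (A * (4 powr (- p)) ^ n))"
          by (intro mult_left_mono cs1) simp
        also have "\<dots> = ennreal (k n * (2 ^ n) powr p * (Ca * (A * (4 powr (- p)) ^ n)))"
          using Ca A by (simp add: k_def flip: ennreal_mult)
        also have "\<dots> = ennreal ((Ca * A * k n) * ((2 ^ n) powr p * (4 powr (- p)) ^ n))"
          by (simp only: mult_ac)
        also have "\<dots> \<le> ennreal ((Ca * A * k n) * 1)"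
        proof (intro ennreal_leI mult_left_mono)
          have "(2 ^ n :: real) powr p * (4 powr (- p)) ^ n = 2 powr (real n * p) * 4 powr (- p * real n)"
            by (simp add: powr_realpow[symmetric] powr_powr)
          also have "\<dots> \<le> 4 powr (real n * p) * 4 powr (- p * real n)"
            using p by (intro mult_right_mono powr_mono2) auto
          also have "\<dots> = 1" by (simp add: mult.commute flip: powr_add)
          finally show "(2 ^ n :: real) powr p * (4 powr (- p)) ^ n \<le> 1" .
        qed (use Ca A in \<open>auto simp: k_def\<close>)
        also have "\<dots> = ennreal (Ca * A) * ennreal (k n)"
          using Ca A by (simp add: k_def flip: ennreal_mult)
        finally show "(\<integral>\<^sup>+\<nu>. ennreal (k n * g \<nu> n powr p) \<partial>?L) \<le> ennreal (Ca * A) * ennreal (k n)" .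
      qed
      also have "\<dots> = ennreal (Ca * A) * ennreal 2"
        by (subst nn_integral_cmult) (auto simp: k2)
      also have "ennreal (2 powr (p - 1)) * (ennreal (Ca * A) * ennreal 2) = ennreal (2 powr (p - 1) * (Ca * A * 2))"
        using Ca A by (simp add: ennreal_mult mult.assoc)
      also have "2 powr (p - 1) * (Ca * A * 2) = 2 powr p * Ca * A"
        by (simp add: powr_diff)
      finally show ?thesis by (simp add: mult_left_mono)
    qed
    then have "c \<in> lp_space p (lattice_pts r)"
      by (auto simp: lp_space_iff intro: le_less_trans)
    moreover have "ennreal (2 powr p * Ca * A) = ennreal (2 powr p * Ca) * (\<integral>\<^sup>+z. ennreal (G f z powr p) \<partial>\<mu>)"
      using A Ca by (simp add: ennreal_mult)
    ultimately show ?thesis using lim fS by auto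
  qed
  then show ?thesis
    using Ca by (intro exI[of _ "2 powr p * Ca"]) auto
qed

text \<open>A sequence in \<open>lp_space\<close> is bounded, so its series converges everywhere,
  and unconditional sums are unique. Existence and value of the sum thus reduce to
  \<open>synthesis\<close>.\<close>

lemma atomic_decomposition_iff:
  assumes "r > 0" "c \<in> lp_space p (lattice_pts r)"
  shows "atomic_decomposition p \<alpha> w r c f \<longleftrightarrow> f = synthesis r c"
proof
  assume "atomic_decomposition p \<alpha> w r c f"
  then show "f = synthesis r c"
    unfolding atomic_decomposition_def synthesis_def kernel_norm_def
    by (intro ext) (metis infsumI)
next
  assume "f = synthesis r c"
  moreover have "norm (c \<nu>) \<le> lp_norm p (lattice_pts r) c" if "\<nu> \<in> lattice_pts r" for \<nu>
    using norm_le_lp_norm[OF assms(2) _ that] p by simp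
  ultimately show "atomic_decomposition p \<alpha> w r c f"
    unfolding atomic_decomposition_def
    using has_sum_synthesis[OF assms(1), of c "lp_norm p (lattice_pts r) c"] by (simp add: kernel_norm_def)
qed

lemma synthesis_in_fock_space:
  assumes r: "r > 0"
  shows "\<exists>C>0. \<forall>c\<in>lp_space p (lattice_pts r). synthesis r c \<in> fock_space p \<alpha> w \<and>
    fock_norm p \<alpha> w (synthesis r c) \<le> C * lp_norm p (lattice_pts r) c"
proof -
  obtain C where C: "C > 0" and bd: "\<And>c b. (\<forall>\<nu>\<in>lattice_pts r. norm (c \<nu>) \<le> b) \<Longrightarrow>
    (\<integral>\<^sup>+z. ennreal (G (synthesis r c) z powr p) \<partial>\<mu>) \<le>
    ennreal C * (\<integral>\<^sup>+\<nu>. ennreal (norm (c \<nu>) powr p) \<partial>count_space (lattice_pts r))"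
    using synthesis_norm_bound[OF r] by blast
  have "synthesis r c \<in> fock_space p \<alpha> w \<and>
    fock_norm p \<alpha> w (synthesis r c) \<le> C powr (1 / p) * lp_norm p (lattice_pts r) c"
    if c: "c \<in> lp_space p (lattice_pts r)" for c
  proof -
    have cb: "norm (c \<nu>) \<le> lp_norm p (lattice_pts r) c" if "\<nu> \<in> lattice_pts r" for \<nu>
      using norm_le_lp_norm[OF c _ that] p by simp
    have l: "ennreal (lp_norm p (lattice_pts r) c powr p) =
        (\<integral>\<^sup>+\<nu>. ennreal (norm (c \<nu>) powr p) \<partial>count_space (lattice_pts r))"
      using p by (intro lp_norm_powr c) simp
    have le: "(\<integral>\<^sup>+z. ennreal (G (synthesis r c) z powr p) \<partial>\<mu>) \<le> ennreal (C * lp_norm p (lattice_pts r) c powr p)"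
      using bd[of c "lp_norm p (lattice_pts r) c"] cb C by (simp add: ennreal_mult l)
    then have F: "synthesis r c \<in> fock_space p \<alpha> w"
      using holomorphic_synthesis[OF r cb] by (auto simp: fock_space_iff intro: le_less_trans)
    have "fock_norm p \<alpha> w (synthesis r c) powr p \<le> C * lp_norm p (lattice_pts r) c powr p"
      using le C unfolding fock_norm_powr[OF F, symmetric] by (subst (asm) ennreal_le_iff) auto
    then show ?thesis
      using F p by (auto intro!: le_root_of_powr_le simp: fock_norm_def lp_norm_def)
  qed
  then show ?thesis
    using C by (intro exI[of _ "C powr (1 / p)"]) auto
qed

lemma atomic_decomposition_all_fine_lattices:
  shows "\<exists>r\<^sub>0>0. \<forall>r. 0 < r \<and> r < r\<^sub>0 \<longrightarrow>
    (\<forall>c \<in> lp_space p (lattice_pts r). \<exists>f. atomic_decomposition p \<alpha> w r c f) \<and>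
    fock_space p \<alpha> w =
      {f. \<exists>c \<in> lp_space p (lattice_pts r). atomic_decomposition p \<alpha> w r c f} \<and>
    (\<exists>C\<ge>1. \<forall>f \<in> fock_space p \<alpha> w.
      (let I = (INF c \<in> {c \<in> lp_space p (lattice_pts r). atomic_decomposition p \<alpha> w r c f}.
                  lp_norm p (lattice_pts r) c)
       in fock_norm p \<alpha> w f / C \<le> I \<and> I \<le> C * fock_norm p \<alpha> w f))"
proof -
  obtain E where E: "E > 0" and err: "\<And>r f. 0 < r \<Longrightarrow> r \<le> 1 / 2 \<Longrightarrow> f \<in> fock_space p \<alpha> w \<Longrightarrow>
    (\<integral>\<^sup>+z. ennreal (G (\<lambda>z. f z - synthesis r (analysis_coeff r f) z) z powr p) \<partial>\<mu>) \<le>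
    ennreal (E * r powr p) * (\<integral>\<^sup>+z. ennreal (G f z powr p) \<partial>\<mu>)"
    using discretization_norm_bound by blast
  \<comment> \<open>The bound 1/2 is the range of \<open>discretization_norm_bound\<close>; the
    other one makes E r^p <= 4^(-p).\<close>
  define r0 where "r0 = min (1 / 2) (E powr (- 1 / p) / 4)"
  show ?thesis
  proof (rule exI[of _ r0], intro conjI allI impI)
    show "0 < r0" using E by (simp add: r0_def)
  next
    fix r assume "0 < r \<and> r < r0"
    then have r: "0 < r" "r \<le> 1 / 2" "r \<le> E powr (- 1 / p) / 4" by (auto simp: r0_def)
    have "E * r powr p \<le> E * (E powr (- 1 / p) / 4) powr p"
      using r E p by (intro mult_left_mono powr_mono2) auto
    also have "\<dots> = 4 powr (- p)"
      using E p by (simp add: powr_divide powr_mult powr_powr powr_minus_divide)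
    finally have Er: "E * r powr p \<le> 4 powr (- p)" .
    have contr: "(\<integral>\<^sup>+z. ennreal (G (\<lambda>z. f z - synthesis r (analysis_coeff r f) z) z powr p) \<partial>\<mu>) \<le>
      ennreal (4 powr (- p)) * (\<integral>\<^sup>+z. ennreal (G f z powr p) \<partial>\<mu>)" if "f \<in> fock_space p \<alpha> w" for f
      using err[OF r(1,2) that] Er by (meson ennreal_leI mult_right_mono order_trans zero_le)
    obtain C1 where C1: "C1 > 0" and syn: "\<And>c. c \<in> lp_space p (lattice_pts r) \<Longrightarrow>
        synthesis r c \<in> fock_space p \<alpha> w \<and>
        fock_norm p \<alpha> w (synthesis r c) \<le> C1 * lp_norm p (lattice_pts r) c"
      using synthesis_in_fock_space[OF r(1)] by blast
    obtain C2 where C2: "C2 > 0" and dec: "\<And>f. f \<in> fock_space p \<alpha> w \<Longrightarrow> \<exists>c\<in>lp_space p (lattice_pts r).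
      (\<integral>\<^sup>+\<nu>. ennreal (norm (c \<nu>) powr p) \<partial>count_space (lattice_pts r)) \<le> ennreal C2 * (\<integral>\<^sup>+z. ennreal (G f z powr p) \<partial>\<mu>) \<and>
      f = synthesis r c"
      using decomposition_with_bound[OF r(1,2) contr] by blast
    note iff = atomic_decomposition_iff[OF r(1)]
    show "\<forall>c \<in> lp_space p (lattice_pts r). \<exists>f. atomic_decomposition p \<alpha> w r c f"
      using iff by blast
    show "fock_space p \<alpha> w = {f. \<exists>c \<in> lp_space p (lattice_pts r). atomic_decomposition p \<alpha> w r c f}"
    proof (intro set_eqI iffI)
      fix f assume "f \<in> fock_space p \<alpha> w"
      then obtain c where "c \<in> lp_space p (lattice_pts r)" "f = synthesis r c"
        using dec by blast
      then show "f \<in> {f. \<exists>c \<in> lp_space p (lattice_pts r). atomic_decomposition p \<alpha> w r c f}"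
        using iff[of c f] by auto
    next
      fix f assume "f \<in> {f. \<exists>c \<in> lp_space p (lattice_pts r). atomic_decomposition p \<alpha> w r c f}"
      then obtain c where c: "c \<in> lp_space p (lattice_pts r)" "atomic_decomposition p \<alpha> w r c f"
        by blast
      then have "f = synthesis r c" using iff[OF c(1), of f] by simp
      then show "f \<in> fock_space p \<alpha> w" using syn[OF c(1)] by simp
    qed
    define C where "C = max 1 (max C1 (C2 powr (1 / p)))"
    have C: "C \<ge> 1" "C \<ge> C1" "C \<ge> C2 powr (1 / p)" by (auto simp: C_def)
    show "\<exists>C\<ge>1. \<forall>f \<in> fock_space p \<alpha> w.
      (let I = (INF c \<in> {c \<in> lp_space p (lattice_pts r). atomic_decomposition p \<alpha> w r c f}.
                  lp_norm p (lattice_pts r) c)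
       in fock_norm p \<alpha> w f / C \<le> I \<and> I \<le> C * fock_norm p \<alpha> w f)"
    proof (intro exI[of _ C] conjI ballI C(1))
      fix f assume f: "f \<in> fock_space p \<alpha> w"
      let ?A = "{c \<in> lp_space p (lattice_pts r). atomic_decomposition p \<alpha> w r c f}"
      obtain c where c: "c \<in> lp_space p (lattice_pts r)" "f = synthesis r c"
        and cle: "(\<integral>\<^sup>+\<nu>. ennreal (norm (c \<nu>) powr p) \<partial>count_space (lattice_pts r)) \<le> ennreal C2 * (\<integral>\<^sup>+z. ennreal (G f z powr p) \<partial>\<mu>)"
        using dec[OF f] by blast
      have cA: "c \<in> ?A" using c iff[OF c(1), of f] by simp
      have nonneg: "0 \<le> fock_norm p \<alpha> w f" "0 \<le> lp_norm p (lattice_pts r) d" for d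
        by (auto simp: fock_norm_def lp_norm_def)
      have "ennreal (lp_norm p (lattice_pts r) c powr p) \<le> ennreal (C2 * fock_norm p \<alpha> w f powr p)"
        using cle lp_norm_powr[OF c(1)] p fock_norm_powr[OF f] C2 by (simp add: ennreal_mult)
      then have "lp_norm p (lattice_pts r) c powr p \<le> C2 * fock_norm p \<alpha> w f powr p"
        using C2 by (subst (asm) ennreal_le_iff) auto
      then have "lp_norm p (lattice_pts r) c \<le> C2 powr (1 / p) * fock_norm p \<alpha> w f"
        using p nonneg by (intro le_root_of_powr_le) auto
      also have "\<dots> \<le> C * fock_norm p \<alpha> w f"
        by (intro mult_right_mono C nonneg)
      finally have up: "lp_norm p (lattice_pts r) c \<le> C * fock_norm p \<alpha> w f" .
      have low: "fock_norm p \<alpha> w f / C \<le> lp_norm p (lattice_pts r) d" if "d \<in> ?A" for d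
      proof -
        have "d \<in> lp_space p (lattice_pts r)" "f = synthesis r d" using that iff[of d f] by auto
        then have "fock_norm p \<alpha> w f \<le> C1 * lp_norm p (lattice_pts r) d"
          using syn by blast
        also have "\<dots> \<le> C * lp_norm p (lattice_pts r) d"
          by (intro mult_right_mono C nonneg)
        finally show ?thesis using C(1) by (simp add: field_simps)
      qed
      \<comment> \<open>The infimum is over real numbers: \<open>c\<close> makes the set nonempty,
        and 0 is a lower bound of the norms.\<close>
      have "fock_norm p \<alpha> w f / C \<le> (INF c\<in>?A. lp_norm p (lattice_pts r) c)"
        using cA low by (intro cINF_greatest) auto
      moreover have "(INF c\<in>?A. lp_norm p (lattice_pts r) c) \<le> C * fock_norm p \<alpha> w f"
        by (rule cINF_lower2[where f = "lp_norm p (lattice_pts r)", OF _ cA up])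
           (rule bdd_belowI2[where m = 0], rule nonneg)
      ultimately show "let I = (INF c\<in>?A. lp_norm p (lattice_pts r) c)
          in fock_norm p \<alpha> w f / C \<le> I \<and> I \<le> C * fock_norm p \<alpha> w f"
        by (simp add: Let_def)
    qed
  qed
qed

end

text \<open>The first clause ensures that the set equality does not silently pass over sequences
  whose series diverge; by the second, the real infimum is taken over a nonempty set.\<close>

theorem theorem5p5:
  fixes p \<alpha> :: real and w :: "complex \<Rightarrow> real"
  assumes "1 < p" and "0 < \<alpha>" and "w \<in> Ap_restricted p"
  shows "\<exists>r\<^sub>0>0. \<forall>r. 0 < r \<and> r < r\<^sub>0 \<longrightarrow>
    (\<forall>c \<in> lp_space p (lattice_pts r). \<exists>f. atomic_decomposition p \<alpha> w r c f) \<and>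
    fock_space p \<alpha> w =
      {f. \<exists>c \<in> lp_space p (lattice_pts r). atomic_decomposition p \<alpha> w r c f} \<and>
    (\<exists>C\<ge>1. \<forall>f \<in> fock_space p \<alpha> w.
      (let I = (INF c \<in> {c \<in> lp_space p (lattice_pts r). atomic_decomposition p \<alpha> w r c f}.
                  lp_norm p (lattice_pts r) c)
       in fock_norm p \<alpha> w f / C \<le> I \<and> I \<le> C * fock_norm p \<alpha> w f))"
proof (rule Ap_restricted_reverse_holder[OF assms(1,3)])
  fix s B :: real
  assume sB: "0 < s" "0 < B"
    "\<And>a. emeasure (weighted_measure w) (centred_square s a) < \<infinity>"
    "\<And>a. 0 < measure (weighted_measure w) (centred_square s a)"
    "\<And>a (g :: complex \<Rightarrow> real) x. g \<in> borel_measurable borel \<Longrightarrow> (\<And>u. 0 \<le> g u) \<Longrightarrow> 0 \<le> x \<Longrightarrow>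
      ennreal x \<le> (\<integral>\<^sup>+u\<in>centred_square s a. ennreal (g u) \<partial>lborel) \<Longrightarrow>
      ennreal (measure (weighted_measure w) (centred_square s a) * x powr p) \<le>
      ennreal B * (\<integral>\<^sup>+u\<in>centred_square s a. ennreal (g u powr p) \<partial>weighted_measure w)"
  have w: "w \<in> borel_measurable lebesgue" "\<And>z. 0 \<le> w z"
    using assms(3) by (auto simp: Ap_restricted_def weight_def)
  interpret ap_weight p \<alpha> s B w
    by (rule ap_weight.intro) (fact assms sB w)+
  show ?thesis
    by (rule atomic_decomposition_all_fine_lattices)
qed

end
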